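(* Let $(M,g_M,J)$ be an almost Hermitian manifold, $(N,g_N)$ a Riemannian manifold, and $F:(M,g_M,J)\to(N,g_N)$ a semi-slant Riemannian map, with $\ker F_*=\mathcal{D}_1\oplus\mathcal{D}_2$ and semi-slant angle $\theta\in[0,\frac{\pi}{2})$. Define the endomorphism $\widehat{J}$ of $\ker F_*$ by $\widehat{J}:=JP+\sec\theta\,\phi Q$. Then for every $x\in F(M)$ the fiber $(F^{-1}(x),\widehat{J})$ is an almost complex manifold (where $\widehat{J}$ acts on the tangent bundle of the fiber, which is the restriction of $\ker F_*$ to the fiber).
   Context: A $C^\infty$-map $F:(M,g_M)\to(N,g_N)$ between Riemannian manifolds is a Riemannian map if for each $p\in M$ the map $(F_* )_p:(\ker (F_* )_p)^{\perp}\to (F_* )_p((\ker (F_* )_p)^{\perp})\subset T_{F(p)}N$ is a linear isometry with respect to $g_M$ and $g_N$. If $(M,g_M,J)$ is almost Hermitian, a Riemannian map $F$ is a semi-slant Riemannian map if there is a distribution $\mathcal{D}_1\subset\ker F_*$ such that $\ker F_*=\mathcal{D}_1\oplus\mathcal{D}_2$, $J(\mathcal{D}_1)=\mathcal{D}_1$, where $\mathcal{D}_2$ is the orthogonal complement of $\mathcal{D}_1$ in $\ker F_*$, and the angle $\theta=\theta(X)$ between $JX$ and the space $(\mathcal{D}_2)_p$ (so $\cos\theta$ is the norm of the orthogonal projection of $JX$ to $(\mathcal{D}_2)_p$ divided by $|JX|$) is constant for all nonzero $X\in(\mathcal{D}_2)_p$ and $p\in M$; $\theta$ is called the semi-slant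 angle. Notation: for $X\in\Gamma(\ker F_* )$ write $X=PX+QX$ with $PX\in\Gamma(\mathcal{D}_1)$, $QX\in\Gamma(\mathcal{D}_2)$, and $JX=\phi X+\omega X$ with $\phi X\in\Gamma(\ker F_* )$, $\omega X\in\Gamma((\ker F_* )^{\perp})$. An almost complex manifold is a manifold together with a smooth endomorphism of its tangent bundle whose square is $-\mathrm{id}$. *)

theory Defs
  imports "HOL-Analysis.Analysis" "HOL-Library.Function_Algebras"
begin

section \<open>Pointwise real vector space structure on functions\<close>

instantiation "fun" :: (type, real_vector) real_vector
begin

definition scaleR_fun :: "real \<Rightarrow> ('a \<Rightarrow> 'b) \<Rightarrow> 'a \<Rightarrow> 'b"
  where "scaleR_fun r f = (\<lambda>x. r *\<^sub>R f x)"

instance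
  by standard (auto simp: scaleR_fun_def plus_fun_def fun_eq_iff algebra_simps)

end

definition linear_on :: "'v::real_vector set \<Rightarrow> ('v \<Rightarrow> 'w::real_vector) \<Rightarrow> bool"
  where "linear_on V f \<longleftrightarrow>
    (\<forall>u\<in>V. \<forall>v\<in>V. f (u + v) = f u + f v) \<and> (\<forall>a. \<forall>v\<in>V. f (a *\<^sub>R v) = a *\<^sub>R f v)"

definition direct_sum :: "'v::real_vector set \<Rightarrow> 'v set \<Rightarrow> 'v set \<Rightarrow> bool"
  where "direct_sum V A B \<longleftrightarrow>
    subspace A \<and> subspace B \<and> V = {a + b | a b. a \<in> A \<and> b \<in> B} \<and> A \<inter> B = {0}"

text \<open>The \<open>A\<close>-component of a vector of \<open>A \<oplus> B\<close>.\<close>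

definition component :: "'v::real_vector set \<Rightarrow> 'v set \<Rightarrow> 'v \<Rightarrow> 'v"
  where "component A B v = (THE a. a \<in> A \<and> v - a \<in> B)"


section \<open>Smooth maps between subsets of Euclidean spaces\<close>

primrec times_differentiable_on ::
    "nat \<Rightarrow> 'v::euclidean_space set \<Rightarrow> ('v \<Rightarrow> 'w::real_normed_vector) \<Rightarrow> bool"
  where
    "times_differentiable_on 0 U f \<longleftrightarrow> continuous_on U f"
  | "times_differentiable_on (Suc n) U f \<longleftrightarrow>
      (\<forall>y\<in>U. f differentiable (at y)) \<and>
      (\<forall>v. times_differentiable_on n U (\<lambda>y. frechet_derivative f (at y) v))"

text \<open>On an arbitrary set \<open>S\<close>, smoothness means that \<open>f\<close> extends, locally around each point of
  \<open>S\<close>, to a \<open>C\<^sup>\<infinity>\<close>-map on an open subset of the ambient space.  For \<open>S\<close> open, or relatively open in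
  a linear subspace, this is the usual notion of a \<open>C\<^sup>\<infinity>\<close>-map.\<close>

definition smooth_on :: "'v::euclidean_space set \<Rightarrow> ('v \<Rightarrow> 'w::real_normed_vector) \<Rightarrow> bool"
  where "smooth_on S f \<longleftrightarrow>
    (\<forall>x\<in>S. \<exists>U f'. open U \<and> x \<in> U \<and> (\<forall>n. times_differentiable_on n U f') \<and>
      (\<forall>y\<in>S \<inter> U. f' y = f y))"


section \<open>Smooth manifolds\<close>

text \<open>A chart takes values in a linear subspace (its model space) of a Euclidean space \<open>'e\<close>.  In this
  way manifolds of all dimensions up to \<open>DIM('e)\<close>, including \<open>0\<close>, are available over one type,
  and a manifold and its submanifolds can be treated uniformly.\<close>

datatype ('a, 'e) chart =
  Chart (chart_dom: "'a set") (chart_model: "'e set") (chart_map: "'a \<Rightarrow> 'e")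

record ('a, 'e) manifold =
  mtop :: "'a topology"
  atlas :: "('a, 'e) chart set"

abbreviation points :: "('a, 'e) manifold \<Rightarrow> 'a set"
  where "points M \<equiv> topspace (mtop M)"

definition chart_inv :: "('a, 'e) chart \<Rightarrow> 'e \<Rightarrow> 'a"
  where "chart_inv c = inv_into (chart_dom c) (chart_map c)"

definition is_chart :: "'a topology \<Rightarrow> ('a, 'e::euclidean_space) chart \<Rightarrow> bool"
  where "is_chart X c \<longleftrightarrow>
    openin X (chart_dom c) \<and> subspace (chart_model c) \<and>
    openin (top_of_set (chart_model c)) (chart_map c ` chart_dom c) \<and>
    homeomorphic_map (subtopology X (chart_dom c)) (top_of_set (chart_map c ` chart_dom c))
      (chart_map c)"

definition charts_at :: "('a, 'e) manifold \<Rightarrow> 'a \<Rightarrow> ('a, 'e) chart set"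
  where "charts_at M p = {c \<in> atlas M. p \<in> chart_dom c}"

text \<open>The expression of \<open>f\<close> in charts \<open>c\<close> (source) and \<open>d\<close> (target), its natural domain,
  and its derivative at the point with coordinates \<open>chart_map c p\<close>.  The derivative is taken within
  a relatively open subset of the model space of \<open>c\<close>, so it is determined only on vectors of this
  model space; it is used only for those.\<close>

definition rep :: "('a, 'e) chart \<Rightarrow> ('b, 'f) chart \<Rightarrow> ('a \<Rightarrow> 'b) \<Rightarrow> 'e \<Rightarrow> 'f"
  where "rep c d f = (\<lambda>y. chart_map d (f (chart_inv c y)))"

definition rep_dom :: "('a, 'e) chart \<Rightarrow> ('b, 'f) chart \<Rightarrow> ('a \<Rightarrow> 'b) \<Rightarrow> 'e set"
  where "rep_dom c d f = chart_map c ` (chart_dom c \<inter> f -` chart_dom d)"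

definition rep_deriv ::
    "('a, 'e::euclidean_space) chart \<Rightarrow> ('b, 'f::euclidean_space) chart \<Rightarrow> ('a \<Rightarrow> 'b) \<Rightarrow> 'a \<Rightarrow> 'e \<Rightarrow> 'f"
  where "rep_deriv c d f p =
    frechet_derivative (rep c d f) (at (chart_map c p) within rep_dom c d f)"

text \<open>Charts around the same point have model spaces of the same dimension, but a disconnected
  manifold may have components of different dimensions; see \<open>has_dimension\<close> for pure dimension.\<close>

definition smooth_manifold :: "('a, 'e::euclidean_space) manifold \<Rightarrow> bool"
  where "smooth_manifold M \<longleftrightarrow>
    Hausdorff_space (mtop M) \<and> second_countable (mtop M) \<and>
    (\<forall>c\<in>atlas M. is_chart (mtop M) c) \<and>
    (\<Union>c\<in>atlas M. chart_dom c) = points M \<and>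
    (\<forall>c\<in>atlas M. \<forall>d\<in>atlas M. smooth_on (rep_dom c d id) (rep c d id))"

definition has_dimension :: "('a, 'e::euclidean_space) manifold \<Rightarrow> nat \<Rightarrow> bool"
  where "has_dimension M k \<longleftrightarrow> (\<forall>c\<in>atlas M. chart_dom c \<noteq> {} \<longrightarrow> dim (chart_model c) = k)"

definition smooth_map ::
    "('a, 'e::euclidean_space) manifold \<Rightarrow> ('b, 'f::euclidean_space) manifold \<Rightarrow> ('a \<Rightarrow> 'b) \<Rightarrow> bool"
  where "smooth_map M N f \<longleftrightarrow>
    continuous_map (mtop M) (mtop N) f \<and>
    (\<forall>c\<in>atlas M. \<forall>d\<in>atlas N. smooth_on (rep_dom c d f) (rep c d f))"


section \<open>Tangent spaces and differentials\<close>

text \<open>A tangent vector at \<open>p\<close> is a family of coordinate vectors, one for each chart around \<open>p\<close>,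
  related by the derivatives of the coordinate changes.  The entries at charts not
  containing \<open>p\<close> carry no information and are set to \<open>0\<close>.\<close>

type_synonym ('a, 'e) tangent_vector = "('a, 'e) chart \<Rightarrow> 'e"

definition tangent_space ::
    "('a, 'e::euclidean_space) manifold \<Rightarrow> 'a \<Rightarrow> ('a, 'e) tangent_vector set"
  where "tangent_space M p = {v.
    (\<forall>c\<in>charts_at M p. v c \<in> chart_model c) \<and>
    (\<forall>c. c \<notin> charts_at M p \<longrightarrow> v c = 0) \<and>
    (\<forall>c\<in>charts_at M p. \<forall>d\<in>charts_at M p. v d = rep_deriv c d id p (v c))}"

definition differential ::
    "('a, 'e::euclidean_space) manifold \<Rightarrow> ('b, 'f::euclidean_space) manifold \<Rightarrow> ('a \<Rightarrow> 'b) \<Rightarrow> 'a \<Rightarrow>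
     ('a, 'e) tangent_vector \<Rightarrow> ('b, 'f) tangent_vector"
  where "differential M N f p v = (THE w. w \<in> tangent_space N (f p) \<and>
    (\<forall>c\<in>charts_at M p. \<forall>d\<in>charts_at N (f p). w d = rep_deriv c d f p (v c)))"

definition smooth_function :: "('a, 'e::euclidean_space) manifold \<Rightarrow> 'a set \<Rightarrow> ('a \<Rightarrow> real) \<Rightarrow> bool"
  where "smooth_function M U h \<longleftrightarrow>
    (\<forall>c\<in>atlas M. smooth_on (chart_map c ` (chart_dom c \<inter> U)) (\<lambda>y. h (chart_inv c y)))"

definition smooth_vector_field ::
    "('a, 'e::euclidean_space) manifold \<Rightarrow> 'a set \<Rightarrow> ('a \<Rightarrow> ('a, 'e) tangent_vector) \<Rightarrow> bool"
  where "smooth_vector_field M U X \<longleftrightarrow>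
    (\<forall>p\<in>U. X p \<in> tangent_space M p) \<and>
    (\<forall>c\<in>atlas M. smooth_on (chart_map c ` (chart_dom c \<inter> U)) (\<lambda>y. X (chart_inv c y) c))"

text \<open>A smooth subbundle of the tangent bundle, given by smooth local frames.\<close>

definition distribution ::
    "('a, 'e::euclidean_space) manifold \<Rightarrow> ('a \<Rightarrow> ('a, 'e) tangent_vector set) \<Rightarrow> bool"
  where "distribution M D \<longleftrightarrow>
    (\<forall>p\<in>points M. \<exists>U (n::nat) X. openin (mtop M) U \<and> p \<in> U \<and>
      (\<forall>i<n. smooth_vector_field M U (X i)) \<and>
      (\<forall>q\<in>U. inj_on (\<lambda>i. X i q) {..<n} \<and> independent ((\<lambda>i. X i q) ` {..<n}) \<and>
        D q = span ((\<lambda>i. X i q) ` {..<n})))"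


section \<open>Riemannian, almost complex and almost Hermitian manifolds\<close>

type_synonym ('a, 'e) metric =
  "'a \<Rightarrow> ('a, 'e) tangent_vector \<Rightarrow> ('a, 'e) tangent_vector \<Rightarrow> real"

type_synonym ('a, 'e) tangent_endo =
  "'a \<Rightarrow> ('a, 'e) tangent_vector \<Rightarrow> ('a, 'e) tangent_vector"

definition riemannian_metric ::
    "('a, 'e::euclidean_space) manifold \<Rightarrow> ('a, 'e) metric \<Rightarrow> bool"
  where "riemannian_metric M g \<longleftrightarrow>
    (\<forall>p\<in>points M. \<forall>u\<in>tangent_space M p.
      linear_on (tangent_space M p) (g p u) \<and>
      (\<forall>v\<in>tangent_space M p. g p u v = g p v u) \<and>
      (u \<noteq> 0 \<longrightarrow> g p u u > 0)) \<and>
    (\<forall>U X Y. openin (mtop M) U \<and> smooth_vector_field M U X \<and> smooth_vector_field M U Y \<longrightarrow>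
      smooth_function M U (\<lambda>p. g p (X p) (Y p)))"

definition riemannian_manifold ::
    "('a, 'e::euclidean_space) manifold \<Rightarrow> ('a, 'e) metric \<Rightarrow> bool"
  where "riemannian_manifold M g \<longleftrightarrow> smooth_manifold M \<and> riemannian_metric M g"

definition smooth_endomorphism ::
    "('a, 'e::euclidean_space) manifold \<Rightarrow> ('a, 'e) tangent_endo \<Rightarrow> bool"
  where "smooth_endomorphism M J \<longleftrightarrow>
    (\<forall>p\<in>points M. J p ` tangent_space M p \<subseteq> tangent_space M p \<and>
      linear_on (tangent_space M p) (J p)) \<and>
    (\<forall>U X. openin (mtop M) U \<and> smooth_vector_field M U X \<longrightarrow>
      smooth_vector_field M U (\<lambda>p. J p (X p)))"

definition almost_complex_manifold ::
    "('a, 'e::euclidean_space) manifold \<Rightarrow> ('a, 'e) tangent_endo \<Rightarrow> bool"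
  where "almost_complex_manifold M J \<longleftrightarrow>
    smooth_manifold M \<and> smooth_endomorphism M J \<and>
    (\<forall>p\<in>points M. \<forall>v\<in>tangent_space M p. J p (J p v) = - v)"

definition almost_hermitian_manifold ::
    "('a, 'e::euclidean_space) manifold \<Rightarrow> ('a, 'e) metric \<Rightarrow> ('a, 'e) tangent_endo \<Rightarrow> bool"
  where "almost_hermitian_manifold M g J \<longleftrightarrow>
    riemannian_manifold M g \<and> almost_complex_manifold M J \<and>
    (\<forall>p\<in>points M. \<forall>u\<in>tangent_space M p. \<forall>v\<in>tangent_space M p. g p (J p u) (J p v) = g p u v)"

definition orth_compl :: "('v \<Rightarrow> 'v \<Rightarrow> real) \<Rightarrow> 'v set \<Rightarrow> 'v set \<Rightarrow> 'v set"
  where "orth_compl b V A = {v \<in> V. \<forall>a\<in>A. b v a = 0}"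


section \<open>Riemannian maps and semi-slant Riemannian maps\<close>

definition vertical_space ::
    "('a, 'e::euclidean_space) manifold \<Rightarrow> ('b, 'f::euclidean_space) manifold \<Rightarrow> ('a \<Rightarrow> 'b) \<Rightarrow>
     'a \<Rightarrow> ('a, 'e) tangent_vector set"
  where "vertical_space M N F p = {v \<in> tangent_space M p. differential M N F p v = 0}"

definition horizontal_space ::
    "('a, 'e::euclidean_space) manifold \<Rightarrow> ('a, 'e) metric \<Rightarrow> ('b, 'f::euclidean_space) manifold \<Rightarrow>
     ('a \<Rightarrow> 'b) \<Rightarrow> 'a \<Rightarrow> ('a, 'e) tangent_vector set"
  where "horizontal_space M g N F p =
    orth_compl (g p) (tangent_space M p) (vertical_space M N F p)"

definition riemannian_map ::
    "('a, 'e::euclidean_space) manifold \<Rightarrow> ('a, 'e) metric \<Rightarrow>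
     ('b, 'f::euclidean_space) manifold \<Rightarrow> ('b, 'f) metric \<Rightarrow> ('a \<Rightarrow> 'b) \<Rightarrow> bool"
  where "riemannian_map M gM N gN F \<longleftrightarrow>
    smooth_map M N F \<and>
    (\<forall>p\<in>points M. \<forall>u\<in>horizontal_space M gM N F p. \<forall>v\<in>horizontal_space M gM N F p.
      gN (F p) (differential M N F p u) (differential M N F p v) = gM p u v)"

definition D2_of ::
    "('a, 'e::euclidean_space) manifold \<Rightarrow> ('a, 'e) metric \<Rightarrow> ('b, 'f::euclidean_space) manifold \<Rightarrow>
     ('a \<Rightarrow> 'b) \<Rightarrow> ('a \<Rightarrow> ('a, 'e) tangent_vector set) \<Rightarrow> 'a \<Rightarrow> ('a, 'e) tangent_vector set"
  where "D2_of M g N F D1 p = orth_compl (g p) (vertical_space M N F p) (D1 p)"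

text \<open>The angle between a nonzero tangent vector \<open>v\<close> and the subspace \<open>A\<close> of the tangent space.\<close>

definition angle_to_subspace ::
    "('a, 'e::euclidean_space) manifold \<Rightarrow> ('a, 'e) metric \<Rightarrow> 'a \<Rightarrow>
     ('a, 'e) tangent_vector \<Rightarrow> ('a, 'e) tangent_vector set \<Rightarrow> real"
  where "angle_to_subspace M g p v A =
    (let w = component A (orth_compl (g p) (tangent_space M p) A) v
     in arccos (sqrt (g p w w) / sqrt (g p v v)))"

definition semi_slant_riemannian_map ::
    "('a, 'e::euclidean_space) manifold \<Rightarrow> ('a, 'e) metric \<Rightarrow> ('a, 'e) tangent_endo \<Rightarrow>
     ('b, 'f::euclidean_space) manifold \<Rightarrow> ('b, 'f) metric \<Rightarrow> ('a \<Rightarrow> 'b) \<Rightarrow>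
     ('a \<Rightarrow> ('a, 'e) tangent_vector set) \<Rightarrow> real \<Rightarrow> bool"
  where "semi_slant_riemannian_map M gM J N gN F D1 \<theta> \<longleftrightarrow>
    riemannian_map M gM N gN F \<and>
    distribution M D1 \<and>
    (\<forall>p\<in>points M.
      D1 p \<subseteq> vertical_space M N F p \<and>
      direct_sum (vertical_space M N F p) (D1 p) (D2_of M gM N F D1 p) \<and>
      J p ` D1 p = D1 p \<and>
      (\<forall>v\<in>D2_of M gM N F D1 p. v \<noteq> 0 \<longrightarrow>
        angle_to_subspace M gM p (J p v) (D2_of M gM N F D1 p) = \<theta>))"

definition P_part ::
    "('a, 'e::euclidean_space) manifold \<Rightarrow> ('a, 'e) metric \<Rightarrow> ('b, 'f::euclidean_space) manifold \<Rightarrow>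
     ('a \<Rightarrow> 'b) \<Rightarrow> ('a \<Rightarrow> ('a, 'e) tangent_vector set) \<Rightarrow> ('a, 'e) tangent_endo"
  where "P_part M g N F D1 p = component (D1 p) (D2_of M g N F D1 p)"

definition Q_part ::
    "('a, 'e::euclidean_space) manifold \<Rightarrow> ('a, 'e) metric \<Rightarrow> ('b, 'f::euclidean_space) manifold \<Rightarrow>
     ('a \<Rightarrow> 'b) \<Rightarrow> ('a \<Rightarrow> ('a, 'e) tangent_vector set) \<Rightarrow> ('a, 'e) tangent_endo"
  where "Q_part M g N F D1 p = component (D2_of M g N F D1 p) (D1 p)"

definition phi_part ::
    "('a, 'e::euclidean_space) manifold \<Rightarrow> ('a, 'e) metric \<Rightarrow> ('a, 'e) tangent_endo \<Rightarrow>
     ('b, 'f::euclidean_space) manifold \<Rightarrow> ('a \<Rightarrow> 'b) \<Rightarrow> ('a, 'e) tangent_endo"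
  where "phi_part M g J N F p v =
    component (vertical_space M N F p) (horizontal_space M g N F p) (J p v)"

definition J_hat ::
    "('a, 'e::euclidean_space) manifold \<Rightarrow> ('a, 'e) metric \<Rightarrow> ('a, 'e) tangent_endo \<Rightarrow>
     ('b, 'f::euclidean_space) manifold \<Rightarrow> ('a \<Rightarrow> 'b) \<Rightarrow>
     ('a \<Rightarrow> ('a, 'e) tangent_vector set) \<Rightarrow> real \<Rightarrow> ('a, 'e) tangent_endo"
  where "J_hat M g J N F D1 \<theta> p v =
    J p (P_part M g N F D1 p v) + (1 / cos \<theta>) *\<^sub>R phi_part M g J N F p (Q_part M g N F D1 p v)"


section \<open>Embedded submanifolds and fibers\<close>

text \<open>Carrying the subspace topology is part of the definition, so the inclusion is a
  topological embedding.\<close>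

definition embedded_submanifold ::
    "('a, 'e::euclidean_space) manifold \<Rightarrow> 'a set \<Rightarrow> ('a, 'e) manifold \<Rightarrow> bool"
  where "embedded_submanifold M S B \<longleftrightarrow>
    S \<subseteq> points M \<and> mtop B = subtopology (mtop M) S \<and>
    smooth_manifold B \<and> smooth_map B M id \<and>
    (\<forall>p\<in>S. inj_on (differential B M id p) (tangent_space B p))"

definition fiber :: "('a, 'e) manifold \<Rightarrow> ('a \<Rightarrow> 'b) \<Rightarrow> 'b \<Rightarrow> 'a set"
  where "fiber M F x = {p \<in> points M. F p = x}"

end

theory Submission
  imports Defs
begin

text \<open>
  A Riemannian map is isometric on its horizontal spaces, so preimages under its differential can be
  chosen with locally uniformly bounded norm.  This keeps the rank from increasing near a point, and
  the usual constant rank argument (straighten the map by the inverse function theorem) exhibits each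
  fiber locally as a graph over the kernel of the differential; projecting onto that kernel gives the
  charts of the fiber.  Pointwise, constancy of the angle means that \<open>\<phi>\<close> scales norms on \<open>D\<^sub>2\<close> by
  \<open>cos \<theta>\<close>; as \<open>\<phi>\<close> is skew-symmetric and preserves \<open>D\<^sub>2\<close>, polarization yields
  \<open>\<phi>\<^sup>2 = - cos\<^sup>2 \<theta>\<close> there.  The projections that enter \<open>J_hat\<close> are smooth because they are
  Gram-Schmidt projections onto spans of smooth frames.
\<close>

section \<open>Gram-Schmidt projection\<close>

text \<open>Three obstacles shape the proof. Charts take values in subspaces of a Euclidean space,
  so a derivative is determined only on the model space; maps are composed with a projection onto it
  before theorems about open subsets of the ambient space apply. The bound on preimages has to be
  Euclidean, while the isometry condition speaks of \<open>gM\<close> and \<open>gN\<close>: both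
  metrics are compared with coordinate norms near a point, which turns the isometry into a single
  constant. Finally, a vector field on a fiber does not live on an open subset of \<open>M\<close>,
  so smoothness of \<open>J_hat\<close> is obtained for fields along a parametrization of the fiber.
  There D1 has the local frames of the distribution, and the kernel has the images of the coordinate
  fields of the fiber. Gram-Schmidt serves twice: for these projections, and with the Euclidean
  inner product to show that inverting a matrix is smooth, which the higher derivatives of the
  inverse of the straightening map require. The angle is below a right angle, so cos \<theta> is
  positive and the factor 1 / cos \<theta> cancels the cosine in \<phi>.\<close>

fun gs_proj :: "('v \<Rightarrow> 'v \<Rightarrow> real) \<Rightarrow> 'v list \<Rightarrow> 'v \<Rightarrow> 'v::real_vector" where
  "gs_proj g [] v = 0"
| "gs_proj g (x # xs) v =
     gs_proj g xs v + (g v (x - gs_proj g xs x) / g (x - gs_proj g xs x) (x - gs_proj g xs x)) *\<^sub>R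
       (x - gs_proj g xs x)"

text \<open>Independence in the order in which \<open>gs_proj\<close> consumes a list: each head
  lies outside the span of its tail, which makes every residual \<open>x - gs_proj g xs x\<close>
  nonzero.\<close>

fun indep_list :: "'v::real_vector list \<Rightarrow> bool" where
  "indep_list [] \<longleftrightarrow> True"
| "indep_list (x # xs) \<longleftrightarrow> x \<notin> span (set xs) \<and> indep_list xs"

lemma indep_list_iff: "indep_list xs \<longleftrightarrow> distinct xs \<and> independent (set xs)"
  by (induction xs) (auto simp: independent_insert span_base real_vector.independent_empty)

text \<open>Tangent vectors are functions on charts, a type without an inner product of its own. So
  \<open>g\<close> is constrained only on the subspace \<open>T\<close>, later a tangent
  space.\<close>

locale inner_on =
  fixes T :: "'v::real_vector set" and g :: "'v \<Rightarrow> 'v \<Rightarrow> real"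
  assumes T: "subspace T"
    and lin: "u \<in> T \<Longrightarrow> linear_on T (g u)"
    and sym: "u \<in> T \<Longrightarrow> v \<in> T \<Longrightarrow> g u v = g v u"
    and pos: "u \<in> T \<Longrightarrow> u \<noteq> 0 \<Longrightarrow> g u u > 0"
begin

lemma add_r: "u \<in> T \<Longrightarrow> v \<in> T \<Longrightarrow> w \<in> T \<Longrightarrow> g u (v + w) = g u v + g u w"
  and scale_r: "u \<in> T \<Longrightarrow> v \<in> T \<Longrightarrow> g u (a *\<^sub>R v) = a * g u v"
  using lin unfolding linear_on_def by auto

lemma add_l: "u \<in> T \<Longrightarrow> v \<in> T \<Longrightarrow> w \<in> T \<Longrightarrow> g (v + w) u = g v u + g w u"
  by (metis add_r sym T subspace_add)

lemma scale_l: "u \<in> T \<Longrightarrow> v \<in> T \<Longrightarrow> g (a *\<^sub>R v) u = a * g v u"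
  by (metis scale_r sym T subspace_scale)

lemma zero_r: "u \<in> T \<Longrightarrow> g u 0 = 0"
  using scale_r[of u u 0] by simp

lemma zero_l: "u \<in> T \<Longrightarrow> g 0 u = 0"
  using scale_l[of u u 0] by simp

lemma diff_r: "u \<in> T \<Longrightarrow> v \<in> T \<Longrightarrow> w \<in> T \<Longrightarrow> g u (v - w) = g u v - g u w"
  using add_r[of u v "(-1) *\<^sub>R w"] scale_r[of u w "-1"] T by (simp add: subspace_neg)

lemma diff_l: "u \<in> T \<Longrightarrow> v \<in> T \<Longrightarrow> w \<in> T \<Longrightarrow> g (v - w) u = g v u - g w u"
  by (metis diff_r sym T subspace_diff)

lemma nonneg: "u \<in> T \<Longrightarrow> g u u \<ge> 0"
  using pos[of u] zero_r[of 0] T subspace_0 by (cases "u = 0") (auto intro: less_imp_le)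

lemma eq_0: "u \<in> T \<Longrightarrow> g u u = 0 \<Longrightarrow> u = 0"
  using pos[of u] by auto

lemma orth_span:
  assumes "u \<in> T" "A \<subseteq> T" "\<And>a. a \<in> A \<Longrightarrow> g u a = 0" "w \<in> span A"
  shows "g u w = 0"
proof -
  have "span A \<subseteq> T" using assms(2) T by (simp add: span_minimal)
  have "w \<in> {w \<in> T. g u w = 0}"
    by (rule span_induct[OF assms(4)])
      (use assms T in \<open>auto simp: subspace_def zero_r add_r scale_r\<close>)
  then show ?thesis by simp
qed

text \<open>Induction on the list: the residual of the head is orthogonal to the span of the tail,
  so adding the component along it keeps the orthogonality already reached. Any spanning list
  therefore yields the orthogonal projection onto its span.\<close>

lemma gs_proj:
  assumes "set xs \<subseteq> T" "v \<in> T"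
  shows "gs_proj g xs v \<in> span (set xs)" "w \<in> span (set xs) \<Longrightarrow> g (v - gs_proj g xs v) w = 0"
proof -
  have *: "gs_proj g xs v \<in> span (set xs) \<and> (\<forall>w\<in>set xs. g (v - gs_proj g xs v) w = 0)"
    if "set xs \<subseteq> T" "v \<in> T" for v
    using that
  proof (induction xs arbitrary: v)
    case Nil
    then show ?case by simp
  next
    case (Cons x xs)
    let ?z = "x - gs_proj g xs x" and ?p = "gs_proj g xs"
    have sp: "span (set xs) \<subseteq> T" using Cons.prems T by (simp add: span_minimal)
    have x: "x \<in> T" "v \<in> T" "set xs \<subseteq> T" using Cons.prems by auto
    have px: "?p x \<in> span (set xs)" "\<And>w. w \<in> set xs \<Longrightarrow> g ?z w = 0"
      and pv: "?p v \<in> span (set xs)" "\<And>w. w \<in> set xs \<Longrightarrow> g (v - ?p v) w = 0"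
      using Cons.IH x by auto
    have pT: "?p x \<in> T" "?p v \<in> T" using px pv sp by auto
    have z: "?z \<in> T" "v - ?p v \<in> T" using x pT T by (auto intro: subspace_diff)
    let ?c = "g v ?z / g ?z ?z"
    have cz: "?c *\<^sub>R ?z \<in> T" using z T by (simp add: subspace_scale)
    have zs: "?z \<in> span (set (x # xs))"
      using px(1) span_mono[of "set xs" "set (x#xs)"] span_base[of x "set (x#xs)"]
      by (auto intro: span_diff)
    have "gs_proj g (x # xs) v \<in> span (set (x # xs))"
      using pv(1) zs span_mono[OF set_subset_Cons[of xs x]] unfolding gs_proj.simps
      by (intro span_add span_scale) auto
    moreover have "g (v - gs_proj g (x # xs) v) w = 0" if "w \<in> set (x # xs)" for w
    proof -
      have wT: "w \<in> T" using that Cons.prems by auto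
      have e: "g (v - gs_proj g (x # xs) v) u = g (v - ?p v) u - ?c * g ?z u" if "u \<in> T" for u
        using z cz that by (simp add: diff_diff_add[symmetric] diff_l scale_l)
      show ?thesis
      proof (cases "w \<in> set xs")
        case True
        then show ?thesis using e[OF wT] pv px by simp
      next
        case False
        then have w: "w = x" using that by simp
        have 1: "g ?z (?p x) = 0" "g (v - ?p v) (?p x) = 0"
          using orth_span[OF z(1) x(3) px(2) px(1)] orth_span[OF z(2) x(3) pv(2) px(1)] by auto
        have 2: "g (?p v) ?z = 0"
          using orth_span[OF z(1) x(3) px(2) pv(1)] sym z pT by metis
        have 3: "g ?z x = g ?z ?z" "g (v - ?p v) x = g (v - ?p v) ?z"
          using diff_r[OF z(1) x(1) pT(1)] diff_r[OF z(2) x(1) pT(1)] 1 by auto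
        have 4: "g (v - ?p v) ?z = g v ?z" using diff_l[OF z(1) x(2) pT(2)] 2 by simp
        \<comment> \<open>If \<open>g ?z ?z\<close> is zero, the residual itself is zero by
          definiteness and both sides vanish; otherwise the quotient cancels.\<close>
        have "?c * g ?z ?z = g v ?z"
          using eq_0[OF z(1)] zero_r[OF x(2)] by (cases "g ?z ?z = 0") auto
        then show ?thesis using e[OF x(1)] 3 4 w by simp
      qed
    qed
    ultimately show ?case by blast
  qed
  show "gs_proj g xs v \<in> span (set xs)" using *[OF assms] by blast
  have "gs_proj g xs v \<in> T"
    using *[OF assms] span_minimal[OF assms(1) T] by blast
  then show "g (v - gs_proj g xs v) w = 0" if "w \<in> span (set xs)"
    using orth_span[OF _ assms(1) _ that, of "v - gs_proj g xs v"] *[OF assms] assms T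
    by (auto intro: subspace_diff)
qed

text \<open>The difference of the two candidates lies in \<open>A\<close> and is orthogonal to
  \<open>A\<close>, in particular to itself.\<close>

lemma orth_unique:
  assumes "A \<subseteq> T" "subspace A" "a \<in> A" "a' \<in> A" "v \<in> T"
    and "\<And>w. w \<in> A \<Longrightarrow> g (v - a) w = 0" "\<And>w. w \<in> A \<Longrightarrow> g (v - a') w = 0"
  shows "a = a'"
proof -
  have aa: "a - a' \<in> A" using assms by (simp add: subspace_diff)
  have "g (a - a') (a - a') = g ((v - a') - (v - a)) (a - a')" by simp
  also have "\<dots> = g (v - a') (a - a') - g (v - a) (a - a')"
    using assms aa T by (intro diff_l) (auto intro: subspace_diff)
  also have "\<dots> = 0" using assms aa by simp
  finally show ?thesis using eq_0 aa assms(1) by fastforce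
qed

end

text \<open>The projection is a rational expression in inner products of the given families, so it
  stays in any class \<open>m\<close> of vector families and \<open>s\<close> of scalar families
  with these closure properties. The two instances are the columns of a matrix with the Euclidean
  inner product, and vector fields along a map with a Riemannian metric. Independence keeps the
  denominators nonzero.\<close>

lemma gs_proj_closed:
  assumes add: "\<And>f h. m f \<Longrightarrow> m h \<Longrightarrow> m (\<lambda>y. f y + h y)"
    and scale: "\<And>r f. s r \<Longrightarrow> m f \<Longrightarrow> m (\<lambda>y. r y *\<^sub>R f y)"
    and zero: "m (\<lambda>y. 0)" and neg: "s (\<lambda>y. -1)"
    and inner: "\<And>f h. m f \<Longrightarrow> m h \<Longrightarrow> s (\<lambda>y. g y (f y) (h y))"
    and div: "\<And>r q. s r \<Longrightarrow> s q \<Longrightarrow> \<forall>y\<in>S. q y \<noteq> 0 \<Longrightarrow> s (\<lambda>y. r y / q y)"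
    and io: "\<And>y. y \<in> S \<Longrightarrow> inner_on (T y) (g y)"
    and T: "\<And>f y. m f \<Longrightarrow> y \<in> S \<Longrightarrow> f y \<in> T y"
    and X: "list_all m X" "\<And>y. y \<in> S \<Longrightarrow> indep_list (map (\<lambda>f. f y) X)"
    and V: "m V"
  shows "m (\<lambda>y. gs_proj (g y) (map (\<lambda>f. f y) X) (V y))"
  using X V
proof (induction X arbitrary: V)
  case Nil
  then show ?case using zero by simp
next
  case (Cons f X)
  let ?p = "\<lambda>y. gs_proj (g y) (map (\<lambda>f. f y) X)"
  have IH: "m (\<lambda>y. ?p y (V y))" if "m V" for V
    using Cons that by simp
  have f: "m f" using Cons by simp
  have z: "m (\<lambda>y. f y - ?p y (f y))"
    using add[OF f scale[OF neg IH[OF f]]] by simp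
  have "f y - ?p y (f y) \<noteq> 0" if "y \<in> S" for y
  proof
    assume "f y - ?p y (f y) = 0"
    then have "f y = ?p y (f y)" by simp
    moreover have "set (map (\<lambda>f. f y) X) \<subseteq> T y" using Cons.prems(1) T that
      by (auto simp: list_all_iff)
    then have "?p y (f y) \<in> span (set (map (\<lambda>f. f y) X))"
      using inner_on.gs_proj(1)[OF io[OF that]] T[OF f that] by blast
    ultimately show False using Cons.prems(2)[OF that] by simp
  qed
  then have nz: "\<forall>y\<in>S. g y (f y - ?p y (f y)) (f y - ?p y (f y)) \<noteq> 0"
    using inner_on.eq_0[OF io T[OF z]] by blast
  show ?case
    using add[OF IH[OF Cons.prems(3)] scale[OF div[OF inner[OF Cons.prems(3) z] inner[OF z z] nz] z]]
    by simp
qed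

section \<open>Smooth functions\<close>

abbreviation "tdo \<equiv> times_differentiable_on"
abbreviation "fderiv f y \<equiv> frechet_derivative f (at y)"

lemma tdo_cong:
  assumes "open U" "\<And>y. y \<in> U \<Longrightarrow> f y = h y" "tdo n U f"
  shows "tdo n U h"
  using assms(2,3)
proof (induction n arbitrary: f h)
  case 0
  then show ?case using continuous_on_cong by fastforce
next
  case (Suc n)
  have hd: "(h has_derivative fderiv f y) (at y)" if "y \<in> U" for y
    by (rule has_derivative_transform_within_open[OF _ assms(1) that Suc.prems(1)])
      (use Suc.prems that in \<open>auto intro: iffD1[OF frechet_derivative_works]\<close>)
  have eq: "fderiv f y v = fderiv h y v" if "y \<in> U" for y v
    using frechet_derivative_at[OF hd[OF that]] by metis
  have "tdo n U (\<lambda>y. fderiv h y v)" for v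
    by (rule Suc.IH[OF eq]) (use Suc.prems in auto)
  then show ?case using hd by (auto simp: differentiable_def)
qed

lemma tdo_subset:
  assumes "V \<subseteq> U" "tdo n U f"
  shows "tdo n V f"
  using assms(2) by (induction n arbitrary: f) (use assms(1) continuous_on_subset in auto)

lemma tdo_continuous: "tdo n U f \<Longrightarrow> continuous_on U f"
  by (cases n) (auto simp: continuous_on_eq_continuous_within
      intro: differentiable_imp_continuous_within differentiable_at_withinI)

lemma tdo_SucD: "tdo (Suc n) U f \<Longrightarrow> tdo n U f"
proof (induction n arbitrary: f)
  case 0
  then show ?case using tdo_continuous by (metis times_differentiable_on.simps(1))
qed auto

lemma tdo_has_derivative:
  "tdo (Suc n) U f \<Longrightarrow> y \<in> U \<Longrightarrow>
    (f has_derivative fderiv f y) (at y)"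
  by (simp add: frechet_derivative_works[symmetric])

text \<open>Lets the inductions below supply the derivative by a formula; on an open set it must
  coincide with \<open>frechet_derivative\<close>.\<close>

lemma tdo_SucI:
  assumes "open U" "\<And>y. y \<in> U \<Longrightarrow> (f has_derivative f' y) (at y)"
    and "\<And>v. tdo n U (\<lambda>y. f' y v)"
  shows "tdo (Suc n) U f"
proof -
  have "f' y = fderiv f y" if "y \<in> U" for y
    using assms(2)[OF that] frechet_derivative_at by blast
  then show ?thesis
    using assms tdo_cong[OF assms(1) _ assms(3)] by (auto simp: differentiable_def)
qed

lemma tdo_const: "tdo n U (\<lambda>y. c)"
  by (induction n arbitrary: c) auto

lemma tdo_linear:
  assumes "open U" "bounded_linear L" shows "tdo n U L"
proof (cases n)
  case 0
  then show ?thesis using assms by (simp add: linear_continuous_on)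
next
  case (Suc m)
  show ?thesis unfolding Suc
    by (rule tdo_SucI[OF assms(1), of _ "\<lambda>_. L"])
      (auto simp: tdo_const assms(2) bounded_linear_imp_has_derivative)
qed

lemma tdo_add:
  assumes "open U" "tdo n U f" "tdo n U h"
  shows "tdo n U (\<lambda>y. f y + h y)"
  using assms(2,3)
proof (induction n arbitrary: f h)
  case 0
  then show ?case by (simp add: continuous_on_add)
next
  case (Suc n)
  show ?case
  proof (rule tdo_SucI[OF assms(1)])
    show "((\<lambda>y. f y + h y) has_derivative
        (\<lambda>v. fderiv f y v + fderiv h y v)) (at y)" if "y \<in> U" for y
      by (intro has_derivative_add tdo_has_derivative[OF Suc.prems(1) that] tdo_has_derivative[OF Suc.prems(2) that])
  qed (use Suc in simp)
qed

lemma tdo_sum: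
  assumes "open U" "\<And>i. i \<in> I \<Longrightarrow> tdo n U (f i)"
  shows "tdo n U (\<lambda>y. \<Sum>i\<in>I. f i y)"
  using assms(2) by (induction I rule: infinite_finite_induct)
    (auto intro: tdo_const tdo_add[OF assms(1)])

text \<open>By the product rule the derivative is a sum of two values of the same \<open>b\<close>,
  each with one factor differentiated, so the induction closes once \<open>tdo_SucD\<close> lowers
  the order of the other factor. One proof covers scaling, real products and inner products.\<close>

lemma tdo_bilinear:
  assumes "open U" "bounded_bilinear b"
    and "tdo n U f" "tdo n U h"
  shows "tdo n U (\<lambda>y. b (f y) (h y))"
  using assms(3,4)
proof (induction n arbitrary: f h)
  case 0
  then show ?case by (simp add: bounded_bilinear.continuous_on[OF assms(2)])
next
  case (Suc n)
  show ?case
  proof (rule tdo_SucI[OF assms(1)])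
    show "((\<lambda>y. b (f y) (h y)) has_derivative
        (\<lambda>v. b (f y) (fderiv h y v) + b (fderiv f y v) (h y))) (at y)"
      if "y \<in> U" for y
      by (intro bounded_bilinear.FDERIV[OF assms(2)] tdo_has_derivative[OF Suc.prems(1) that] tdo_has_derivative[OF Suc.prems(2) that])
    show "tdo n U
        (\<lambda>y. b (f y) (fderiv h y v) + b (fderiv f y v) (h y))" for v
      using Suc.prems by (intro tdo_add[OF assms(1)] Suc.IH tdo_SucD[OF Suc.prems(1)]
          tdo_SucD[OF Suc.prems(2)]) simp_all
  qed
qed

lemma tdo_compose_linear:
  assumes "open U" "bounded_linear L" "tdo n U f"
  shows "tdo n U (\<lambda>y. L (f y))"
  using assms(3)
proof (induction n arbitrary: f)
  case 0
  then show ?case by (simp add: bounded_linear.continuous_on[OF assms(2)])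
next
  case (Suc n)
  show ?case
  proof (rule tdo_SucI[OF assms(1)])
    show "((\<lambda>y. L (f y)) has_derivative (\<lambda>v. L (fderiv f y v))) (at y)"
      if "y \<in> U" for y
      by (intro bounded_linear.has_derivative[OF assms(2)] tdo_has_derivative[OF Suc.prems(1) that])
  qed (use Suc in simp)
qed

lemma linear_expand:
  fixes L :: "'v::euclidean_space \<Rightarrow> 'w::real_vector"
  assumes "linear L" shows "L v = (\<Sum>b\<in>Basis. (v \<bullet> b) *\<^sub>R L b)"
proof -
  have "L v = L (\<Sum>b\<in>Basis. (v \<bullet> b) *\<^sub>R b)" by (simp add: euclidean_representation)
  also have "\<dots> = (\<Sum>b\<in>Basis. (v \<bullet> b) *\<^sub>R L b)"
    by (simp add: linear_sum[OF assms] linear_scale[OF assms])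
  finally show ?thesis .
qed

text \<open>The chain rule applies the derivative of \<open>h\<close> to a vector that varies with
  \<open>y\<close>. Expanding this vector in \<open>Basis\<close> leaves directional derivatives of
  \<open>h\<close> in fixed directions, to which the induction hypothesis applies.\<close>

lemma tdo_compose:
  fixes f :: "'v::euclidean_space \<Rightarrow> 'w::euclidean_space"
  assumes "open U" "open V" "f ` U \<subseteq> V" "tdo n U f" "tdo n V h"
  shows "tdo n U (\<lambda>y. h (f y))"
  using assms(4,5)
proof (induction n arbitrary: h)
  case 0
  then show ?case using assms(3) continuous_on_compose2[of V h U f] by simp
next
  case (Suc n)
  have fV: "f y \<in> V" if "y \<in> U" for y using that assms(3) by auto
  show ?case
  proof (rule tdo_SucI[OF assms(1),
          of _ "\<lambda>y v. \<Sum>b\<in>Basis. (fderiv f y v \<bullet> b) *\<^sub>R fderiv h (f y) b"])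
    fix y assume y: "y \<in> U"
    have "((h \<circ> f) has_derivative fderiv h (f y) \<circ> fderiv f y) (at y)"
      by (intro diff_chain_at tdo_has_derivative[OF Suc.prems(1) y] tdo_has_derivative[OF Suc.prems(2) fV[OF y]])
    moreover have "fderiv h (f y) \<circ> fderiv f y =
      (\<lambda>v. \<Sum>b\<in>Basis. (fderiv f y v \<bullet> b) *\<^sub>R fderiv h (f y) b)"
      unfolding o_def
      by (intro ext linear_expand has_derivative_linear[OF tdo_has_derivative[OF Suc.prems(2) fV[OF y]]])
    ultimately show "((\<lambda>y. h (f y)) has_derivative
      (\<lambda>v. \<Sum>b\<in>Basis. (fderiv f y v \<bullet> b) *\<^sub>R fderiv h (f y) b)) (at y)"
      by (simp add: o_def)
  next
    fix v
    have 1: "tdo n U (\<lambda>y. fderiv h (f y) b)" for b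
      using Suc.IH[of "\<lambda>z. fderiv h z b"] Suc.prems tdo_SucD by auto
    have 2: "tdo n U (\<lambda>y. fderiv f y v \<bullet> b)" for b
      using Suc.prems by (intro tdo_compose_linear[OF assms(1) bounded_linear_inner_left]) simp
    show "tdo n U (\<lambda>y. \<Sum>b\<in>Basis. (fderiv f y v \<bullet> b) *\<^sub>R fderiv h (f y) b)"
      by (intro tdo_sum tdo_bilinear[OF _ bounded_bilinear_scaleR] 1 2 assms(1))
  qed
qed

text \<open>The derivative of a reciprocal is a product of reciprocals and the derivative of
  \<open>h\<close>, so reciprocals can be handled by induction on the order.\<close>

lemma tdo_divide:
  fixes f h :: "'v::euclidean_space \<Rightarrow> real"
  assumes U: "open U" and nz: "\<forall>y\<in>U. h y \<noteq> 0"
    and f: "tdo n U f" and h: "tdo n U h"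
  shows "tdo n U (\<lambda>y. f y / h y)"
proof -
  note mult = tdo_bilinear[OF U bounded_bilinear_mult]
  have "tdo n U (\<lambda>y. inverse (h y))" using h
  proof (induction n)
    case 0
    then show ?case using nz by (simp add: continuous_on_inverse)
  next
    case (Suc n)
    have n: "tdo n U (\<lambda>y. -1)" by (rule tdo_const)
    show ?case
    proof (rule tdo_SucI[OF U, of _ "\<lambda>y v. -1 * (inverse (h y) * fderiv h y v * inverse (h y))"])
      show "((\<lambda>y. inverse (h y)) has_derivative
         (\<lambda>v. -1 * (inverse (h y) * fderiv h y v * inverse (h y)))) (at y)"
        if "y \<in> U" for y
        using Deriv.has_derivative_inverse[OF _ tdo_has_derivative[OF Suc.prems that]] nz that by simp
      show "tdo n U (\<lambda>y. -1 * (inverse (h y) * fderiv h y v * inverse (h y)))" for v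
        using Suc tdo_SucD[OF Suc.prems] by (intro mult n) auto
    qed
  qed
  from mult[OF f this] show ?thesis by (simp add: divide_inverse)
qed

section \<open>Smooth dependence of inverse matrices, and the smooth inverse function
  theorem\<close>

lemma tdo_linear_inverse:
  fixes A :: "'v::euclidean_space \<Rightarrow> 'w::euclidean_space \<Rightarrow> 'w"
  assumes U: "open U" and A: "\<And>v. tdo n U (\<lambda>y. A y v)"
    and lin: "\<And>y. y \<in> U \<Longrightarrow> linear (A y)" and inj: "\<And>y. y \<in> U \<Longrightarrow> inj (A y)"
  shows "tdo n U (\<lambda>y. inv (A y) w)"
proof -
  txt \<open>Solve \<open>A y x = w\<close> by projecting each column of \<open>A y\<close> off the span of the others:
    the coefficients of \<open>x\<close> are then quotients of inner products.\<close>
  define m where "m = (\<lambda>f::'v \<Rightarrow> 'w. tdo n U f)"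
  define s where "s = (\<lambda>f::'v \<Rightarrow> real. tdo n U f)"
  have add: "m (\<lambda>y. f y + h y)" if "m f" "m h" for f h
    using that tdo_add[OF U] m_def by blast
  have scale: "m (\<lambda>y. r y *\<^sub>R f y)" if "s r" "m f" for r f
    using that tdo_bilinear[OF U bounded_bilinear_scaleR] m_def s_def by blast
  have zero: "m (\<lambda>y. 0)" and neg: "s (\<lambda>y. -1)" and w: "m (\<lambda>y. w)"
    using tdo_const m_def s_def by blast+
  have inner: "s (\<lambda>y. f y \<bullet> h y)" if "m f" "m h" for f h
    using that tdo_bilinear[OF U bounded_bilinear_inner] m_def s_def by blast
  have div: "s (\<lambda>y. r y / q y)" if "s r" "s q" "\<forall>y\<in>U. q y \<noteq> 0" for r q
    using that tdo_divide[OF U] s_def by blast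
  have io: "inner_on UNIV ((\<bullet>) :: 'w \<Rightarrow> 'w \<Rightarrow> real)"
    by standard (auto simp: linear_on_def inner_add_right inner_commute)
  obtain bs :: "'w list" where bs: "set bs = Basis" "distinct bs"
    using finite_distinct_list[OF finite_Basis] by blast
  define cs where "cs b = map (\<lambda>e y. A y e) (filter (\<lambda>e. e \<noteq> b) bs)" for b
  define z where "z b y = A y b - gs_proj (\<bullet>) (map (\<lambda>f. f y) (cs b)) (A y b)" for b y
  have cs: "set (map (\<lambda>f. f y) (cs b)) = A y ` (Basis - {b})" for b y
    by (auto simp: cs_def bs)
  have Am: "m (\<lambda>y. A y v)" for v using A m_def by blast
  have ind: "indep_list (map (\<lambda>f. f y) (cs b))" if "y \<in> U" for y b
  proof -
    have "independent (A y ` (Basis - {b}))"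
      using lin[OF that] inj[OF that] independent_mono[OF independent_Basis, of "Basis - {b}"]
      by (intro linear_independent_injective_image) (auto intro: inj_on_subset)
    moreover have "distinct (map (\<lambda>f. f y) (cs b))"
      using bs inj[OF that] by (auto simp: cs_def distinct_map o_def intro: inj_on_subset)
    ultimately show ?thesis unfolding indep_list_iff cs by simp
  qed
  have zm: "m (z b)" for b
  proof -
    have "m (\<lambda>y. gs_proj (\<bullet>) (map (\<lambda>f. f y) (cs b)) (A y b))"
      by (rule gs_proj_closed[of m s "\<lambda>_. (\<bullet>)" U "\<lambda>_. UNIV"])
        (use add scale zero neg inner div io ind Am in \<open>auto simp: list_all_iff cs_def\<close>)
    from add[OF Am scale[OF neg this]] show ?thesis by (simp add: z_def[abs_def])
  qed
  have z0: "z b y \<bullet> A y e = 0" if "e \<in> Basis" "e \<noteq> b" for b e y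
    unfolding z_def using inner_on.gs_proj(2)[OF io] that
    by (metis DiffI cs image_eqI singletonD span_base subset_UNIV UNIV_I)
  \<comment> \<open>A zero pairing would make the residual orthogonal to every column, hence to the
    whole space, since \<open>A y\<close> is onto. The residual would vanish and column
    \<open>b\<close> would depend on the others.\<close>
  have zb: "z b y \<bullet> A y b \<noteq> 0" if "y \<in> U" "b \<in> Basis" for b y
  proof
    assume 0: "z b y \<bullet> A y b = 0"
    have "z b y \<bullet> A y x = 0" for x
      unfolding linear_expand[OF lin[OF that(1)], of x] inner_sum_right
      using 0 z0 by (intro sum.neutral) (metis inner_scaleR_right mult_zero_right)
    moreover have "surj (A y)" using lin[OF that(1)] inj[OF that(1)] linear_injective_imp_surjective by blast
    ultimately have "z b y = 0" by (metis inner_eq_zero_iff surjD)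
    then have "A y b \<in> span (A y ` (Basis - {b}))"
      using inner_on.gs_proj(1)[OF io, of "map (\<lambda>f. f y) (cs b)" "A y b"] unfolding z_def cs by simp
    then have "A y b \<in> A y ` span (Basis - {b})"
      using linear_span_image[OF lin[OF that(1)]] by blast
    then have "b \<in> span (Basis - {b})" using inj[OF that(1)] by (metis imageE injD)
    then show False using independent_Basis that(2) unfolding dependent_def by blast
  qed
  define c where "c b y = (z b y \<bullet> w) / (z b y \<bullet> A y b)" for b y
  have "m (\<lambda>y. c b y *\<^sub>R b)" if "b \<in> Basis" for b
  proof -
    have "s (c b)" unfolding c_def using div[OF inner[OF zm w] inner[OF zm Am]] zb that by simp
    then show ?thesis using scale[OF _ tdo_const[of n U b, folded m_def]] by blast
  qed
  then have *: "m (\<lambda>y. \<Sum>b\<in>Basis. c b y *\<^sub>R b)"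
    unfolding m_def by (intro tdo_sum U) auto
  have "(\<Sum>b\<in>Basis. c b y *\<^sub>R b) = inv (A y) w" if y: "y \<in> U" for y
  proof -
    let ?x = "inv (A y) w"
    have "surj (A y)" using lin[OF y] inj[OF y] linear_injective_imp_surjective by blast
    then have x: "A y ?x = w" by (simp add: surj_f_inv_f)
    have "c b y = ?x \<bullet> b" if b: "b \<in> Basis" for b
    proof -
      have "z b y \<bullet> w = (\<Sum>e\<in>Basis. (?x \<bullet> e) * (z b y \<bullet> A y e))"
        by (subst x[symmetric], subst linear_expand[OF lin[OF y]]) (simp add: inner_sum_right)
      also have "\<dots> = (\<Sum>e\<in>Basis. if e = b then (?x \<bullet> b) * (z b y \<bullet> A y b) else 0)"
        using z0 by (intro sum.cong) auto
      also have "\<dots> = (?x \<bullet> b) * (z b y \<bullet> A y b)" using b by simp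
      finally show ?thesis using zb[OF y b] by (simp add: c_def)
    qed
    then show ?thesis by (simp add: euclidean_representation)
  qed
  then show ?thesis by (rule tdo_cong[OF U _ *[unfolded m_def]])
qed

text \<open>The inverse function theorem gives a differentiable \<open>g\<close> whose derivative at
  \<open>y\<close> is the inverse of the derivative of \<open>f\<close> at \<open>g y\<close>. If
  \<open>g\<close> is of class n, that matrix is of class n in \<open>y\<close>, hence so is its
  inverse, and \<open>g\<close> is of class n + 1. The derivative at \<open>x0\<close> is normalized
  to the identity, as the straightening map provides.\<close>

lemma smooth_inverse_function:
  fixes f :: "'v::euclidean_space \<Rightarrow> 'v"
  assumes U: "open U" and f: "\<And>n. tdo n U f" and x0: "x0 \<in> U"
    and id: "fderiv f x0 = id"
  obtains U' V g where "open U'" "U' \<subseteq> U" "x0 \<in> U'" "open V" "f x0 \<in> V" "homeomorphism U' V f g"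
    "\<And>n. tdo n V g"
    "\<And>y. y \<in> V \<Longrightarrow> (g has_derivative inv (fderiv f (g y))) (at y)"
    "\<And>y. y \<in> V \<Longrightarrow> bij (fderiv f (g y))"
proof -
  let ?D = "\<lambda>x. fderiv f x"
  have hd: "(f has_derivative ?D x) (at x)" if "x \<in> U" for x
    using tdo_has_derivative[OF f that] .
  have ba: "blinfun_apply (Blinfun (?D x)) = ?D x" if "x \<in> U" for x
    using hd[OF that] by (simp add: bounded_linear_Blinfun_apply has_derivative_bounded_linear)
  have cont: "continuous_on U (\<lambda>x. Blinfun (?D x))"
  proof (rule continuous_on_blinfun_componentwise)
    fix i :: 'v
    have "tdo 0 U (\<lambda>x. ?D x i)" using f[of "Suc 0"] by simp
    then have "continuous_on U (\<lambda>x. ?D x i)" by simp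
    then show "continuous_on U (\<lambda>x. blinfun_apply (Blinfun (?D x)) i)"
      using ba by (subst continuous_on_cong[OF refl, where g = "\<lambda>x. ?D x i"]) auto
  qed
  have "id_blinfun o\<^sub>L Blinfun (?D x0) = id_blinfun"
    by (rule blinfun_eqI) (simp add: ba[OF x0] id, simp add: id_def bounded_linear_Blinfun_apply)
  then obtain U' V g g' where *: "open U'" "U' \<subseteq> U" "x0 \<in> U'" "open V" "f x0 \<in> V"
    "homeomorphism U' V f g" "\<And>y. y \<in> V \<Longrightarrow> (g has_derivative (g' y)) (at y)"
    "\<And>y. y \<in> V \<Longrightarrow> g' y = inv (blinfun_apply (Blinfun (?D (g y))))"
    "\<And>y. y \<in> V \<Longrightarrow> bij (blinfun_apply (Blinfun (?D (g y))))"
    using inverse_function_theorem[OF U _ cont x0, of f id_blinfun] hd ba by metis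
  have gU: "g y \<in> U" if "y \<in> V" for y
    using *(2,6) that unfolding homeomorphism_def by blast
  have g: "(g has_derivative inv (?D (g y))) (at y)" "bij (?D (g y))" if "y \<in> V" for y
    using *(7,8,9)[OF that] ba[OF gU[OF that]] by auto
  have "tdo n V g" for n
  proof (induction n)
    case 0
    then show ?case using *(6) by (simp add: homeomorphism_def)
  next
    case (Suc n)
    show ?case
    proof (rule tdo_SucI[OF *(4) g(1)])
      show "tdo n V (\<lambda>y. inv (?D (g y)) v)" for v
      proof (rule tdo_linear_inverse[OF *(4)])
        show "tdo n V (\<lambda>y. ?D (g y) v)" for v
          using tdo_compose[OF *(4) U _ Suc, of "\<lambda>x. ?D x v"] f[of "Suc n"] gU by auto
      qed (use g bij_is_inj has_derivative_linear[OF hd[OF gU]] in auto)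
    qed
  qed
  then show ?thesis using that[of U' V g] * g by metis
qed

section \<open>Smooth maps on arbitrary subsets\<close>

lemma smooth_onI:
  assumes "\<And>x. x \<in> S \<Longrightarrow> \<exists>U h. open U \<and> x \<in> U \<and> (\<forall>n. tdo n U h) \<and>
    (\<forall>y\<in>S \<inter> U. h y = f y)"
  shows "smooth_on S f"
  using assms unfolding smooth_on_def by blast

lemma smooth_onE:
  assumes "smooth_on S f" "x \<in> S"
  obtains U h where "open U" "x \<in> U" "\<And>n. tdo n U h"
    "\<And>y. y \<in> S \<Longrightarrow> y \<in> U \<Longrightarrow> h y = f y"
  using assms unfolding smooth_on_def by (metis IntI)

lemma smooth_on_open: "open U \<Longrightarrow> (\<And>n. tdo n U f) \<Longrightarrow> smooth_on U f"
  by (rule smooth_onI) blast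

lemma smooth_on_subset:
  assumes "smooth_on S f" "T \<subseteq> S"
  shows "smooth_on T f"
proof (rule smooth_onI)
  fix x assume "x \<in> T"
  then obtain U h where "open U" "x \<in> U" "\<And>n. tdo n U h"
    "\<And>y. y \<in> S \<Longrightarrow> y \<in> U \<Longrightarrow> h y = f y"
    using smooth_onE[OF assms(1), of x] assms(2) by blast
  then show "\<exists>U h. open U \<and> x \<in> U \<and> (\<forall>n. tdo n U h) \<and> (\<forall>y\<in>T \<inter> U. h y = f y)"
    using assms(2) by (intro exI[of _ U] exI[of _ h]) auto
qed

lemma smooth_on_cong: "smooth_on S f \<Longrightarrow> (\<And>x. x \<in> S \<Longrightarrow> f x = h x) \<Longrightarrow> smooth_on S h"
  unfolding smooth_on_def by simp

lemma smooth_on_local: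
  assumes "\<And>x. x \<in> S \<Longrightarrow> \<exists>V. open V \<and> x \<in> V \<and> smooth_on (S \<inter> V) f"
  shows "smooth_on S f"
proof (rule smooth_onI)
  fix x assume x: "x \<in> S"
  then obtain V where V: "open V" "x \<in> V" "smooth_on (S \<inter> V) f" using assms by blast
  obtain U h where U: "open U" "x \<in> U" "\<And>n. tdo n U h"
    "\<And>y. y \<in> S \<inter> V \<Longrightarrow> y \<in> U \<Longrightarrow> h y = f y"
    using smooth_onE[OF V(3), of x] x V by auto
  have "tdo n (U \<inter> V) h" for n using U(3) by (rule tdo_subset[rotated]) auto
  then show "\<exists>U h. open U \<and> x \<in> U \<and> (\<forall>n. tdo n U h) \<and> (\<forall>y\<in>S \<inter> U. h y = f y)"
    using U V by (intro exI[of _ "U \<inter> V"] exI[of _ h]) auto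
qed

lemma smooth_on_continuous: "smooth_on S f \<Longrightarrow> continuous_on S f"
proof (subst continuous_on_eq_continuous_within, safe)
  fix x assume "smooth_on S f" and x: "x \<in> S"
  then obtain U h where U: "open U" "x \<in> U" "\<And>n. tdo n U h"
    "\<And>y. y \<in> S \<Longrightarrow> y \<in> U \<Longrightarrow> h y = f y"
    by (metis smooth_onE)
  have "continuous (at x) h" using tdo_continuous[OF U(3)] U continuous_on_eq_continuous_at by blast
  then have "(h \<longlongrightarrow> h x) (at x within S)"
    using continuous_at_imp_continuous_at_within continuous_within by blast
  moreover have "\<forall>\<^sub>F y in at x within S. h y = f y"
    using U by (auto simp: eventually_at_filter eventually_nhds)
  ultimately show "continuous (at x within S) f"
    using U x unfolding continuous_within by (metis tendsto_cong)
qed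

lemma smooth_on_const: "smooth_on S (\<lambda>y. c)"
  by (rule smooth_onI) (use tdo_const in \<open>auto intro!: exI[of _ UNIV] exI[of _ "\<lambda>_. c"]\<close>)

lemma smooth_on_linear: "bounded_linear L \<Longrightarrow> smooth_on S L"
  by (rule smooth_on_subset[OF smooth_on_open[OF open_UNIV]]) (auto intro: tdo_linear)

lemma smooth_on_id: "smooth_on S (\<lambda>y. y)"
  by (rule smooth_on_linear) (rule bounded_linear_ident)

text \<open>Local extensions of two maps must live on the same open set before they can be combined;
  intersecting the two sets achieves this.\<close>

lemma smooth_on_common_extension:
  assumes "smooth_on S f" "smooth_on S h" "x \<in> S"
  obtains U f' h' where "open U" "x \<in> U" "\<And>n. tdo n U f'" "\<And>n. tdo n U h'"
    "\<And>y. y \<in> S \<Longrightarrow> y \<in> U \<Longrightarrow> f' y = f y" "\<And>y. y \<in> S \<Longrightarrow> y \<in> U \<Longrightarrow> h' y = h y"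
proof -
  obtain U f' where U: "open U" "x \<in> U" "\<And>n. tdo n U f'" "\<And>y. y \<in> S \<Longrightarrow> y \<in> U \<Longrightarrow> f' y = f y"
    by (metis smooth_onE[OF assms(1,3)])
  obtain V h' where V: "open V" "x \<in> V" "\<And>n. tdo n V h'" "\<And>y. y \<in> S \<Longrightarrow> y \<in> V \<Longrightarrow> h' y = h y"
    by (metis smooth_onE[OF assms(2,3)])
  show thesis
    by (rule that[OF open_Int[OF U(1) V(1)] _ tdo_subset[OF Int_lower1 U(3)] tdo_subset[OF Int_lower2 V(3)]])
      (use U V in auto)
qed

lemma smooth_on_bilinear:
  assumes "bounded_bilinear b" "smooth_on S f" "smooth_on S h"
  shows "smooth_on S (\<lambda>y. b (f y) (h y))"
proof (rule smooth_onI)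
  fix x assume x: "x \<in> S"
  obtain U f' h' where U: "open U" "x \<in> U" "\<And>n. tdo n U f'" "\<And>n. tdo n U h'"
    "\<And>y. y \<in> S \<Longrightarrow> y \<in> U \<Longrightarrow> f' y = f y" "\<And>y. y \<in> S \<Longrightarrow> y \<in> U \<Longrightarrow> h' y = h y"
    by (rule smooth_on_common_extension[OF assms(2,3) x]) (rule that)
  have "tdo n U (\<lambda>y. b (f' y) (h' y))" for n by (rule tdo_bilinear[OF U(1) assms(1) U(3,4)])
  then show "\<exists>U q. open U \<and> x \<in> U \<and> (\<forall>n. tdo n U q) \<and> (\<forall>y\<in>S \<inter> U. q y = b (f y) (h y))"
    using U by (intro exI[of _ U] exI[of _ "\<lambda>y. b (f' y) (h' y)"]) auto
qed

lemmas smooth_on_scaleR = smooth_on_bilinear[OF bounded_bilinear_scaleR]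
lemmas smooth_on_mult = smooth_on_bilinear[OF bounded_bilinear_mult]
lemmas smooth_on_inner = smooth_on_bilinear[OF bounded_bilinear_inner]

lemma smooth_on_add:
  assumes "smooth_on S f" "smooth_on S h"
  shows "smooth_on S (\<lambda>y. f y + h y)"
proof (rule smooth_onI)
  fix x assume x: "x \<in> S"
  obtain U f' h' where U: "open U" "x \<in> U" "\<And>n. tdo n U f'" "\<And>n. tdo n U h'"
    "\<And>y. y \<in> S \<Longrightarrow> y \<in> U \<Longrightarrow> f' y = f y" "\<And>y. y \<in> S \<Longrightarrow> y \<in> U \<Longrightarrow> h' y = h y"
    by (rule smooth_on_common_extension[OF assms x]) (rule that)
  have "tdo n U (\<lambda>y. f' y + h' y)" for n by (rule tdo_add[OF U(1,3,4)])
  then show "\<exists>U q. open U \<and> x \<in> U \<and> (\<forall>n. tdo n U q) \<and> (\<forall>y\<in>S \<inter> U. q y = f y + h y)"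
    using U by (intro exI[of _ U] exI[of _ "\<lambda>y. f' y + h' y"]) auto
qed

lemma smooth_on_sum: "(\<And>i. i \<in> I \<Longrightarrow> smooth_on S (f i)) \<Longrightarrow> smooth_on S (\<lambda>y. \<Sum>i\<in>I. f i y)"
  by (induction I rule: infinite_finite_induct) (auto intro: smooth_on_const smooth_on_add)

lemma smooth_on_compose:
  fixes f :: "'v::euclidean_space \<Rightarrow> 'w::euclidean_space"
  assumes "smooth_on T h" "smooth_on S f" "f ` S \<subseteq> T"
  shows "smooth_on S (\<lambda>y. h (f y))"
proof (rule smooth_onI)
  fix x assume x: "x \<in> S"
  obtain U f' where U: "open U" "x \<in> U" "\<And>n. tdo n U f'"
    "\<And>y. y \<in> S \<Longrightarrow> y \<in> U \<Longrightarrow> f' y = f y"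
    by (metis smooth_onE[OF assms(2) x])
  obtain V h' where V: "open V" "f x \<in> V" "\<And>n. tdo n V h'"
    "\<And>y. y \<in> T \<Longrightarrow> y \<in> V \<Longrightarrow> h' y = h y"
    by (metis smooth_onE[OF assms(1)] assms(3) image_subset_iff x)
  \<comment> \<open>The extension of \<open>f\<close> may leave the domain of the extension of
    \<open>h\<close>. On the preimage of \<open>V\<close>, open because the extension is continuous,
    the composition makes sense.\<close>
  let ?W = "U \<inter> f' -` V"
  have W: "open ?W" using continuous_on_open_vimage[OF U(1)] tdo_continuous[OF U(3)] V(1)
    by (metis Int_commute)
  have "tdo n ?W (\<lambda>y. h' (f' y))" for n
    by (rule tdo_compose[OF W V(1)]) (use U V in \<open>auto intro: tdo_subset[of _ U]\<close>)
  moreover have "x \<in> ?W" "\<forall>y\<in>S \<inter> ?W. h' (f' y) = h (f y)"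
    using U V x assms(3) by auto
  ultimately show "\<exists>U q. open U \<and> x \<in> U \<and> (\<forall>n. tdo n U q) \<and>
      (\<forall>y\<in>S \<inter> U. q y = h (f y))"
    using W by (intro exI[of _ ?W] exI[of _ "\<lambda>y. h' (f' y)"]) auto
qed

lemma smooth_on_compose_linear:
  fixes f :: "'v::euclidean_space \<Rightarrow> 'w::euclidean_space"
  shows "bounded_linear L \<Longrightarrow> smooth_on S f \<Longrightarrow> smooth_on S (\<lambda>y. L (f y))"
  using smooth_on_compose[OF smooth_on_linear[of L UNIV]] by blast

lemma smooth_on_divide:
  fixes f h :: "'v::euclidean_space \<Rightarrow> real"
  assumes "smooth_on S f" "smooth_on S h" "\<forall>y\<in>S. h y \<noteq> 0"
  shows "smooth_on S (\<lambda>y. f y / h y)"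
proof (rule smooth_onI)
  fix x assume x: "x \<in> S"
  obtain U f' h' where U: "open U" "x \<in> U" "\<And>n. tdo n U f'" "\<And>n. tdo n U h'"
    "\<And>y. y \<in> S \<Longrightarrow> y \<in> U \<Longrightarrow> f' y = f y" "\<And>y. y \<in> S \<Longrightarrow> y \<in> U \<Longrightarrow> h' y = h y"
    by (rule smooth_on_common_extension[OF assms(1,2) x]) (rule that)
  \<comment> \<open>The extended denominator may vanish off \<open>S\<close>; its zeros are
    removed.\<close>
  let ?W = "U \<inter> h' -` (- {0})"
  have W: "open ?W" by (rule continuous_open_preimage[OF tdo_continuous[OF U(4)] U(1)]) auto
  have "tdo n ?W (\<lambda>y. f' y / h' y)" for n
    by (rule tdo_divide[OF W _ tdo_subset[OF Int_lower1 U(3)] tdo_subset[OF Int_lower1 U(4)]]) auto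
  moreover have "x \<in> ?W" "\<forall>y\<in>S \<inter> ?W. f' y / h' y = f y / h y"
    using U x assms(3) by auto
  ultimately show "\<exists>U q. open U \<and> x \<in> U \<and> (\<forall>n. tdo n U q) \<and> (\<forall>y\<in>S \<inter> U. q y = f y / h y)"
    using W by (intro exI[of _ ?W] exI[of _ "\<lambda>y. f' y / h' y"]) auto
qed

section \<open>Derivatives within relatively open subsets of subspaces\<close>

text \<open>For \<open>v\<close> in \<open>E\<close> the line through \<open>x\<close> stays in
  \<open>S\<close> for small parameters, so the value \<open>D v\<close> becomes an ordinary
  one-variable derivative.\<close>

lemma has_derivative_within_direction:
  fixes f :: "'v::euclidean_space \<Rightarrow> 'w::real_normed_vector"
  assumes S: "openin (top_of_set E) S" "subspace E" "x \<in> S" and v: "v \<in> E"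
    and D: "(f has_derivative D) (at x within S)"
  shows "((\<lambda>t. f (x + t *\<^sub>R v)) has_vector_derivative D v) (at 0)"
proof -
  obtain G where G: "open G" "S = E \<inter> G" using S(1) by (auto simp: openin_open)
  let ?l = "\<lambda>t. x + t *\<^sub>R v"
  let ?T = "?l -` G"
  have T: "open ?T" "0 \<in> ?T"
    using G S(3) by (auto intro!: open_vimage continuous_intros)
  have sub: "?l ` ?T \<subseteq> S"
    using G S v by (auto intro: subspace_add subspace_scale)
  have "(?l has_derivative (\<lambda>t. t *\<^sub>R v)) (at 0 within ?T)"
    by (auto intro!: derivative_eq_intros)
  moreover have "(f has_derivative D) (at (?l 0) within ?l ` ?T)"
    using has_derivative_subset[OF D sub] by simp
  ultimately have "((\<lambda>t. f (?l t)) has_derivative (\<lambda>t. D (t *\<^sub>R v))) (at 0 within ?T)"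
    by (rule has_derivative_in_compose)
  then show ?thesis
    unfolding at_within_open[OF T(2,1)] has_vector_derivative_def
    by (simp only: linear_scale[OF has_derivative_linear[OF D]])
qed

lemma has_derivative_within_unique:
  fixes f :: "'v::euclidean_space \<Rightarrow> 'w::real_normed_vector"
  assumes "openin (top_of_set E) S" "openin (top_of_set E) S'" "subspace E" "x \<in> S" "x \<in> S'" "v \<in> E"
    and D: "(f has_derivative D) (at x within S)" "(h has_derivative D') (at x within S')"
    and "\<And>y. y \<in> S \<inter> S' \<Longrightarrow> f y = h y"
  shows "D v = D' v"
proof -
  have SS: "openin (top_of_set E) (S \<inter> S')" "x \<in> S \<inter> S'" using assms by auto
  have 1: "(f has_derivative D) (at x within S \<inter> S')" "(h has_derivative D') (at x within S \<inter> S')"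
    using has_derivative_subset[OF D(1)] has_derivative_subset[OF D(2)] by auto
  have "(f has_derivative D') (at x within S \<inter> S')"
    by (rule has_derivative_transform[OF _ _ 1(2)]) (use assms SS in auto)
  then show ?thesis
    using has_derivative_within_direction[OF SS(1) assms(3) SS(2) assms(6)] 1(1)
      vector_derivative_unique_at by blast
qed

text \<open>The extension agrees with \<open>f\<close> on the part of \<open>S\<close> near
  \<open>x\<close>, so its derivative also serves for \<open>f\<close>.\<close>

lemma smooth_on_has_derivative_ext:
  assumes "x \<in> S" "open U" "x \<in> U" "\<And>n. tdo n U h"
    "\<And>y. y \<in> S \<Longrightarrow> y \<in> U \<Longrightarrow> h y = f y"
  shows "(f has_derivative fderiv h x) (at x within S)"
proof (rule has_derivative_transform_eventually)
  show "(h has_derivative fderiv h x) (at x within S)"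
    using tdo_has_derivative[OF assms(4) assms(3)] by (rule has_derivative_at_withinI)
  show "\<forall>\<^sub>F y in at x within S. h y = f y"
    using assms by (auto simp: eventually_at_filter eventually_nhds)
qed (use assms in auto)

lemma smooth_on_has_derivative:
  assumes "smooth_on S f" "x \<in> S"
  shows "(f has_derivative frechet_derivative f (at x within S)) (at x within S)"
proof -
  obtain U h where "open U" "x \<in> U" "\<And>n. tdo n U h"
    "\<And>y. y \<in> S \<Longrightarrow> y \<in> U \<Longrightarrow> h y = f y"
    by (metis smooth_onE[OF assms])
  from smooth_on_has_derivative_ext[OF assms(2) this] show ?thesis
    unfolding frechet_derivative_works[symmetric] differentiable_def by blast
qed

text \<open>The derivative within \<open>S\<close> involves a choice off \<open>E\<close> that need
  not depend smoothly on the base point. On vectors of \<open>E\<close> it agrees with the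
  derivative of a local extension, which is smooth in the base point, and expansion in
  \<open>Basis\<close> accounts for the varying vector.\<close>

lemma smooth_on_derivative:
  fixes f :: "'v::euclidean_space \<Rightarrow> 'w::real_normed_vector" and a :: "'u::euclidean_space \<Rightarrow> 'v"
  assumes S: "openin (top_of_set E) S" "subspace E" and f: "smooth_on S f"
    and a: "smooth_on T a" "a ` T \<subseteq> S" and v: "smooth_on T v" "v ` T \<subseteq> E"
  shows "smooth_on T (\<lambda>y. frechet_derivative f (at (a y) within S) (v y))"
proof (rule smooth_on_local)
  fix x assume x: "x \<in> T"
  obtain U h where U: "open U" "a x \<in> U" "\<And>n. tdo n U h"
    "\<And>y. y \<in> S \<Longrightarrow> y \<in> U \<Longrightarrow> h y = f y"
    by (metis smooth_onE[OF f] a(2) image_subset_iff x)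
  obtain V where V: "open V" "V \<inter> T = a -` U \<inter> T"
    using smooth_on_continuous[OF a(1)] U(1) unfolding continuous_on_open_invariant by blast
  have xV: "x \<in> V" using U(2) V x by blast
  let ?f = "\<lambda>y. \<Sum>b\<in>Basis. (v y \<bullet> b) *\<^sub>R fderiv h (a y) b"
  have sub: "a ` (T \<inter> V) \<subseteq> U" using V by blast
  have "smooth_on (T \<inter> V) (\<lambda>y. v y \<bullet> b)" for b
    by (intro smooth_on_inner smooth_on_subset[OF v(1)] smooth_on_const) auto
  moreover have "smooth_on (T \<inter> V) (\<lambda>y. fderiv h (a y) b)" for b
  proof (rule smooth_on_compose[OF _ _ sub, of "\<lambda>z. fderiv h z b"])
    show "smooth_on U (\<lambda>z. fderiv h z b)"
    proof (rule smooth_on_open[OF U(1)])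
      show "tdo n U (\<lambda>z. fderiv h z b)" for n
        using U(3)[of "Suc n"] by simp
    qed
  qed (use smooth_on_subset[OF a(1)] in auto)
  ultimately have "smooth_on (T \<inter> V) ?f"
    by (intro smooth_on_sum smooth_on_scaleR)
  moreover have "?f y = frechet_derivative f (at (a y) within S) (v y)" if y: "y \<in> T \<inter> V" for y
  proof -
    have ay: "a y \<in> S" "a y \<in> U" "v y \<in> E" using y a v sub by auto
    have "?f y = fderiv h (a y) (v y)"
      by (rule linear_expand[symmetric])
        (rule has_derivative_linear[OF tdo_has_derivative[OF U(3) ay(2)]])
    also have "\<dots> = frechet_derivative f (at (a y) within S) (v y)"
      by (rule has_derivative_within_unique[OF S(1) S(1) S(2) ay(1) ay(1) ay(3)
            smooth_on_has_derivative_ext[OF ay(1) U(1) ay(2) U(3,4)]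
            smooth_on_has_derivative[OF f ay(1)] refl]) auto
    finally show ?thesis .
  qed
  ultimately have "smooth_on (T \<inter> V) (\<lambda>y. frechet_derivative f (at (a y) within S) (v y))"
    by (rule smooth_on_cong)
  then show "\<exists>V. open V \<and> x \<in> V \<and>
      smooth_on (T \<inter> V) (\<lambda>y. frechet_derivative f (at (a y) within S) (v y))"
    using V(1) xV by blast
qed

section \<open>Fibers of maps with uniformly bounded partial inverses\<close>

text \<open>Sum of the components along an orthonormal basis. The norm bound, from Pythagoras, later
  ensures that the projection maps a ball centred in the subspace into itself.\<close>

lemma orthogonal_projection_exists:
  fixes E :: "'v::euclidean_space set"
  assumes "subspace E"
  obtains p where "bounded_linear p" "\<And>v. p v \<in> E" "\<And>v. v \<in> E \<Longrightarrow> p v = v"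
    "\<And>v. norm (p v) \<le> norm v" "\<And>v e. e \<in> E \<Longrightarrow> (v - p v) \<bullet> e = 0"
proof -
  obtain B where B: "B \<subseteq> E" "pairwise orthogonal B" "\<And>x. x \<in> B \<Longrightarrow> norm x = 1"
    "independent B" "card B = dim E" "span B = E"
    using orthonormal_basis_subspace[OF assms] by metis
  have fin: "finite B" using B(4) independent_imp_finite by blast
  define p where "p v = (\<Sum>b\<in>B. (v \<bullet> b) *\<^sub>R b)" for v
  have lin: "linear p"
    by (rule linearI)
      (simp_all add: p_def inner_left_distrib algebra_simps sum.distrib scaleR_sum_right)
  have in_E: "p v \<in> E" for v
    unfolding p_def using B(1) assms by (intro subspace_sum subspace_scale) auto
  have orth_b: "(v - p v) \<bullet> b = 0" if b: "b \<in> B" for v b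
  proof -
    have "p v \<bullet> b = (\<Sum>e\<in>B. if e = b then v \<bullet> b else 0)"
      unfolding p_def inner_sum_left
    proof (intro sum.cong refl)
      fix e assume e: "e \<in> B"
      have "b \<bullet> b = 1" using B(3)[OF b] by (simp add: norm_eq_1)
      moreover have "e \<bullet> b = 0" if "e \<noteq> b" using B(2) e b that
        by (auto simp: pairwise_def orthogonal_def)
      ultimately show "(v \<bullet> e) *\<^sub>R e \<bullet> b = (if e = b then v \<bullet> b else 0)" by auto
    qed
    then show ?thesis using b fin by (simp add: inner_diff_left)
  qed
  have orth: "(v - p v) \<bullet> e = 0" if "e \<in> E" for v e
  proof -
    have "subspace {e. (v - p v) \<bullet> e = 0}"
      by (auto simp: subspace_def inner_right_distrib)
    then have "span B \<subseteq> {e. (v - p v) \<bullet> e = 0}"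
      using orth_b by (intro span_minimal) auto
    then show ?thesis using that B(6) by blast
  qed
  have pfix: "p v = v" if "v \<in> E" for v
  proof -
    have "(v - p v) \<bullet> (v - p v) = 0" using orth that in_E assms by (simp add: subspace_diff)
    then show ?thesis by simp
  qed
  have "norm (p v) \<le> norm v" for v
  proof -
    have "orthogonal (p v) (v - p v)" using orth[OF in_E] by (simp add: orthogonal_def inner_commute)
    from norm_add_Pythagorean[OF this] have "(norm (p v))\<^sup>2 \<le> (norm v)\<^sup>2" by simp
    then show ?thesis by (rule power2_le_imp_le) simp
  qed
  moreover have "bounded_linear p" using lin by (simp add: linear_conv_bounded_linear)
  ultimately show thesis by (intro that[of p] in_E pfix orth)
qed

text \<open>The hypothesis on \<open>C\<close> says that preimages under the derivatives can be chosen with uniformly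
  bounded norm; it prevents the rank of \<open>f\<close> from increasing near \<open>y0\<close> and thus replaces the
  constant rank condition.\<close>

lemma constant_rank_fiber:
  fixes f :: "'v::euclidean_space \<Rightarrow> 'w::euclidean_space"
  defines "D \<equiv> \<lambda>y. fderiv f y"
  assumes U: "open U" "y0 \<in> U" and f: "\<And>n. tdo n U f"
    and lift: "\<And>y v. y \<in> U \<Longrightarrow> \<exists>w. D y w = D y v \<and> norm w \<le> C * norm (D y v)"
  obtains G T p s where "open G" "y0 \<in> G" "G \<subseteq> U"
    "openin (top_of_set {v. D y0 v = 0}) T" "bounded_linear p" "range p \<subseteq> {v. D y0 v = 0}"
    "\<And>v. D y0 v = 0 \<Longrightarrow> p v = v" "smooth_on T s"
    "\<And>y. y \<in> G \<Longrightarrow> f y = f y0 \<Longrightarrow> p y \<in> T \<and> s (p y) = y"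
    "\<And>z. z \<in> T \<Longrightarrow> s z \<in> G \<and> f (s z) = f y0 \<and> p (s z) = z"
    "\<And>y. y \<in> G \<Longrightarrow> dim {v. D y v = 0} = dim {v. D y0 v = 0}"
proof -
  let ?K = "{v. D y0 v = 0}"
  have hd: "(f has_derivative D y) (at y)" if "y \<in> U" for y
    unfolding D_def using tdo_has_derivative[OF f that] .
  have lin: "linear (D y)" if "y \<in> U" for y using has_derivative_linear[OF hd[OF that]] .
  have K: "subspace {v. D y v = 0}" if "y \<in> U" for y
    using linear_subspace_kernel[OF lin[OF that]] .
  obtain p where p: "bounded_linear p" "\<And>v. p v \<in> ?K" "\<And>v. v \<in> ?K \<Longrightarrow> p v = v"
    "\<And>v. norm (p v) \<le> norm v" "\<And>v e. e \<in> ?K \<Longrightarrow> (v - p v) \<bullet> e = 0"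
    by (rule orthogonal_projection_exists[OF K[OF U(2)]]) (rule that)
  have plin: "linear p" using p(1) bounded_linear.linear by blast
  have pp: "p (p v) = p v" for v using p(2,3) by blast
  let ?W = "{v. p v = 0}"
  have "inj_on (D y0) ?W"
  proof (rule inj_onI)
    fix u v assume uv: "u \<in> ?W" "v \<in> ?W" "D y0 u = D y0 v"
    then have "D y0 (u - v) = 0" using linear_diff[OF lin[OF U(2)]] by simp
    then have "p (u - v) = u - v" using p(3) by blast
    then show "u = v" using uv linear_diff[OF plin] by simp
  qed
  \<comment> \<open>\<open>A\<close> inverts \<open>D y0\<close> on the complement of its kernel and
    takes values in that complement. Hence \<open>p\<close> and \<open>A\<close> composed with
    \<open>D y0\<close> add up to the identity, which is the content of \<open>AD\<close>
    below.\<close>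
  then obtain A where A: "range A \<subseteq> ?W" "linear A" "\<And>v. v \<in> ?W \<Longrightarrow> A (D y0 v) = v"
    using linear_exists_left_inverse_on[OF lin[OF U(2)] linear_subspace_kernel[OF plin]] by blast
  have Ab: "bounded_linear A" using A(2) linear_conv_bounded_linear by blast
  have pA: "p (A x) = 0" for x using A(1) by blast
  have AD: "A (D y0 v) = v - p v" for v
  proof -
    have "D y0 v = D y0 (v - p v)" using p(2) linear_diff[OF lin[OF U(2)]] by simp
    moreover have "v - p v \<in> ?W" using linear_diff[OF plin] pp by simp
    ultimately show ?thesis using A(3) by metis
  qed
  obtain a where a: "a > 0" "\<And>x. norm (A x) \<le> norm x * a"
    using bounded_linear.pos_bounded[OF Ab] by blast
  obtain b where b: "b > 0" "\<And>x. norm (D y0 x) \<le> norm x * b"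
    using bounded_linear.pos_bounded[of "D y0"] lin[OF U(2)] linear_conv_bounded_linear by blast
  \<comment> \<open>With the operator bounds \<open>a\<close> for \<open>A\<close> and
    \<open>b\<close> for \<open>D y0\<close>, this makes the factor in the estimate for
    \<open>key\<close> equal to |C| / (2 (|C| + 1)), which is below 1 for every real
    \<open>C\<close>.\<close>
  define \<eta> where "\<eta> = 1 / (2 * (1 + a * b) * (\<bar>C\<bar> + 1))"
  have eta: "\<eta> > 0" unfolding \<eta>_def using a b
    by (intro divide_pos_pos mult_pos_pos) (auto intro: add_pos_pos)
  have eta1: "(1 + a * b) * \<eta> * \<bar>C\<bar> < 1"
  proof -
    have pos: "1 + a * b > 0" "\<bar>C\<bar> + 1 > 0" using a b by (auto intro: add_pos_pos)
    have "(1 + a * b) * \<eta> * \<bar>C\<bar> = \<bar>C\<bar> / (2 * (\<bar>C\<bar> + 1))"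
    proof -
      have "x * (1 / (2 * x * y)) * c = c / (2 * y)" if "x > 0" for x y c :: real
        using that by simp
      from this[OF pos(1)] show ?thesis unfolding \<eta>_def .
    qed
    also have "\<dots> < 1" using pos(2) by (simp add: field_simps)
    finally show ?thesis .
  qed
  obtain U1 where U1: "open U1" "y0 \<in> U1" "U1 \<subseteq> U"
    "\<And>y v. y \<in> U1 \<Longrightarrow> norm (D y v - D y0 v) \<le> \<eta> * norm v"
  proof -
    \<comment> \<open>This sum over the basis dominates the operator norm of
      \<open>D y - D y0\<close> and is continuous, so a small value at \<open>y\<close> gives the
      uniform estimate.\<close>
    let ?d = "\<lambda>y. \<Sum>e\<in>Basis. norm (D y e - D y0 e)"
    have cont: "continuous_on U (\<lambda>y. D y e)" for e
      using f[of 1] unfolding D_def by simp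
    have "continuous_on U ?d"
      by (intro continuous_intros cont)
    then have o: "open (U \<inter> ?d -` {..<\<eta>})"
      by (intro continuous_open_preimage U(1) open_lessThan)
    have bd: "norm (D y v - D y0 v) \<le> \<eta> * norm v" if y: "y \<in> U \<inter> ?d -` {..<\<eta>}" for y v
    proof -
      have yU: "y \<in> U" using y by simp
      have "D y v - D y0 v = (\<Sum>e\<in>Basis. (v \<bullet> e) *\<^sub>R (D y e - D y0 e))"
        by (subst linear_expand[OF lin[OF yU]], subst linear_expand[OF lin[OF U(2)]])
          (simp add: sum_subtractf scaleR_diff_right)
      also have "norm \<dots> \<le> (\<Sum>e\<in>Basis. norm v * norm (D y e - D y0 e))"
        by (intro sum_norm_le) (auto intro!: mult_right_mono simp: Basis_le_norm)
      also have "\<dots> = norm v * ?d y" by (simp add: sum_distrib_left)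
      also have "\<dots> \<le> norm v * \<eta>" using y by (intro mult_left_mono) auto
      finally show ?thesis by (simp add: mult.commute)
    qed
    show thesis
    proof (rule that[OF o])
      show "y0 \<in> U \<inter> ?d -` {..<\<eta>}" using U(2) eta by simp
    qed (use bd in blast)+
  qed
  \<comment> \<open>Here the rank is kept from increasing. Take a bounded preimage \<open>w\<close>
    of \<open>D y v\<close> and put q = \<open>D y w - D y0 w\<close>. As \<open>A\<close> kills
    \<open>D y w\<close>, the component of \<open>w\<close> off the kernel of \<open>D y0\<close> is
    minus \<open>A\<close> q, whence \<open>D y w\<close> equals q - \<open>D y0\<close>
    (\<open>A\<close> q). Its norm is then at most a factor below 1 times itself.\<close>
  have key: "D y v = 0" if y: "y \<in> U1" and v: "A (D y v) = 0" for y v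
  proof -
    have yU: "y \<in> U" using y U1 by blast
    obtain w where w: "D y w = D y v" "norm w \<le> C * norm (D y v)" using lift[OF yU] by blast
    have p0: "D y0 (p x) = 0" for x using p(2) by blast
    have "D y0 w = D y0 (w - p w)" using p0 linear_diff[OF lin[OF U(2)]] by simp
    also have "w - p w = - A (D y w - D y0 w)" using AD v w(1) linear_diff[OF A(2)] by simp
    finally have "D y0 w = - D y0 (A (D y w - D y0 w))"
      using linear_neg[OF lin[OF U(2)]] by simp
    then have e: "D y w = (D y w - D y0 w) - D y0 (A (D y w - D y0 w))"
      by (simp only: diff_conv_add_uminus) simp
    let ?q = "D y w - D y0 w"
    have "norm (D y w) \<le> norm ?q + norm (D y0 (A ?q))"
      by (subst e) (rule norm_triangle_ineq4)
    also have "norm (D y0 (A ?q)) \<le> (norm ?q * a) * b"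
      using b(2)[of "A ?q"] a(2)[of ?q] b(1) by (meson mult_right_mono order.trans less_imp_le)
    also have "norm ?q + norm ?q * a * b = (1 + a * b) * norm ?q" by (simp add: algebra_simps)
    also have "\<dots> \<le> (1 + a * b) * (\<eta> * norm w)" using U1(4)[OF y] a b by (intro mult_left_mono) auto
    also have "\<dots> \<le> (1 + a * b) * (\<eta> * (\<bar>C\<bar> * norm (D y v)))"
    proof -
      have "norm w \<le> \<bar>C\<bar> * norm (D y v)" using w(2)
        by (meson abs_ge_self mult_right_mono norm_ge_zero order.trans)
      then show ?thesis using eta a b by (intro mult_left_mono) auto
    qed
    finally have "norm (D y v) \<le> ((1 + a * b) * \<eta> * \<bar>C\<bar>) * norm (D y v)"
      using w(1) by (simp add: mult.assoc)
    then have "norm (D y v) * (1 - (1 + a * b) * \<eta> * \<bar>C\<bar>) \<le> 0" by (simp add: algebra_simps)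
    then have "norm (D y v) \<le> 0" using eta1 by (simp add: mult_le_0_iff)
    then show ?thesis by simp
  qed
  \<comment> \<open>The straightening map: \<open>p\<close> keeps the coordinate along the kernel,
    and \<open>A\<close> records the value of \<open>f\<close> in the complement. By
    \<open>AD\<close> its derivative at \<open>y0\<close> is the identity.\<close>
  define \<Phi> where "\<Phi> y = p y + A (f y)" for y
  have Phi: "tdo n U1 \<Phi>" for n
    unfolding \<Phi>_def
    by (rule tdo_add[OF U1(1) tdo_linear[OF U1(1) p(1)]
          tdo_compose_linear[OF U1(1) Ab tdo_subset[OF U1(3) f]]])
  have DPhi: "(\<Phi> has_derivative (\<lambda>v. p v + A (D y v))) (at y)" if "y \<in> U1" for y
    unfolding \<Phi>_def
    by (rule has_derivative_add[OF bounded_linear_imp_has_derivative[OF p(1)]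
          bounded_linear.has_derivative[OF Ab hd]]) (use that U1(3) in blast)
  have DPhi': "fderiv \<Phi> y = (\<lambda>v. p v + A (D y v))" if "y \<in> U1" for y
    using frechet_derivative_at[OF DPhi[OF that]] by simp
  have "fderiv \<Phi> y0 = id" using DPhi'[OF U1(2)] AD by (simp add: fun_eq_iff)
  then obtain U' V g where inv: "open U'" "U' \<subseteq> U1" "y0 \<in> U'" "open V" "\<Phi> y0 \<in> V"
    "homeomorphism U' V \<Phi> g" "\<And>n. tdo n V g"
    "\<And>y. y \<in> V \<Longrightarrow> (g has_derivative inv (fderiv \<Phi> (g y))) (at y)"
    "\<And>y. y \<in> V \<Longrightarrow> bij (fderiv \<Phi> (g y))"
    using smooth_inverse_function[OF U1(1) Phi U1(2)] by metis
  have gP: "g (\<Phi> y) = y" "\<Phi> y \<in> V" if "y \<in> U'" for y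
    using inv(6) that unfolding homeomorphism_def by blast+
  have Pg: "\<Phi> (g y) = y" "g y \<in> U'" if "y \<in> V" for y
    using inv(6) that unfolding homeomorphism_def by blast+
  obtain r where r: "r > 0" "ball (\<Phi> y0) r \<subseteq> V" using inv(4,5) open_contains_ball by blast
  \<comment> \<open>On the level set of \<open>f\<close> through \<open>y0\<close> the second part
    of \<open>\<Phi>\<close> is constantly \<open>w0\<close>, so the level set is carried into the
    affine space \<open>w0\<close> + kernel, and \<open>s\<close> is the inverse of
    \<open>\<Phi>\<close> on it.\<close>
  define w0 where "w0 = A (f y0)"
  have P0: "\<Phi> y0 = p y0 + w0" by (simp add: \<Phi>_def w0_def)
  define G where "G = U' \<inter> \<Phi> -` ball (\<Phi> y0) r"
  have cP: "continuous_on U' \<Phi>" using inv(6) homeomorphism_cont1 by blast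
  have "open G" unfolding G_def by (intro continuous_open_preimage cP inv(1) open_ball)
  have GU: "G \<subseteq> U" using U1 inv G_def by blast
  have y0G: "y0 \<in> G" using inv(3) r by (simp add: G_def)
  define T where "T = ?K \<inter> ball (p y0) r"
  define s where "s z = g (z + w0)" for z
  have ballT: "z + w0 \<in> ball (\<Phi> y0) r \<longleftrightarrow> z \<in> ball (p y0) r" for z
    by (simp add: P0 dist_norm)
  have T: "openin (top_of_set ?K) T" unfolding T_def by (simp add: openin_open_Int)
  have shift: "smooth_on T (\<lambda>z. z + w0)" by (intro smooth_on_add smooth_on_id smooth_on_const)
  have s: "smooth_on T s" unfolding s_def
    by (rule smooth_on_compose[OF smooth_on_open[OF inv(4,7)] shift])
      (use ballT r(2) in \<open>auto simp: T_def\<close>)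
  have 1: "p y \<in> T \<and> s (p y) = y" if "y \<in> G" "f y = f y0" for y
  proof -
    have e: "p y + w0 = \<Phi> y" by (simp add: \<Phi>_def w0_def that)
    then have "p y \<in> ball (p y0) r" using that ballT[of "p y"] by (simp add: G_def)
    then show ?thesis using e gP p(2) that by (simp add: T_def s_def G_def)
  qed
  have ps: "p (s z) = z" and sG: "s z \<in> G" if "z \<in> T" for z
  proof -
    have zV: "z + w0 \<in> V" "z + w0 \<in> ball (\<Phi> y0) r" using that ballT r by (auto simp: T_def)
    have e: "\<Phi> (s z) = z + w0" using Pg[OF zV(1)] by (simp add: s_def)
    show "s z \<in> G" using e Pg(2)[OF zV(1)] zV(2) by (simp add: G_def s_def)
    have "p (\<Phi> (s z)) = p (z + w0)" using e by simp
    then show "p (s z) = z"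
      using that linear_add[OF plin] pA pp p(3) by (simp add: \<Phi>_def w0_def T_def)
  qed
  \<comment> \<open>Every point of the straightened affine slice lies on the level set. A derivative
    direction \<open>?v\<close> of the inverse along the kernel satisfies
    \<open>p ?v + A (D ?y ?v) = p u\<close>; applying \<open>p\<close> leaves
    \<open>p ?v = p u\<close>, so \<open>A\<close> kills \<open>D ?y ?v\<close>, and
    \<open>key\<close> kills the vector itself. The inner \<open>p\<close> extends the function to a
    full ball, which is convex and, by the norm bound, projected into itself.\<close>
  have "\<exists>c. \<forall>z\<in>ball (p y0) r. f (g (p z + w0)) = c"
  proof (rule has_derivative_zero_constant[OF convex_ball])
    fix z assume z: "z \<in> ball (p y0) r"
    have "norm (p (p y0 - z)) < r" using p(4)[of "p y0 - z"] z by (simp add: dist_norm)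
    then have "p z \<in> ball (p y0) r" using linear_diff[OF plin] pp by (simp add: dist_norm)
    then have zV: "p z + w0 \<in> V" using ballT r by blast
    let ?y = "g (p z + w0)"
    have yU: "?y \<in> U1" using Pg(2)[OF zV] inv by blast
    let ?I = "inv (fderiv \<Phi> ?y)"
    have "D ?y (?I (p u)) = 0" for u
    proof -
      let ?v = "?I (p u)"
      have "p ?v + A (D ?y ?v) = p u"
        using inv(9)[OF zV] DPhi'[OF yU] by (metis bij_inv_eq_iff)
      then have "p (p ?v + A (D ?y ?v)) = p (p u)" by simp
      then have "p ?v = p u" using linear_add[OF plin] pA pp by simp
      then have "A (D ?y ?v) = 0" using \<open>p ?v + A (D ?y ?v) = p u\<close> by simp
      then show ?thesis by (rule key[OF yU])
    qed
    moreover have "((\<lambda>z. f (g (p z + w0))) has_derivative (\<lambda>u. D ?y (?I (p u)))) (at z within ball (p y0) r)"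
    proof -
      have h1: "((\<lambda>z. p z + w0) has_derivative p) (at z)"
        using bounded_linear_imp_has_derivative[OF p(1)] by (auto intro!: derivative_eq_intros)
      have h2: "((\<lambda>z. g (p z + w0)) has_derivative (\<lambda>u. ?I (p u))) (at z)"
        using has_derivative_compose[OF h1 inv(8)[OF zV]] .
      have yU': "?y \<in> U" using yU U1 by blast
      show ?thesis
        using has_derivative_compose[OF h2 hd[OF yU']] has_derivative_at_withinI by blast
    qed
    ultimately show "((\<lambda>z. f (g (p z + w0))) has_derivative (\<lambda>h. 0)) (at z within ball (p y0) r)"
      by simp
  qed
  then obtain c where c: "\<And>z. z \<in> ball (p y0) r \<Longrightarrow> f (g (p z + w0)) = c" by blast
  have "c = f y0" using c[of "p y0"] r(1) pp P0 gP(1)[OF inv(3)] by simp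
  then have fs: "f (s z) = f y0" if "z \<in> T" for z
    using c[of z] that p(3)[of z] by (simp add: T_def s_def)
  \<comment> \<open>The derivative of \<open>\<Phi>\<close> at \<open>y\<close> maps the kernel at
    \<open>y\<close> isomorphically onto the kernel at \<open>y0\<close>. Surjectivity is again
    \<open>key\<close>: a preimage of a kernel vector has \<open>A (D y v) = 0\<close>.\<close>
  have dims: "dim {v. D y v = 0} = dim ?K" if y: "y \<in> G" for y
  proof -
    let ?P = "\<lambda>v. p v + A (D y v)"
    have yU: "y \<in> U1" "y \<in> U'" using y inv by (auto simp: G_def)
    then have yU': "y \<in> U" using U1 by blast
    have bij: "bij ?P" using inv(9)[of "\<Phi> y"] gP[OF yU(2)] DPhi'[OF yU(1)] by metis
    have Plin: "linear ?P"
      using DPhi[OF yU(1)] has_derivative_linear by blast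
    have "?P ` {v. D y v = 0} = ?K"
    proof
      show "?P ` {v. D y v = 0} \<subseteq> ?K" using p(2) linear_0[OF A(2)] by auto
      show "?K \<subseteq> ?P ` {v. D y v = 0}"
      proof
        fix k assume k: "k \<in> ?K"
        from surjD[OF bij_is_surj[OF bij], of k] obtain v where v: "k = ?P v" ..
        then have "p k = p (?P v)" by simp
        then have "k = p v" using p(3)[OF k] linear_add[OF plin] pp pA by simp
        then have "A (D y v) = 0" using v by simp
        then have "D y v = 0" by (rule key[OF yU(1)])
        then show "k \<in> ?P ` {v. D y v = 0}" using v by blast
      qed
    qed
    moreover have "inj_on ?P (span {v. D y v = 0})"
      using bij by (meson bij_is_inj inj_on_subset subset_UNIV)
    ultimately show ?thesis using dim_image_eq[OF Plin] by metis
  qed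
  show thesis
  proof (rule that[OF \<open>open G\<close> y0G GU T p(1) _ _ s])
    show "range p \<subseteq> ?K" using p(2) by blast
    show "p v = v" if "D y0 v = 0" for v using p(3) that by blast
    show "p y \<in> T \<and> s (p y) = y" if "y \<in> G" "f y = f y0" for y using 1 that by blast
    show "s z \<in> G \<and> f (s z) = f y0 \<and> p (s z) = z" if "z \<in> T" for z
      using sG[OF that] fs[OF that] ps[OF that] by blast
    show "dim {v. D y v = 0} = dim ?K" if "y \<in> G" for y by (rule dims[OF that])
  qed
qed

section \<open>Charts and tangent spaces\<close>

text \<open>Near \<open>x\<close> the sets \<open>S\<close> and \<open>R\<close> coincide, so a
  derivative found on the smaller set is one on the larger, and uniqueness on \<open>E\<close>
  identifies it with the chosen one.\<close>

lemma frechet_derivative_within_eqI: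
  fixes f :: "'v::euclidean_space \<Rightarrow> 'w::real_normed_vector"
  assumes S: "openin (top_of_set E) S" and R: "openin (top_of_set E) R" and E: "subspace E"
    and x: "x \<in> S" "S \<subseteq> R" and D: "(f has_derivative D) (at x within S)" and v: "v \<in> E"
  shows "frechet_derivative f (at x within R) v = D v"
proof -
  obtain G where G: "open G" "S = E \<inter> G" using S by (auto simp: openin_open)
  have "R \<subseteq> E" using R openin_imp_subset by blast
  then have "at x within S = at x within R"
    using G x by (intro at_within_nhd[of x G]) auto
  then have D': "(f has_derivative D) (at x within R)" using D by simp
  then have "(f has_derivative frechet_derivative f (at x within R)) (at x within R)"
    unfolding frechet_derivative_works[symmetric] differentiable_def by blast
  from has_derivative_within_unique[OF R R E _ _ v this D'] show ?thesis using x by auto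
qed

lemma chart_facts:
  assumes "is_chart X c"
  shows chart_openin: "openin X (chart_dom c)"
    and chart_subspace: "subspace (chart_model c)"
    and chart_image_openin: "openin (top_of_set (chart_model c)) (chart_map c ` chart_dom c)"
    and chart_inj: "inj_on (chart_map c) (chart_dom c)"
    and chart_cont: "continuous_map (subtopology X (chart_dom c)) euclidean (chart_map c)"
    and chart_open_map: "openin X U \<Longrightarrow> openin (top_of_set (chart_model c)) (chart_map c ` (chart_dom c \<inter> U))"
    and chart_preimage: "open G \<Longrightarrow> openin X {p \<in> chart_dom c. chart_map c p \<in> G}"
    and chart_inv_cont: "continuous_map (top_of_set (chart_map c ` chart_dom c)) X (chart_inv c)"
proof -
  have sub: "chart_dom c \<subseteq> topspace X" and *: "openin X (chart_dom c)" "subspace (chart_model c)"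
    "openin (top_of_set (chart_model c)) (chart_map c ` chart_dom c)"
    and h: "homeomorphic_map (subtopology X (chart_dom c)) (top_of_set (chart_map c ` chart_dom c)) (chart_map c)"
    using assms openin_subset unfolding is_chart_def by auto
  show "openin X (chart_dom c)" "subspace (chart_model c)"
    "openin (top_of_set (chart_model c)) (chart_map c ` chart_dom c)" by fact+
  have ts: "topspace (subtopology X (chart_dom c)) = chart_dom c" using sub by auto
  show inj: "inj_on (chart_map c) (chart_dom c)"
    using homeomorphic_imp_injective_map[OF h] ts by simp
  show cont: "continuous_map (subtopology X (chart_dom c)) euclidean (chart_map c)"
    using homeomorphic_imp_continuous_map[OF h] by (simp add: continuous_map_in_subtopology)
  show "openin (top_of_set (chart_model c)) (chart_map c ` (chart_dom c \<inter> U))" if "openin X U"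
  proof -
    have "openin (subtopology X (chart_dom c)) (chart_dom c \<inter> U)"
      using that by (simp add: openin_subtopology_Int2)
    then have "openin (top_of_set (chart_map c ` chart_dom c)) (chart_map c ` (chart_dom c \<inter> U))"
      using homeomorphic_imp_open_map[OF h] unfolding open_map_def by blast
    then show ?thesis using *(3) openin_trans by blast
  qed
  show "openin X {p \<in> chart_dom c. chart_map c p \<in> G}" if "open G"
  proof -
    have "openin (subtopology X (chart_dom c)) {p \<in> topspace (subtopology X (chart_dom c)). chart_map c p \<in> G}"
      using openin_continuous_map_preimage[OF cont] that by simp
    then show ?thesis using ts openin_trans_full *(1) by metis
  qed
  obtain k where k: "homeomorphic_maps (subtopology X (chart_dom c)) (top_of_set (chart_map c ` chart_dom c)) (chart_map c) k"
    using h homeomorphic_map_maps by blast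
  have "continuous_map (top_of_set (chart_map c ` chart_dom c)) X k"
    using k unfolding homeomorphic_maps_def by (simp add: continuous_map_in_subtopology)
  moreover have "k y = chart_inv c y" if "y \<in> topspace (top_of_set (chart_map c ` chart_dom c))" for y
    using that k inj ts unfolding homeomorphic_maps_def chart_inv_def by auto
  ultimately show "continuous_map (top_of_set (chart_map c ` chart_dom c)) X (chart_inv c)"
    by (rule continuous_map_eq)
qed

lemma chart_inv_map [simp]: "is_chart X c \<Longrightarrow> p \<in> chart_dom c \<Longrightarrow> chart_inv c (chart_map c p) = p"
  by (simp add: chart_inj chart_inv_def)

lemma chart_projection:
  assumes "is_chart X c"
  obtains \<pi> where "bounded_linear \<pi>" "\<And>v. \<pi> v \<in> chart_model c" "\<And>v. v \<in> chart_model c \<Longrightarrow> \<pi> v = v"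
    "linear \<pi>"
  using orthogonal_projection_exists[OF chart_subspace[OF assms]] bounded_linear.linear by metis

lemma manifold_chart: "smooth_manifold M \<Longrightarrow> c \<in> atlas M \<Longrightarrow> is_chart (mtop M) c"
  by (simp add: smooth_manifold_def)

lemma charts_at_chart: "smooth_manifold M \<Longrightarrow> c \<in> charts_at M p \<Longrightarrow> is_chart (mtop M) c"
  by (simp add: charts_at_def manifold_chart)

lemma charts_atD: "c \<in> charts_at M p \<Longrightarrow> c \<in> atlas M \<and> p \<in> chart_dom c"
  by (simp add: charts_at_def)

lemma charts_at_ex: "smooth_manifold M \<Longrightarrow> p \<in> points M \<Longrightarrow> \<exists>c. c \<in> charts_at M p"
  unfolding smooth_manifold_def charts_at_def by blast

lemma charts_at_points: "smooth_manifold M \<Longrightarrow> c \<in> charts_at M p \<Longrightarrow> p \<in> points M"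
  unfolding smooth_manifold_def charts_at_def by blast

lemma smooth_map_id: "smooth_manifold M \<Longrightarrow> smooth_map M M id"
  by (simp add: smooth_manifold_def smooth_map_def)

lemma rep_chart_map: "is_chart X c \<Longrightarrow> p \<in> chart_dom c \<Longrightarrow> rep c d f (chart_map c p) = chart_map d (f p)"
  by (simp add: rep_def)

lemma rep_dom_openin:
  assumes M: "smooth_manifold M" and N: "smooth_manifold N" and f: "continuous_map (mtop M) (mtop N) f"
    and c: "c \<in> atlas M" "d \<in> atlas N"
  shows "openin (top_of_set (chart_model c)) (rep_dom c d f)"
proof -
  have "openin (mtop M) {p \<in> points M. f p \<in> chart_dom d}"
    using openin_continuous_map_preimage[OF f] chart_openin[OF manifold_chart[OF N c(2)]] .
  moreover have "chart_dom c \<inter> {p \<in> points M. f p \<in> chart_dom d} = chart_dom c \<inter> f -` chart_dom d"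
    using openin_subset[OF chart_openin[OF manifold_chart[OF M c(1)]]] by auto
  ultimately show ?thesis unfolding rep_dom_def
    using chart_open_map[OF manifold_chart[OF M c(1)]] by metis
qed

lemma rep_has_derivative:
  assumes "smooth_map M N f" "c \<in> charts_at M p" "d \<in> charts_at N (f p)"
  shows "(rep c d f has_derivative rep_deriv c d f p) (at (chart_map c p) within rep_dom c d f)"
    and "chart_map c p \<in> rep_dom c d f"
proof -
  show x: "chart_map c p \<in> rep_dom c d f"
    using assms(2,3) by (auto simp: rep_dom_def charts_at_def)
  show "(rep c d f has_derivative rep_deriv c d f p) (at (chart_map c p) within rep_dom c d f)"
    unfolding rep_deriv_def
    by (rule smooth_on_has_derivative[OF _ x]) (use assms in \<open>auto simp: smooth_map_def charts_at_def\<close>)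
qed

lemma rep_deriv_linear:
  assumes "smooth_map M N f" "c \<in> charts_at M p" "d \<in> charts_at N (f p)"
  shows "linear (rep_deriv c d f p)"
  using rep_has_derivative(1)[OF assms] has_derivative_linear by blast

text \<open>The direct expression of the composite and the one through \<open>d\<close> have
  different domains; the chain rule is applied on their intersection, which is relatively open. With
  identity maps this is the cocycle rule for coordinate changes.\<close>

lemma rep_deriv_chain:
  assumes M: "smooth_manifold M" and N: "smooth_manifold N" and L: "smooth_manifold L"
    and f: "smooth_map M N f" and h: "smooth_map N L h"
    and c: "c \<in> charts_at M p" and d: "d \<in> charts_at N (f p)" and e: "e \<in> charts_at L (h (f p))"
    and v: "v \<in> chart_model c"
  shows "rep_deriv c e (h \<circ> f) p v = rep_deriv d e h (f p) (rep_deriv c d f p v)"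
proof -
  note cc = charts_atD[OF c] and dd = charts_atD[OF d] and ee = charts_atD[OF e]
  note C = charts_at_chart[OF M c] and Dc = charts_at_chart[OF N d]
  have cf: "continuous_map (mtop M) (mtop N) f" and ch: "continuous_map (mtop N) (mtop L) h"
    using f h by (auto simp: smooth_map_def)
  have chf: "continuous_map (mtop M) (mtop L) (h \<circ> f)" using continuous_map_compose[OF cf ch] .
  let ?x = "chart_map c p"
  define S where "S = rep_dom c d f \<inter> rep_dom c e (h \<circ> f)"
  have R: "openin (top_of_set (chart_model c)) (rep_dom c e (h \<circ> f))"
    by (rule rep_dom_openin[OF M L chf]) (use cc ee in auto)
  have S: "openin (top_of_set (chart_model c)) S" unfolding S_def
    by (intro openin_Int R rep_dom_openin[OF M N cf]) (use cc dd in auto)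
  have xS: "?x \<in> S" using cc dd ee by (auto simp: S_def rep_dom_def)
  have xf: "rep c d f ?x = chart_map d (f p)" using rep_chart_map[OF C] cc by blast
  have im: "rep c d f ` S \<subseteq> rep_dom d e h"
  proof (rule image_subsetI)
    fix y assume y: "y \<in> S"
    then obtain q where q: "q \<in> chart_dom c" "f q \<in> chart_dom d" "y = chart_map c q"
      by (auto simp: S_def rep_dom_def)
    obtain q' where q': "q' \<in> chart_dom c" "h (f q') \<in> chart_dom e" "y = chart_map c q'"
      using y by (auto simp: S_def rep_dom_def)
    have "q = q'" using inj_onD[OF chart_inj[OF C]] q q' by metis
    then have "h (f q) \<in> chart_dom e" using q' by simp
    then show "rep c d f y \<in> rep_dom d e h" using q rep_chart_map[OF C] by (auto simp: rep_dom_def)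
  qed
  have d1: "(rep c d f has_derivative rep_deriv c d f p) (at ?x within S)"
    by (rule has_derivative_subset[OF rep_has_derivative(1)[OF f c d]]) (simp add: S_def)
  have d2: "(rep d e h has_derivative rep_deriv d e h (f p)) (at (rep c d f ?x) within rep c d f ` S)"
    unfolding xf by (rule has_derivative_subset[OF rep_has_derivative(1)[OF h d e] im])
  have "((\<lambda>y. rep d e h (rep c d f y)) has_derivative (\<lambda>v. rep_deriv d e h (f p) (rep_deriv c d f p v))) (at ?x within S)"
    by (rule has_derivative_in_compose[OF d1 d2])
  then have hd: "(rep c e (h \<circ> f) has_derivative (\<lambda>v. rep_deriv d e h (f p) (rep_deriv c d f p v))) (at ?x within S)"
  proof (rule has_derivative_transform[OF xS, rotated])
    fix y assume "y \<in> S"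
    then obtain q where q: "q \<in> chart_dom c" "f q \<in> chart_dom d" "y = chart_map c q"
      by (auto simp: S_def rep_dom_def)
    show "rep c e (h \<circ> f) y = rep d e h (rep c d f y)"
      using q by (simp add: rep_chart_map[OF C] rep_chart_map[OF Dc])
  qed
  show ?thesis unfolding rep_deriv_def[of c e]
    by (rule frechet_derivative_within_eqI[OF S R chart_subspace[OF C] xS _ hd v]) (simp add: S_def)
qed

lemma rep_deriv_self:
  assumes M: "smooth_manifold M" and c: "c \<in> charts_at M p" and v: "v \<in> chart_model c"
  shows "rep_deriv c c id p v = v"
proof -
  note C = charts_at_chart[OF M c]
  have R: "openin (top_of_set (chart_model c)) (rep_dom c c id)"
    by (rule rep_dom_openin[OF M M]) (use charts_atD[OF c] in auto)
  have x: "chart_map c p \<in> rep_dom c c id" using charts_atD[OF c] by (auto simp: rep_dom_def)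
  have "(rep c c id has_derivative (\<lambda>v. v)) (at (chart_map c p) within rep_dom c c id)"
    by (rule has_derivative_transform[OF x _ has_derivative_ident])
      (auto simp: rep_dom_def rep_chart_map[OF C])
  from frechet_derivative_within_eqI[OF R R chart_subspace[OF C] x subset_refl this v]
  show ?thesis unfolding rep_deriv_def .
qed

text \<open>The coordinate expression takes values in the target model space, so projecting onto
  that space does not change it. By uniqueness the derivative equals its own projection.\<close>

lemma rep_deriv_in_model:
  assumes M: "smooth_manifold M" and N: "smooth_manifold N" and f: "smooth_map M N f"
    and c: "c \<in> charts_at M p" and d: "d \<in> charts_at N (f p)" and v: "v \<in> chart_model c"
  shows "rep_deriv c d f p v \<in> chart_model d"
proof -
  note C = charts_at_chart[OF M c] and Dc = charts_at_chart[OF N d]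
  obtain \<pi> where \<pi>: "bounded_linear \<pi>" "\<And>v. \<pi> v \<in> chart_model d" "\<And>v. v \<in> chart_model d \<Longrightarrow> \<pi> v = v"
    "linear \<pi>"
    by (rule chart_projection[OF Dc]) (rule that)
  have R: "openin (top_of_set (chart_model c)) (rep_dom c d f)"
    by (rule rep_dom_openin[OF M N]) (use charts_atD[OF c] charts_atD[OF d] f in \<open>auto simp: smooth_map_def\<close>)
  note x = rep_has_derivative(2)[OF f c d]
  note hd = rep_has_derivative(1)[OF f c d]
  have "((\<lambda>y. \<pi> (rep c d f y)) has_derivative (\<lambda>v. \<pi> (rep_deriv c d f p v)))
      (at (chart_map c p) within rep_dom c d f)"
    by (rule bounded_linear.has_derivative[OF \<pi>(1) hd])
  then have "(rep c d f has_derivative (\<lambda>v. \<pi> (rep_deriv c d f p v)))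
      (at (chart_map c p) within rep_dom c d f)"
  proof (rule has_derivative_transform[OF x, rotated])
    fix y assume "y \<in> rep_dom c d f"
    then have "rep c d f y \<in> chart_map d ` chart_dom d"
      by (auto simp: rep_dom_def rep_chart_map[OF C])
    then have "rep c d f y \<in> chart_model d"
      using openin_imp_subset[OF chart_image_openin[OF Dc]] by blast
    then show "rep c d f y = \<pi> (rep c d f y)" using \<pi>(3) by simp
  qed
  from has_derivative_within_unique[OF R R chart_subspace[OF C] x x v hd this refl]
  have "rep_deriv c d f p v = \<pi> (rep_deriv c d f p v)" .
  then show ?thesis using \<pi>(2) by metis
qed

text \<open>The inverse of the coordinate map from the tangent space at \<open>p\<close> to the
  model space of \<open>c\<close>. With \<open>v\<close> fixed and \<open>p\<close> varying it is a
  coordinate vector field of \<open>c\<close>.\<close>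

definition tvec :: "('a, 'e::euclidean_space) manifold \<Rightarrow> 'a \<Rightarrow> ('a, 'e) chart \<Rightarrow> 'e \<Rightarrow> ('a, 'e) tangent_vector"
  where "tvec M p c v = (\<lambda>d. if d \<in> charts_at M p then rep_deriv c d id p v else 0)"

lemma tvec_self: "smooth_manifold M \<Longrightarrow> c \<in> charts_at M p \<Longrightarrow> v \<in> chart_model c \<Longrightarrow> tvec M p c v c = v"
  by (simp add: tvec_def rep_deriv_self)

text \<open>Compatibility between two further charts is the chain rule for the coordinate
  changes.\<close>

lemma tvec_in_tangent_space:
  assumes M: "smooth_manifold M" and c: "c \<in> charts_at M p" and v: "v \<in> chart_model c"
  shows "tvec M p c v \<in> tangent_space M p"
proof -
  have 1: "rep_deriv c d id p v \<in> chart_model d" if "d \<in> charts_at M p" for d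
    using rep_deriv_in_model[OF M M smooth_map_id[OF M] c _ v] that by simp
  have 2: "rep_deriv c d' id p v = rep_deriv d d' id p (rep_deriv c d id p v)"
    if "d \<in> charts_at M p" "d' \<in> charts_at M p" for d d'
    using rep_deriv_chain[OF M M M smooth_map_id[OF M] smooth_map_id[OF M] c, of d d' v] that v
    by simp
  show ?thesis
    unfolding tangent_space_def tvec_def
  proof (intro CollectI conjI ballI allI impI)
    fix d d' assume d: "d \<in> charts_at M p" "d' \<in> charts_at M p"
    show "(if d' \<in> charts_at M p then rep_deriv c d' id p v else 0) =
        rep_deriv d d' id p (if d \<in> charts_at M p then rep_deriv c d id p v else 0)"
      using 2[OF d] d by simp
  qed (use 1 in auto)
qed

lemma tangent_coord:
  "v \<in> tangent_space M p \<Longrightarrow> c \<in> charts_at M p \<Longrightarrow> v c \<in> chart_model c"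
  "v \<in> tangent_space M p \<Longrightarrow> c \<in> charts_at M p \<Longrightarrow> d \<in> charts_at M p \<Longrightarrow> v d = rep_deriv c d id p (v c)"
  "v \<in> tangent_space M p \<Longrightarrow> c \<notin> charts_at M p \<Longrightarrow> v c = 0"
  unfolding tangent_space_def by blast+

lemma tangent_eq_tvec:
  assumes "v \<in> tangent_space M p" "c \<in> charts_at M p"
  shows "v = tvec M p c (v c)"
proof
  fix d
  show "v d = tvec M p c (v c) d"
    using tangent_coord(2)[OF assms, of d] tangent_coord(3)[OF assms(1), of d]
    unfolding tvec_def by simp
qed

lemma tangent_eqI:
  assumes "u \<in> tangent_space M p" "v \<in> tangent_space M p" "c \<in> charts_at M p" "u c = v c"
  shows "u = v"
  using tangent_eq_tvec[OF assms(1,3)] tangent_eq_tvec[OF assms(2,3)] assms(4) by metis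

lemma linear_on_sum:
  assumes T: "subspace T" and f: "linear_on T f" and x: "\<And>e. x e \<in> T"
  shows "f (\<Sum>e\<in>A. r e *\<^sub>R x e) = (\<Sum>e\<in>A. r e *\<^sub>R f (x e))"
proof -
  have f0: "f 0 = 0" using f subspace_0[OF T] unfolding linear_on_def by (metis scaleR_zero_left)
  show ?thesis
  proof (induction A rule: infinite_finite_induct)
    case (insert a A)
    have "(\<Sum>e\<in>A. r e *\<^sub>R x e) \<in> T" by (intro subspace_sum subspace_scale T x)
    then have "f (r a *\<^sub>R x a + (\<Sum>e\<in>A. r e *\<^sub>R x e)) = r a *\<^sub>R f (x a) + f (\<Sum>e\<in>A. r e *\<^sub>R x e)"
      using f x subspace_scale[OF T x] unfolding linear_on_def by simp
    then show ?case by (simp only: sum.insert[OF insert(1,2)] insert(3))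
  qed (simp_all only: sum.empty sum.infinite f0 not_False_eq_True)
qed

lemma subspace_tangent_space:
  assumes M: "smooth_manifold M"
  shows "subspace (tangent_space M p)"
proof -
  have l: "linear (rep_deriv c d id p)" if "c \<in> charts_at M p" "d \<in> charts_at M p" for c d
    using rep_deriv_linear[OF smooth_map_id[OF M] that(1)] that(2) by simp
  have s: "subspace (chart_model c)" if "c \<in> charts_at M p" for c
    using charts_at_chart[OF M that] chart_subspace by blast
  show ?thesis
  proof (rule subspaceI)
    show "0 \<in> tangent_space M p"
      unfolding tangent_space_def using subspace_0[OF s] linear_0[OF l] by (simp add: zero_fun_def)
    show "u + v \<in> tangent_space M p" if "u \<in> tangent_space M p" "v \<in> tangent_space M p" for u v
    proof -
      have "(u + v) d = rep_deriv c d id p ((u + v) c)" if c: "c \<in> charts_at M p" "d \<in> charts_at M p" for c d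
        using tangent_coord(2)[OF \<open>u \<in> _\<close> c] tangent_coord(2)[OF \<open>v \<in> _\<close> c]
        by (simp add: linear_add[OF l[OF c]])
      moreover have "(u + v) c \<in> chart_model c" if "c \<in> charts_at M p" for c
        using tangent_coord(1)[OF \<open>u \<in> _\<close> that] tangent_coord(1)[OF \<open>v \<in> _\<close> that]
        by (simp add: subspace_add[OF s[OF that]])
      moreover have "(u + v) c = 0" if "c \<notin> charts_at M p" for c
        using tangent_coord(3)[OF \<open>u \<in> _\<close> that] tangent_coord(3)[OF \<open>v \<in> _\<close> that] by simp
      ultimately show ?thesis unfolding tangent_space_def by blast
    qed
    show "a *\<^sub>R v \<in> tangent_space M p" if "v \<in> tangent_space M p" for a v
    proof -
      have "(a *\<^sub>R v) d = rep_deriv c d id p ((a *\<^sub>R v) c)"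
        if c: "c \<in> charts_at M p" "d \<in> charts_at M p" for c d
        using tangent_coord(2)[OF \<open>v \<in> _\<close> c] by (simp add: scaleR_fun_def linear_scale[OF l[OF c]])
      moreover have "(a *\<^sub>R v) c \<in> chart_model c" if "c \<in> charts_at M p" for c
        using tangent_coord(1)[OF \<open>v \<in> _\<close> that]
        by (simp add: scaleR_fun_def subspace_scale[OF s[OF that]])
      moreover have "(a *\<^sub>R v) c = 0" if "c \<notin> charts_at M p" for c
        using tangent_coord(3)[OF \<open>v \<in> _\<close> that] by (simp add: scaleR_fun_def)
      ultimately show ?thesis unfolding tangent_space_def by blast
    qed
  qed
qed

text \<open>Justifies the definite description: a candidate built from one pair of charts has the
  right entries for all pairs by the chain rule, and a tangent vector is determined by one
  entry.\<close>

lemma differential_tangent: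
  assumes M: "smooth_manifold M" and N: "smooth_manifold N" and f: "smooth_map M N f"
    and v: "v \<in> tangent_space M p" and p: "p \<in> points M"
  shows "differential M N f p v \<in> tangent_space N (f p)"
    and "c \<in> charts_at M p \<Longrightarrow> d \<in> charts_at N (f p) \<Longrightarrow>
      differential M N f p v d = rep_deriv c d f p (v c)"
proof -
  have fp: "f p \<in> points N" using f p by (auto simp: smooth_map_def continuous_map_def)
  obtain c0 d0 where c0: "c0 \<in> charts_at M p" and d0: "d0 \<in> charts_at N (f p)"
    using charts_at_ex[OF M p] charts_at_ex[OF N fp] by blast
  let ?w = "tvec N (f p) d0 (rep_deriv c0 d0 f p (v c0))"
  let ?P = "\<lambda>w. w \<in> tangent_space N (f p) \<and>
    (\<forall>c\<in>charts_at M p. \<forall>d\<in>charts_at N (f p). w d = rep_deriv c d f p (v c))"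
  have m: "rep_deriv c0 d0 f p (v c0) \<in> chart_model d0"
    using rep_deriv_in_model[OF M N f c0 d0 tangent_coord(1)[OF v c0]] .
  have 1: "?w \<in> tangent_space N (f p)" using tvec_in_tangent_space[OF N d0 m] .
  have "?w d = rep_deriv c d f p (v c)" if c: "c \<in> charts_at M p" and d: "d \<in> charts_at N (f p)" for c d
  proof -
    have "?w d = rep_deriv d0 d id (f p) (rep_deriv c0 d0 f p (v c0))" using d by (simp add: tvec_def)
    also have "\<dots> = rep_deriv c0 d (id \<circ> f) p (v c0)"
      using rep_deriv_chain[OF M N N f smooth_map_id[OF N] c0 d0, of d] tangent_coord(1)[OF v c0] d
      by simp
    also have "\<dots> = rep_deriv c d f p (rep_deriv c0 c id p (v c0))"
      using rep_deriv_chain[OF M M N smooth_map_id[OF M] f c0, of c d] tangent_coord(1)[OF v c0] c d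
      by simp
    also have "rep_deriv c0 c id p (v c0) = v c" using tangent_coord(2)[OF v c0 c] by simp
    finally show ?thesis .
  qed
  then have "?P ?w" using 1 by blast
  moreover have "w = ?w" if "?P w" for w
    by (rule tangent_eqI[OF _ 1 d0]) (use that \<open>?P ?w\<close> c0 d0 in auto)
  ultimately have "?P (differential M N f p v)"
    unfolding differential_def by (rule theI)
  then show "differential M N f p v \<in> tangent_space N (f p)"
    and "c \<in> charts_at M p \<Longrightarrow> d \<in> charts_at N (f p) \<Longrightarrow> differential M N f p v d = rep_deriv c d f p (v c)"
    by blast+
qed

lemma scaleR_fun_apply: "(a *\<^sub>R f) x = a *\<^sub>R f x"
  by (simp add: scaleR_fun_def)

lemma differential_linear_on:
  assumes M: "smooth_manifold M" and N: "smooth_manifold N" and f: "smooth_map M N f"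
    and p: "p \<in> points M"
  shows "linear_on (tangent_space M p) (differential M N f p)"
proof -
  note T = subspace_tangent_space[OF M, of p] and T' = subspace_tangent_space[OF N, of "f p"]
  note t = differential_tangent(1)[OF M N f _ p] and co = differential_tangent(2)[OF M N f _ p]
  have fp: "f p \<in> points N" using f p by (auto simp: smooth_map_def continuous_map_def)
  obtain c d where c: "c \<in> charts_at M p" and d: "d \<in> charts_at N (f p)"
    using charts_at_ex[OF M p] charts_at_ex[OF N fp] by blast
  note l = rep_deriv_linear[OF f c d]
  have "differential M N f p (u + v) = differential M N f p u + differential M N f p v"
    if "u \<in> tangent_space M p" "v \<in> tangent_space M p" for u v
    by (rule tangent_eqI[OF t subspace_add[OF T' t t] d])
      (use that T c d in \<open>simp_all add: subspace_add co linear_add[OF l]\<close>)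
  moreover have "differential M N f p (a *\<^sub>R v) = a *\<^sub>R differential M N f p v"
    if "v \<in> tangent_space M p" for a v
    by (rule tangent_eqI[OF t subspace_scale[OF T' t] d])
      (use that T c d in \<open>simp_all add: subspace_scale co scaleR_fun_apply linear_scale[OF l]\<close>)
  ultimately show ?thesis by (simp add: linear_on_def)
qed

section \<open>Fields along maps into a manifold\<close>

text \<open>A field on a fiber is not a field on an open subset of the ambient manifold. It is
  treated as a field along a map \<open>a\<close> from a coordinate domain, and smoothness is tested
  in one chart, chosen around the image of \<open>a\<close>.\<close>

definition smooth_along :: "('a, 'e::euclidean_space) manifold \<Rightarrow> ('a, 'e) chart \<Rightarrow> 'u::euclidean_space set \<Rightarrow>
    ('u \<Rightarrow> 'a) \<Rightarrow> ('u \<Rightarrow> ('a, 'e) tangent_vector) \<Rightarrow> bool"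
  where "smooth_along M c T a V \<longleftrightarrow>
    (\<forall>y\<in>T. V y \<in> tangent_space M (a y)) \<and> smooth_on T (\<lambda>y. V y c)"

lemma smooth_along_subset: "smooth_along M c T a V \<Longrightarrow> T' \<subseteq> T \<Longrightarrow> smooth_along M c T' a V"
  unfolding smooth_along_def using smooth_on_subset by blast

lemma smooth_along_cong:
  assumes "smooth_along M c T a V" "\<And>y. y \<in> T \<Longrightarrow> V y = W y"
  shows "smooth_along M c T a W"
proof -
  have "smooth_on T (\<lambda>y. W y c)"
    by (rule smooth_on_cong[of T "\<lambda>y. V y c"]) (use assms in \<open>auto simp: smooth_along_def\<close>)
  then show ?thesis using assms by (auto simp: smooth_along_def)
qed

lemma smooth_along_add:
  "smooth_manifold M \<Longrightarrow> smooth_along M c T a V \<Longrightarrow> smooth_along M c T a W \<Longrightarrow>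
    smooth_along M c T a (\<lambda>y. V y + W y)"
  by (simp add: smooth_along_def smooth_on_add subspace_add[OF subspace_tangent_space])

lemma smooth_along_scale:
  "smooth_manifold M \<Longrightarrow> smooth_on T r \<Longrightarrow> smooth_along M c T a V \<Longrightarrow>
    smooth_along M c T a (\<lambda>y. r y *\<^sub>R V y)"
  by (simp add: smooth_along_def scaleR_fun_apply smooth_on_scaleR
      subspace_scale[OF subspace_tangent_space])

lemma smooth_along_zero: "smooth_manifold M \<Longrightarrow> smooth_along M c T a (\<lambda>y. 0)"
  by (simp add: smooth_along_def smooth_on_const subspace_0[OF subspace_tangent_space])

text \<open>In another chart the entry is the derivative of the coordinate change applied to the
  fixed vector \<open>v\<close>.\<close>

lemma smooth_vector_field_tvec:
  assumes M: "smooth_manifold M" and c: "c \<in> atlas M" and v: "v \<in> chart_model c"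
  shows "smooth_vector_field M (chart_dom c) (\<lambda>q. tvec M q c v)"
  unfolding smooth_vector_field_def
proof (intro conjI ballI)
  show "tvec M q c v \<in> tangent_space M q" if "q \<in> chart_dom c" for q
    using tvec_in_tangent_space[OF M _ v] that c by (simp add: charts_at_def)
  fix d assume d: "d \<in> atlas M"
  note C = manifold_chart[OF M c] and Dc = manifold_chart[OF M d]
  let ?T = "chart_map d ` (chart_dom d \<inter> chart_dom c)"
  have TT: "?T = rep_dom d c id" by (simp add: rep_dom_def vimage_def)
  have R: "openin (top_of_set (chart_model c)) (rep_dom c d id)"
    by (rule rep_dom_openin[OF M M _ c d]) simp
  have s: "smooth_on ?T (\<lambda>y. frechet_derivative (rep c d id) (at (rep d c id y) within rep_dom c d id) v)"
  proof (rule smooth_on_derivative[OF R chart_subspace[OF C]])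
    show "smooth_on (rep_dom c d id) (rep c d id)" "smooth_on ?T (rep d c id)"
      unfolding TT using M c d by (auto simp: smooth_manifold_def)
    show "rep d c id ` ?T \<subseteq> rep_dom c d id"
      by (auto simp: rep_dom_def rep_chart_map[OF Dc])
  qed (use v smooth_on_const in auto)
  show "smooth_on ?T (\<lambda>y. tvec M (chart_inv d y) c v d)"
  proof (rule smooth_on_cong[OF s])
    fix y assume "y \<in> ?T"
    then obtain q where q: "q \<in> chart_dom d" "q \<in> chart_dom c" "y = chart_map d q" by auto
    then have "d \<in> charts_at M (chart_inv d y)" using d Dc by (simp add: charts_at_def)
    then show "frechet_derivative (rep c d id) (at (rep d c id y) within rep_dom c d id) v =
        tvec M (chart_inv d y) c v d"
      using q Dc by (simp add: tvec_def rep_deriv_def rep_chart_map)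
  qed
qed

lemma field_along:
  assumes M: "smooth_manifold M" and c: "c \<in> atlas M"
    and a: "smooth_on T (\<lambda>y. chart_map c (a y))" "a ` T \<subseteq> chart_dom c \<inter> U"
    and X: "smooth_vector_field M U X"
  shows "smooth_along M c T a (\<lambda>y. X (a y))"
proof -
  note C = manifold_chart[OF M c]
  have "smooth_on (chart_map c ` (chart_dom c \<inter> U)) (\<lambda>y. X (chart_inv c y) c)"
    using X c by (simp add: smooth_vector_field_def)
  moreover have "(\<lambda>y. chart_map c (a y)) ` T \<subseteq> chart_map c ` (chart_dom c \<inter> U)"
    using a(2) by blast
  ultimately have "smooth_on T (\<lambda>y. X (chart_inv c (chart_map c (a y))) c)"
    by (rule smooth_on_compose[OF _ a(1)])
  then have "smooth_on T (\<lambda>y. X (a y) c)"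
    by (rule smooth_on_cong) (use a(2) C in auto)
  then show ?thesis using X a(2) by (auto simp: smooth_along_def smooth_vector_field_def)
qed

text \<open>The projections of the ambient basis vectors span the model space but may be dependent.
  The coefficients are nevertheless canonical, being ambient coordinates of \<open>v c\<close>, and
  so vary smoothly with \<open>v\<close>.\<close>

lemma tangent_frame_expand:
  assumes M: "smooth_manifold M" and c: "c \<in> charts_at M p" and v: "v \<in> tangent_space M p"
    and \<pi>: "linear \<pi>" "\<And>v. \<pi> v \<in> chart_model c" "\<And>v. v \<in> chart_model c \<Longrightarrow> \<pi> v = v"
  shows "v = (\<Sum>e\<in>Basis. (v c \<bullet> e) *\<^sub>R tvec M p c (\<pi> e))"
proof (rule tangent_eqI[OF v _ c])
  have t: "tvec M p c (\<pi> e) \<in> tangent_space M p" for e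
    using tvec_in_tangent_space[OF M c \<pi>(2)] .
  show "(\<Sum>e\<in>Basis. (v c \<bullet> e) *\<^sub>R tvec M p c (\<pi> e)) \<in> tangent_space M p"
    by (intro subspace_sum subspace_scale subspace_tangent_space[OF M] t)
  have ev: "(\<Sum>e\<in>A. f e) c = (\<Sum>e\<in>A. f e c)" for A and f :: "'b \<Rightarrow> ('a, 'b) tangent_vector"
    by (induction A rule: infinite_finite_induct) auto
  have "v c = \<pi> (v c)" using \<pi>(3) tangent_coord(1)[OF v c] by simp
  also have "\<dots> = (\<Sum>e\<in>Basis. (v c \<bullet> e) *\<^sub>R \<pi> e)" by (rule linear_expand[OF \<pi>(1)])
  finally show "v c = (\<Sum>e\<in>Basis. (v c \<bullet> e) *\<^sub>R tvec M p c (\<pi> e)) c"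
    unfolding ev scaleR_fun_apply tvec_self[OF M c \<pi>(2)] .
qed

text \<open>Smoothness of \<open>J\<close> is postulated for fields on open sets. Coordinate fields
  are such fields, and pointwise linearity extends the statement to combinations whose coefficients
  are defined only along \<open>a\<close>.\<close>

lemma endo_along:
  assumes M: "smooth_manifold M" and c: "c \<in> atlas M"
    and a: "smooth_on T (\<lambda>y. chart_map c (a y))" "a ` T \<subseteq> chart_dom c"
    and J: "smooth_endomorphism M J" and V: "smooth_along M c T a V"
  shows "smooth_along M c T a (\<lambda>y. J (a y) (V y))"
proof -
  note C = manifold_chart[OF M c]
  obtain \<pi> where \<pi>: "bounded_linear \<pi>" "\<And>v. \<pi> v \<in> chart_model c" "\<And>v. v \<in> chart_model c \<Longrightarrow> \<pi> v = v"
    and lin: "linear \<pi>"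
    by (rule chart_projection[OF C]) (rule that)
  have cy: "c \<in> charts_at M (a y)" "a y \<in> points M" if "y \<in> T" for y
  proof -
    show *: "c \<in> charts_at M (a y)" using that a(2) c by (auto simp: charts_at_def)
    show "a y \<in> points M" using charts_at_points[OF M *] .
  qed
  let ?X = "\<lambda>e q. tvec M q c (\<pi> e)"
  have X: "smooth_along M c T a (\<lambda>y. J (a y) (?X e (a y)))" for e
  proof (rule field_along[OF M c a(1), of "chart_dom c"])
    show "smooth_vector_field M (chart_dom c) (\<lambda>q. J q (?X e q))"
      using J smooth_vector_field_tvec[OF M c \<pi>(2)] chart_openin[OF C]
      unfolding smooth_endomorphism_def by blast
  qed (use a in auto)
  have co: "smooth_on T (\<lambda>y. V y c \<bullet> e)" for e
    using V unfolding smooth_along_def by (intro smooth_on_inner smooth_on_const) auto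
  have sum: "smooth_along M c T a (\<lambda>y. \<Sum>e\<in>B. (V y c \<bullet> e) *\<^sub>R J (a y) (?X e (a y)))" for B
  proof (induction B rule: infinite_finite_induct)
    case (insert x F)
    show ?case unfolding sum.insert[OF insert(1,2)]
      by (rule smooth_along_add[OF M smooth_along_scale[OF M co X] insert(3)])
  qed (simp_all only: sum.empty sum.infinite smooth_along_zero[OF M] not_False_eq_True)
  have "(\<Sum>e\<in>Basis. (V y c \<bullet> e) *\<^sub>R J (a y) (?X e (a y))) = J (a y) (V y)" if y: "y \<in> T" for y
  proof -
    have t: "?X e (a y) \<in> tangent_space M (a y)" for e
      using tvec_in_tangent_space[OF M cy(1)[OF y] \<pi>(2)] .
    have Jl: "linear_on (tangent_space M (a y)) (J (a y))"
      using J cy(2)[OF y] by (simp add: smooth_endomorphism_def)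
    have "J (a y) (\<Sum>e\<in>Basis. (V y c \<bullet> e) *\<^sub>R ?X e (a y)) =
        (\<Sum>e\<in>Basis. (V y c \<bullet> e) *\<^sub>R J (a y) (?X e (a y)))"
      by (rule linear_on_sum[OF subspace_tangent_space[OF M] Jl t])
    moreover have "V y = (\<Sum>e\<in>Basis. (V y c \<bullet> e) *\<^sub>R ?X e (a y))"
      by (rule tangent_frame_expand[OF M cy(1)[OF y] _ lin \<pi>(2,3)])
        (use V y in \<open>auto simp: smooth_along_def\<close>)
    ultimately show ?thesis by metis
  qed
  from smooth_along_cong[OF sum this] show ?thesis .
qed

section \<open>Riemannian metrics in coordinates and along maps\<close>

lemma riemannian_inner_on:
  assumes "riemannian_manifold M g" "p \<in> points M"
  shows "inner_on (tangent_space M p) (g p)"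
proof -
  have "\<forall>p\<in>points M. \<forall>u\<in>tangent_space M p. linear_on (tangent_space M p) (g p u) \<and>
      (\<forall>v\<in>tangent_space M p. g p u v = g p v u) \<and> (u \<noteq> 0 \<longrightarrow> g p u u > 0)"
    using assms(1) unfolding riemannian_manifold_def riemannian_metric_def by (elim conjE)
  moreover have "subspace (tangent_space M p)"
    using assms(1) by (simp add: riemannian_manifold_def subspace_tangent_space)
  ultimately show ?thesis using assms(2) unfolding inner_on_def by simp
qed

lemma metric_expand:
  assumes M: "riemannian_manifold M g" and c: "c \<in> charts_at M p"
    and u: "u \<in> tangent_space M p" and v: "v \<in> tangent_space M p"
    and \<pi>: "linear \<pi>" "\<And>v. \<pi> v \<in> chart_model c" "\<And>v. v \<in> chart_model c \<Longrightarrow> \<pi> v = v"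
  shows "g p u v = (\<Sum>i\<in>Basis. \<Sum>j\<in>Basis. (u c \<bullet> i) * ((v c \<bullet> j) *
      g p (tvec M p c (\<pi> i)) (tvec M p c (\<pi> j))))"
proof -
  have sm: "smooth_manifold M" using M by (simp add: riemannian_manifold_def)
  interpret inner_on "tangent_space M p" "g p"
    by (rule riemannian_inner_on[OF M charts_at_points[OF sm c]])
  let ?X = "\<lambda>e. tvec M p c (\<pi> e)"
  have t: "?X e \<in> tangent_space M p" for e using tvec_in_tangent_space[OF sm c \<pi>(2)] .
  have r: "g p w (\<Sum>e\<in>B. f e *\<^sub>R ?X e) = (\<Sum>e\<in>B. f e * g p w (?X e))"
    if w: "w \<in> tangent_space M p" for w f and B :: "'b set"
    using linear_on_sum[OF T lin[OF w], of ?X, OF t] by simp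
  have l: "g p (\<Sum>e\<in>B. f e *\<^sub>R ?X e) w = (\<Sum>e\<in>B. f e * g p (?X e) w)"
    if w: "w \<in> tangent_space M p" for w f and B :: "'b set"
  proof -
    have s: "(\<Sum>e\<in>B. f e *\<^sub>R ?X e) \<in> tangent_space M p" by (intro subspace_sum subspace_scale T t)
    show ?thesis unfolding sym[OF s w] r[OF w] by (intro sum.cong refl) (simp add: sym[OF w t])
  qed
  have "g p u v = g p (\<Sum>i\<in>Basis. (u c \<bullet> i) *\<^sub>R ?X i) v"
    using tangent_frame_expand[OF sm c u \<pi>] by simp
  also have "\<dots> = (\<Sum>i\<in>Basis. (u c \<bullet> i) * g p (?X i) v)" by (rule l[OF v])
  also have "\<dots> = (\<Sum>i\<in>Basis. (u c \<bullet> i) * g p (?X i) (\<Sum>j\<in>Basis. (v c \<bullet> j) *\<^sub>R ?X j))"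
    using tangent_frame_expand[OF sm c v \<pi>] by simp
  also have "\<dots> = (\<Sum>i\<in>Basis. (u c \<bullet> i) * (\<Sum>j\<in>Basis. (v c \<bullet> j) * g p (?X i) (?X j)))"
    by (simp add: r[OF t])
  finally show ?thesis by (simp add: sum_distrib_left)
qed

lemma metric_coefficient_smooth:
  assumes M: "riemannian_manifold M g" and c: "c \<in> atlas M"
    and v: "v \<in> chart_model c" "w \<in> chart_model c"
  shows "smooth_on (chart_map c ` chart_dom c)
    (\<lambda>z. g (chart_inv c z) (tvec M (chart_inv c z) c v) (tvec M (chart_inv c z) c w))"
proof -
  have sm: "smooth_manifold M" using M by (simp add: riemannian_manifold_def)
  note C = manifold_chart[OF sm c]
  have "\<forall>U X Y. openin (mtop M) U \<and> smooth_vector_field M U X \<and> smooth_vector_field M U Y \<longrightarrow>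
      smooth_function M U (\<lambda>p. g p (X p) (Y p))"
    using M unfolding riemannian_manifold_def riemannian_metric_def by (elim conjE)
  from this[rule_format, OF conjI[OF chart_openin[OF C]
        conjI[OF smooth_vector_field_tvec[OF sm c v(1)] smooth_vector_field_tvec[OF sm c v(2)]]]]
  have "smooth_function M (chart_dom c) (\<lambda>q. g q (tvec M q c v) (tvec M q c w))" .
  then have "smooth_on (chart_map c ` (chart_dom c \<inter> chart_dom c))
    (\<lambda>z. g (chart_inv c z) (tvec M (chart_inv c z) c v) (tvec M (chart_inv c z) c w))"
    using c unfolding smooth_function_def by blast
  then show ?thesis by simp
qed

text \<open>The coefficients of the metric in a coordinate frame are smooth on the chart; composed
  with \<open>a\<close> they express the metric on fields along \<open>a\<close>.\<close>

lemma metric_along: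
  assumes M: "riemannian_manifold M g" and c: "c \<in> atlas M"
    and a: "smooth_on T (\<lambda>y. chart_map c (a y))" "a ` T \<subseteq> chart_dom c"
    and V: "smooth_along M c T a V" and W: "smooth_along M c T a W"
  shows "smooth_on T (\<lambda>y. g (a y) (V y) (W y))"
proof -
  have sm: "smooth_manifold M" using M by (simp add: riemannian_manifold_def)
  note C = manifold_chart[OF sm c]
  obtain \<pi> where \<pi>: "bounded_linear \<pi>" "\<And>v. \<pi> v \<in> chart_model c" "\<And>v. v \<in> chart_model c \<Longrightarrow> \<pi> v = v"
    and lin: "linear \<pi>"
    by (rule chart_projection[OF C]) (rule that)
  let ?G = "\<lambda>i j z. g (chart_inv c z) (tvec M (chart_inv c z) c (\<pi> i)) (tvec M (chart_inv c z) c (\<pi> j))"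
  have G: "smooth_on T (\<lambda>y. ?G i j (chart_map c (a y)))" for i j
    by (rule smooth_on_compose[OF metric_coefficient_smooth[OF M c \<pi>(2) \<pi>(2)] a(1)]) (use a in auto)
  have co: "smooth_on T (\<lambda>y. X y c \<bullet> e)" if "smooth_along M c T a X" for X e
    using that unfolding smooth_along_def by (intro smooth_on_inner smooth_on_const) auto
  have "smooth_on T (\<lambda>y. \<Sum>i\<in>Basis. \<Sum>j\<in>Basis. (V y c \<bullet> i) * ((W y c \<bullet> j) * ?G i j (chart_map c (a y))))"
    by (intro smooth_on_sum smooth_on_mult co V W G)
  then show ?thesis
  proof (rule smooth_on_cong)
    fix y assume y: "y \<in> T"
    have cy: "c \<in> charts_at M (a y)" using y a(2) c by (auto simp: charts_at_def)
    have inv: "chart_inv c (chart_map c (a y)) = a y" using C cy by (simp add: charts_at_def)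
    have t: "V y \<in> tangent_space M (a y)" "W y \<in> tangent_space M (a y)"
      using V W y by (auto simp: smooth_along_def)
    show "(\<Sum>i\<in>Basis. \<Sum>j\<in>Basis. (V y c \<bullet> i) * ((W y c \<bullet> j) * ?G i j (chart_map c (a y)))) = g (a y) (V y) (W y)"
      unfolding inv using metric_expand[OF M cy t lin \<pi>(2,3)] by simp
  qed
qed

lemma gs_proj_along:
  assumes M: "riemannian_manifold M g" and c: "c \<in> atlas M"
    and a: "smooth_on T (\<lambda>y. chart_map c (a y))" "a ` T \<subseteq> chart_dom c"
    and X: "list_all (smooth_along M c T a) X" "\<And>y. y \<in> T \<Longrightarrow> indep_list (map (\<lambda>f. f y) X)"
    and V: "smooth_along M c T a V"
  shows "smooth_along M c T a (\<lambda>y. gs_proj (g (a y)) (map (\<lambda>f. f y) X) (V y))"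
proof -
  have sm: "smooth_manifold M" using M by (simp add: riemannian_manifold_def)
  have pt: "a y \<in> points M" if "y \<in> T" for y
    using that a(2) openin_subset[OF chart_openin[OF manifold_chart[OF sm c]]] by blast
  show ?thesis
    by (rule gs_proj_closed[where m = "smooth_along M c T a" and s = "smooth_on T" and S = T
          and T = "\<lambda>y. tangent_space M (a y)", OF smooth_along_add[OF sm] smooth_along_scale[OF sm]
          smooth_along_zero[OF sm] smooth_on_const metric_along[OF M c a] smooth_on_divide
          riemannian_inner_on[OF M pt] _ X V])
      (auto simp: smooth_along_def)
qed

text \<open>In charts the differential is the derivative of the coordinate expression on vectors of
  the model space, so \<open>smooth_on_derivative\<close> applies with varying base point and
  vector.\<close>

lemma differential_along:
  assumes B: "smooth_manifold B" and M: "smooth_manifold M" and f: "smooth_map B M f"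
    and b: "b \<in> atlas B" and c: "c \<in> atlas M"
    and a: "smooth_on T (\<lambda>y. chart_map b (a y))" "a ` T \<subseteq> chart_dom b" "f ` a ` T \<subseteq> chart_dom c"
    and V: "smooth_along B b T a V"
  shows "smooth_along M c T (\<lambda>y. f (a y)) (\<lambda>y. differential B M f (a y) (V y))"
  unfolding smooth_along_def
proof (intro conjI ballI)
  have bcy: "b \<in> charts_at B (a y)" "c \<in> charts_at M (f (a y))" if "y \<in> T" for y
    using that a b c by (auto simp: charts_at_def)
  have pt: "a y \<in> points B" if "y \<in> T" for y using charts_at_points[OF B bcy(1)[OF that]] .
  have Vy: "V y \<in> tangent_space B (a y)" if "y \<in> T" for y using V that by (simp add: smooth_along_def)
  show "differential B M f (a y) (V y) \<in> tangent_space M (f (a y))" if "y \<in> T" for y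
    by (rule differential_tangent(1)[OF B M f Vy[OF that] pt[OF that]])
  have cf: "continuous_map (mtop B) (mtop M) f" using f by (simp add: smooth_map_def)
  have "smooth_on T (\<lambda>y. frechet_derivative (rep b c f) (at (chart_map b (a y)) within rep_dom b c f) (V y b))"
  proof (rule smooth_on_derivative[OF rep_dom_openin[OF B M cf b c] chart_subspace[OF manifold_chart[OF B b]]])
    show "smooth_on (rep_dom b c f) (rep b c f)" using f b c by (simp add: smooth_map_def)
    show "(\<lambda>y. chart_map b (a y)) ` T \<subseteq> rep_dom b c f" unfolding rep_dom_def using a(2,3) by blast
    show "(\<lambda>y. V y b) ` T \<subseteq> chart_model b" using tangent_coord(1)[OF Vy bcy(1)] by blast
  qed (use a V in \<open>auto simp: smooth_along_def\<close>)
  then show "smooth_on T (\<lambda>y. differential B M f (a y) (V y) c)"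
  proof (rule smooth_on_cong)
    fix y assume y: "y \<in> T"
    show "frechet_derivative (rep b c f) (at (chart_map b (a y)) within rep_dom b c f) (V y b) =
        differential B M f (a y) (V y) c"
      using differential_tangent(2)[OF B M f Vy[OF y] pt[OF y] bcy(1)[OF y] bcy(2)[OF y]]
      by (simp add: rep_deriv_def)
  qed
qed

text \<open>At \<open>p0\<close> the quadratic form of the metric has a positive minimum m0 on the
  unit sphere of the model space. Where the coefficients differ from those at \<open>p0\<close> by
  less than m0 / 2 in total, m0 / 2 is still a lower bound, and the sum of their absolute values at
  \<open>p0\<close> plus m0 / 2 is an upper bound.\<close>

lemma metric_comparable:
  assumes M: "riemannian_manifold M g" and c: "c \<in> charts_at M p0"
  obtains U m k where "openin (mtop M) U" "p0 \<in> U" "U \<subseteq> chart_dom c" "0 < m" "0 < k"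
    "\<And>q u. q \<in> U \<Longrightarrow> u \<in> tangent_space M q \<Longrightarrow> m * (norm (u c))\<^sup>2 \<le> g q u u"
    "\<And>q u. q \<in> U \<Longrightarrow> u \<in> tangent_space M q \<Longrightarrow> g q u u \<le> k * (norm (u c))\<^sup>2"
proof -
  have sm: "smooth_manifold M" using M by (simp add: riemannian_manifold_def)
  note C = charts_at_chart[OF sm c] and cc = charts_atD[OF c]
  let ?E = "chart_model c" and ?S = "chart_map c ` chart_dom c" and ?z0 = "chart_map c p0"
  obtain \<pi> where \<pi>: "bounded_linear \<pi>" "\<And>v. \<pi> v \<in> ?E" "\<And>v. v \<in> ?E \<Longrightarrow> \<pi> v = v"
    and lin: "linear \<pi>"
    by (rule chart_projection[OF C]) (rule that)
  define G where "G i j z = g (chart_inv c z) (tvec M (chart_inv c z) c (\<pi> i)) (tvec M (chart_inv c z) c (\<pi> j))"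
    for i j z
  have Gc: "continuous_on ?S (G i j)" for i j
    unfolding G_def using smooth_on_continuous[OF metric_coefficient_smooth[OF M _ \<pi>(2) \<pi>(2)]] cc by blast
  define H where "H z v = (\<Sum>i\<in>Basis. \<Sum>j\<in>Basis. (v \<bullet> i) * ((v \<bullet> j) * G i j z))" for z v
  have gH: "g q u u = H (chart_map c q) (u c)" if q: "q \<in> chart_dom c" and u: "u \<in> tangent_space M q" for q u
  proof -
    have "c \<in> charts_at M q" using q cc by (simp add: charts_at_def)
    from metric_expand[OF M this u u lin \<pi>(2,3)] show ?thesis
      unfolding H_def G_def using C q by simp
  qed
  define \<delta> where "\<delta> z = (\<Sum>i\<in>Basis. \<Sum>j\<in>Basis. \<bar>G i j z - G i j ?z0\<bar>)" for z
  have bil: "\<bar>\<Sum>i\<in>Basis. \<Sum>j\<in>Basis. (v \<bullet> i) * ((v \<bullet> j) * K i j)\<bar> \<le> (\<Sum>i\<in>Basis. \<Sum>j\<in>Basis. \<bar>K i j\<bar>) * (norm v)\<^sup>2"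
    for K and v :: 'b
  proof -
    have "\<bar>\<Sum>i\<in>Basis. \<Sum>j\<in>Basis. (v \<bullet> i) * ((v \<bullet> j) * K i j)\<bar>
      \<le> (\<Sum>i\<in>Basis. \<bar>\<Sum>j\<in>Basis. (v \<bullet> i) * ((v \<bullet> j) * K i j)\<bar>)" by (rule sum_abs)
    also have "\<dots> \<le> (\<Sum>i\<in>Basis. \<Sum>j\<in>Basis. \<bar>(v \<bullet> i) * ((v \<bullet> j) * K i j)\<bar>)"
      by (intro sum_mono sum_abs)
    also have "\<dots> \<le> (\<Sum>i\<in>Basis. \<Sum>j\<in>Basis. norm v * (norm v * \<bar>K i j\<bar>))"
      unfolding abs_mult
      by (intro sum_mono mult_mono) (auto simp: Basis_le_norm)
    finally show ?thesis by (simp add: sum_distrib_left sum_distrib_right power2_eq_square mult_ac)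
  qed
  have dH: "\<bar>H z v - H ?z0 v\<bar> \<le> \<delta> z * (norm v)\<^sup>2" for z v
  proof -
    have e: "H z v - H ?z0 v = (\<Sum>i\<in>Basis. \<Sum>j\<in>Basis. (v \<bullet> i) * ((v \<bullet> j) * (G i j z - G i j ?z0)))"
      unfolding H_def by (simp add: sum_subtractf[symmetric] right_diff_distrib)
    show ?thesis unfolding e \<delta>_def by (rule bil)
  qed
  obtain m0 where m0: "m0 > 0" "\<And>v. v \<in> ?E \<Longrightarrow> m0 * (norm v)\<^sup>2 \<le> H ?z0 v"
  proof -
    let ?K = "sphere 0 1 \<inter> ?E"
    have Hpos: "H ?z0 v > 0" if v: "v \<in> ?E" "v \<noteq> 0" for v
    proof -
      have t: "tvec M p0 c v \<in> tangent_space M p0" "tvec M p0 c v c = v"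
        using tvec_in_tangent_space[OF sm c v(1)] tvec_self[OF sm c v(1)] .
      then have "tvec M p0 c v \<noteq> 0" using v(2) by auto
      then have "g p0 (tvec M p0 c v) (tvec M p0 c v) > 0"
        using inner_on.pos[OF riemannian_inner_on[OF M charts_at_points[OF sm c]] t(1)] by blast
      then show ?thesis using gH[OF _ t(1)] cc t(2) by simp
    qed
    have hom: "H z (r *\<^sub>R v) = r\<^sup>2 * H z v" for z r v
      unfolding H_def by (simp add: sum_distrib_left power2_eq_square mult_ac)
    show thesis
    \<comment> \<open>An empty sphere means a zero model space, for which any positive constant
      works.\<close>
    proof (cases "?K = {}")
      case True
      have "v = 0" if "v \<in> ?E" for v
      proof (rule ccontr)
        assume "v \<noteq> 0"
        then have "(1 / norm v) *\<^sub>R v \<in> ?K" using subspace_scale[OF chart_subspace[OF C] that] by simp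
        then show False using True by blast
      qed
      then show thesis by (intro that[of 1]) (force simp: H_def)+
    next
      case False
      have "compact ?K" using closed_subspace[OF chart_subspace[OF C]] by (intro compact_Int_closed) auto
      moreover have "continuous_on ?K (H ?z0)" unfolding H_def by (intro continuous_intros)
      ultimately obtain w where w: "w \<in> ?K" "\<And>v. v \<in> ?K \<Longrightarrow> H ?z0 w \<le> H ?z0 v"
        using continuous_attains_inf[OF _ False] by metis
      have "H ?z0 w * (norm v)\<^sup>2 \<le> H ?z0 v" if v: "v \<in> ?E" for v
      proof (cases "v = 0")
        case True then show ?thesis by (simp add: H_def)
      next
        case False
        then have "(1 / norm v) *\<^sub>R v \<in> ?K" using subspace_scale[OF chart_subspace[OF C] v] by simp
        then have "H ?z0 w * (norm v)\<^sup>2 \<le> H ?z0 ((1 / norm v) *\<^sub>R v) * (norm v)\<^sup>2"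
          using w(2) by (intro mult_right_mono) auto
        also have "\<dots> = H ?z0 v" unfolding hom using False by (simp add: field_simps)
        finally show ?thesis .
      qed
      moreover have "H ?z0 w > 0"
      proof (rule Hpos)
        show "w \<in> ?E" "w \<noteq> 0" using w(1) by auto
      qed
      ultimately show thesis using that by blast
    qed
  qed
  have "continuous_on ?S \<delta>" unfolding \<delta>_def by (intro continuous_intros Gc)
  then obtain W where W: "open W" "W \<inter> ?S = \<delta> -` {..<m0 / 2} \<inter> ?S"
    unfolding continuous_on_open_invariant using open_lessThan by blast
  define U where "U = {q \<in> chart_dom c. chart_map c q \<in> W}"
  have Udelta: "\<delta> (chart_map c q) < m0 / 2" if "q \<in> U" for q
  proof -
    have "chart_map c q \<in> W \<inter> ?S" using that by (auto simp: U_def)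
    then show ?thesis unfolding W(2) by simp
  qed
  have "\<delta> ?z0 = 0" by (simp add: \<delta>_def)
  then have "?z0 \<in> W \<inter> ?S" unfolding W(2) using m0(1) cc by simp
  then have p0U: "p0 \<in> U" using cc by (simp add: U_def)
  let ?k0 = "\<Sum>i\<in>Basis. \<Sum>j\<in>Basis. \<bar>G i j ?z0\<bar>"
  have k0: "?k0 \<ge> 0" by (intro sum_nonneg) auto
  have main: "m0 / 2 * (norm (u c))\<^sup>2 \<le> g q u u \<and> g q u u \<le> (?k0 + m0 / 2) * (norm (u c))\<^sup>2"
    if q: "q \<in> U" and u: "u \<in> tangent_space M q" for q u
  proof -
    have qd: "q \<in> chart_dom c" using q by (simp add: U_def)
    have "c \<in> charts_at M q" using qd cc by (simp add: charts_at_def)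
    then have uE: "u c \<in> ?E" using tangent_coord(1)[OF u] by blast
    have "\<bar>H (chart_map c q) (u c) - H ?z0 (u c)\<bar> \<le> \<delta> (chart_map c q) * (norm (u c))\<^sup>2" by (rule dH)
    also have "\<dots> \<le> m0 / 2 * (norm (u c))\<^sup>2" using Udelta[OF q] by (intro mult_right_mono) auto
    finally have 1: "\<bar>H (chart_map c q) (u c) - H ?z0 (u c)\<bar> \<le> m0 / 2 * (norm (u c))\<^sup>2" .
    have 2: "H ?z0 (u c) \<le> ?k0 * (norm (u c))\<^sup>2"
      using bil[of "u c" "\<lambda>i j. G i j ?z0"] unfolding H_def by linarith
    have 3: "m0 * (norm (u c))\<^sup>2 = m0 / 2 * (norm (u c))\<^sup>2 + m0 / 2 * (norm (u c))\<^sup>2" by simp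
    have 4: "(?k0 + m0 / 2) * (norm (u c))\<^sup>2 = ?k0 * (norm (u c))\<^sup>2 + m0 / 2 * (norm (u c))\<^sup>2"
      by (rule distrib_right)
    show ?thesis unfolding gH[OF qd u] 4 using 1 2 3 m0(2)[OF uE] by linarith
  qed
  show thesis
  proof (rule that[of U "m0 / 2" "?k0 + m0 / 2"])
    show "openin (mtop M) U" unfolding U_def by (rule chart_preimage[OF C W(1)])
  qed (use p0U m0(1) k0 main in \<open>auto simp: U_def\<close>)
qed

section \<open>Submanifolds from slice charts\<close>

text \<open>A chart \<open>b\<close> of \<open>S\<close> is tied to an ambient chart
  \<open>c\<close> in coordinates: \<open>b\<close> is a linear image of \<open>c\<close>, and
  \<open>s\<close> recovers the ambient coordinates smoothly. Regularity questions on
  \<open>S\<close> thereby reduce to \<open>M\<close>, by inserting \<open>s\<close> before and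
  \<open>\<pi>\<close> after a map.\<close>

definition slice :: "('a, 'e::euclidean_space) manifold \<Rightarrow> 'a set \<Rightarrow> ('a, 'e) chart \<Rightarrow> ('a, 'e) chart \<Rightarrow>
    ('e \<Rightarrow> 'e) \<Rightarrow> ('e \<Rightarrow> 'e) \<Rightarrow> bool"
  where "slice M S b c \<pi> s \<longleftrightarrow>
    c \<in> atlas M \<and> chart_dom b \<subseteq> chart_dom c \<and> chart_dom b \<subseteq> S \<and>
    openin (subtopology (mtop M) S) (chart_dom b) \<and> subspace (chart_model b) \<and>
    openin (top_of_set (chart_model b)) (chart_map b ` chart_dom b) \<and>
    bounded_linear \<pi> \<and> (\<forall>q\<in>chart_dom b. chart_map b q = \<pi> (chart_map c q)) \<and>
    smooth_on (chart_map b ` chart_dom b) s \<and> (\<forall>q\<in>chart_dom b. s (chart_map b q) = chart_map c q)"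

definition slice_manifold :: "('a, 'e::euclidean_space) manifold \<Rightarrow> 'a set \<Rightarrow> ('a, 'e) manifold"
  where "slice_manifold M S =
    \<lparr>mtop = subtopology (mtop M) S, atlas = {b. \<exists>c \<pi> s. slice M S b c \<pi> s}\<rparr>"

lemma sliceD:
  assumes "slice M S b c \<pi> s"
  shows "c \<in> atlas M" "chart_dom b \<subseteq> chart_dom c" "chart_dom b \<subseteq> S"
    "openin (subtopology (mtop M) S) (chart_dom b)" "subspace (chart_model b)"
    "openin (top_of_set (chart_model b)) (chart_map b ` chart_dom b)" "bounded_linear \<pi>"
    "\<And>q. q \<in> chart_dom b \<Longrightarrow> chart_map b q = \<pi> (chart_map c q)"
    "smooth_on (chart_map b ` chart_dom b) s"
    "\<And>q. q \<in> chart_dom b \<Longrightarrow> s (chart_map b q) = chart_map c q"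
  using assms unfolding slice_def by blast+

text \<open>The inverse of the chart is \<open>s\<close> followed by the inverse of
  \<open>c\<close>; both directions are continuous because \<open>\<pi>\<close> and \<open>s\<close>
  are.\<close>

lemma slice_is_chart:
  assumes M: "smooth_manifold M" and sl: "slice M S b c \<pi> s"
  shows "is_chart (subtopology (mtop M) S) b"
proof -
  note s = sliceD[OF sl] and C = manifold_chart[OF M sliceD(1)[OF sl]]
  let ?Y = "top_of_set (chart_map b ` chart_dom b)"
  have X: "subtopology (subtopology (mtop M) S) (chart_dom b) = subtopology (mtop M) (chart_dom b)"
    using s(3) by (simp add: subtopology_subtopology inf.absorb2)
  have sub: "chart_dom b \<subseteq> points M"
    using s(2) openin_subset[OF chart_openin[OF C]] by blast
  have inv: "chart_inv c (s (chart_map b q)) = q" if "q \<in> chart_dom b" for q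
    using s(10)[OF that] chart_inv_map[OF C] s(2) that by auto
  have "homeomorphic_maps (subtopology (mtop M) (chart_dom b)) ?Y (chart_map b) (\<lambda>y. chart_inv c (s y))"
    unfolding homeomorphic_maps_def
  proof (intro conjI ballI)
    have "continuous_map (subtopology (mtop M) (chart_dom b)) euclidean (chart_map c)"
      using continuous_map_from_subtopology_mono[OF chart_cont[OF C] s(2)] .
    moreover have "continuous_map euclidean euclidean \<pi>"
      using s(7) by (simp add: linear_continuous_on)
    ultimately have "continuous_map (subtopology (mtop M) (chart_dom b)) euclidean (\<pi> \<circ> chart_map c)"
      by (rule continuous_map_compose)
    then have "continuous_map (subtopology (mtop M) (chart_dom b)) euclidean (chart_map b)"
      by (rule continuous_map_eq) (use s(8) in auto)
    then show "continuous_map (subtopology (mtop M) (chart_dom b)) ?Y (chart_map b)"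
      by (simp add: continuous_map_in_subtopology image_subset_iff_funcset[symmetric] image_mono)
    have "continuous_map ?Y (top_of_set (chart_map c ` chart_dom c)) s"
      using smooth_on_continuous[OF s(9)] s(2,10) by (auto simp: continuous_map_in_subtopology)
    then have "continuous_map ?Y (mtop M) (chart_inv c \<circ> s)"
      using continuous_map_compose chart_inv_cont[OF C] by blast
    then show "continuous_map ?Y (subtopology (mtop M) (chart_dom b)) (\<lambda>y. chart_inv c (s y))"
      using inv by (auto simp: continuous_map_in_subtopology o_def)
    show "chart_inv c (s (chart_map b q)) = q" if "q \<in> topspace (subtopology (mtop M) (chart_dom b))" for q
      using inv that by simp
    show "chart_map b (chart_inv c (s y)) = y" if "y \<in> topspace ?Y" for y
      using inv that by auto
  qed
  then show ?thesis
    unfolding is_chart_def X using s(4,5,6) homeomorphic_map_maps by blast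
qed

lemma slice_manifold_simps:
  "mtop (slice_manifold M S) = subtopology (mtop M) S"
  "b \<in> atlas (slice_manifold M S) \<longleftrightarrow> (\<exists>c \<pi> s. slice M S b c \<pi> s)"
  by (simp_all add: slice_manifold_def)

lemma slice_rep_smooth:
  assumes M: "smooth_manifold M" and sl: "slice M S b c \<pi> s" and d: "d \<in> atlas M"
  shows "smooth_on (rep_dom b d id) (rep b d id)"
proof -
  note s = sliceD[OF sl] and b = slice_is_chart[OF M sl]
  have "smooth_on (rep_dom b d id) (\<lambda>z. rep c d id (s z))"
  proof (rule smooth_on_compose[of "rep_dom c d id" "rep c d id" _ s])
    show "smooth_on (rep_dom c d id) (rep c d id)" using M s(1) d by (simp add: smooth_manifold_def)
    show "smooth_on (rep_dom b d id) s" by (rule smooth_on_subset[OF s(9)]) (auto simp: rep_dom_def)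
    show "s ` rep_dom b d id \<subseteq> rep_dom c d id"
      using s(2,10) by (fastforce simp: rep_dom_def)
  qed
  then show ?thesis
  proof (rule smooth_on_cong)
    fix z assume "z \<in> rep_dom b d id"
    then obtain q where q: "q \<in> chart_dom b" "z = chart_map b q" by (auto simp: rep_dom_def)
    then have "q \<in> chart_dom c" using s(2) by blast
    then show "rep c d id (s z) = rep b d id z"
      using q s(10) by (simp add: rep_chart_map[OF b] rep_chart_map[OF manifold_chart[OF M s(1)]])
  qed
qed

text \<open>The topological axioms pass to subspaces. The change from \<open>b\<close> to another
  slice chart is the inclusion in the charts \<open>b\<close> and \<open>c'\<close>, followed by the
  linear map \<open>\<pi>'\<close>.\<close>

lemma smooth_manifold_slice_manifold:
  assumes M: "smooth_manifold M" and S: "S \<subseteq> points M"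
    and cover: "\<And>p. p \<in> S \<Longrightarrow> \<exists>b c \<pi> s. slice M S b c \<pi> s \<and> p \<in> chart_dom b"
  shows "smooth_manifold (slice_manifold M S)" "smooth_map (slice_manifold M S) M id"
proof -
  let ?B = "slice_manifold M S"
  show "smooth_manifold ?B"
    unfolding smooth_manifold_def
  proof (intro conjI ballI)
    show "Hausdorff_space (mtop ?B)"
      using M by (simp add: smooth_manifold_def slice_manifold_simps Hausdorff_space_subtopology)
    show "second_countable (mtop ?B)"
      using M by (simp add: smooth_manifold_def slice_manifold_simps second_countable_subtopology)
    show "is_chart (mtop ?B) b" if "b \<in> atlas ?B" for b
      using that slice_is_chart[OF M] by (auto simp: slice_manifold_simps)
    have "(\<Union>b\<in>atlas ?B. chart_dom b) = S"
    proof
      show "(\<Union>b\<in>atlas ?B. chart_dom b) \<subseteq> S"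
        by (auto simp: slice_manifold_simps dest: subsetD[OF sliceD(3)])
      show "S \<subseteq> (\<Union>b\<in>atlas ?B. chart_dom b)"
        using cover unfolding slice_manifold_simps(2)[abs_def] slice_manifold_def by fastforce
    qed
    then show "(\<Union>b\<in>atlas ?B. chart_dom b) = points ?B"
      using S by (simp add: slice_manifold_simps inf.absorb2)
    fix b b' assume bb: "b \<in> atlas ?B" "b' \<in> atlas ?B"
    obtain c \<pi> s where sl: "slice M S b c \<pi> s" using bb by (auto simp: slice_manifold_simps)
    obtain c' \<pi>' s' where sl': "slice M S b' c' \<pi>' s'" using bb by (auto simp: slice_manifold_simps)
    note s' = sliceD[OF sl']
    have sub: "rep_dom b b' id \<subseteq> rep_dom b c' id" using s'(2) by (auto simp: rep_dom_def)
    have "smooth_on (rep_dom b b' id) (\<lambda>z. \<pi>' (rep b c' id z))"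
      by (rule smooth_on_compose_linear[OF s'(7) smooth_on_subset[OF slice_rep_smooth[OF M sl s'(1)] sub]])
    then show "smooth_on (rep_dom b b' id) (rep b b' id)"
    proof (rule smooth_on_cong)
      fix z assume "z \<in> rep_dom b b' id"
      then obtain q where q: "q \<in> chart_dom b" "q \<in> chart_dom b'" "z = chart_map b q" by (auto simp: rep_dom_def)
      then show "\<pi>' (rep b c' id z) = rep b b' id z"
        using s'(8) by (simp add: rep_chart_map[OF slice_is_chart[OF M sl]])
    qed
  qed
  show "smooth_map ?B M id"
    unfolding smooth_map_def
  proof (intro conjI ballI)
    show "continuous_map (mtop ?B) (mtop M) id"
      by (simp add: slice_manifold_simps continuous_map_from_subtopology)
    show "smooth_on (rep_dom b c id) (rep b c id)" if "b \<in> atlas ?B" "c \<in> atlas M" for b c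
      using that slice_rep_smooth[OF M] by (auto simp: slice_manifold_simps)
  qed
qed

text \<open>Differentiate the identity saying that \<open>\<pi>\<close> undoes the inclusion in the
  charts \<open>b\<close> and \<open>c\<close>. It recovers a tangent vector of the slice linearly
  from its image, whence injectivity of the differential of the inclusion.\<close>

lemma slice_tangent:
  assumes M: "smooth_manifold M" and B: "smooth_manifold (slice_manifold M S)"
    and inc: "smooth_map (slice_manifold M S) M id"
    and sl: "slice M S b c \<pi> s" and p: "p \<in> chart_dom b"
    and u: "u \<in> tangent_space (slice_manifold M S) p"
  shows "u b = \<pi> (differential (slice_manifold M S) M id p u c)"
proof -
  let ?B = "slice_manifold M S"
  note s = sliceD[OF sl] and bc = slice_is_chart[OF M sl]
  have b: "b \<in> charts_at ?B p" using sl p by (auto simp: charts_at_def slice_manifold_simps)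
  have c: "c \<in> charts_at M (id p)" using s(1,2) p by (auto simp: charts_at_def)
  have e: "differential ?B M id p u c = rep_deriv b c id p (u b)"
    by (rule differential_tangent(2)[OF B M inc u charts_at_points[OF B b] b c])
  have R: "openin (top_of_set (chart_model b)) (rep_dom b c id)"
    by (rule rep_dom_openin[OF B M]) (use inc charts_atD[OF b] s(1) in \<open>auto simp: smooth_map_def\<close>)
  note hd = rep_has_derivative[OF inc b c]
  have 1: "((\<lambda>y. \<pi> (rep b c id y)) has_derivative (\<lambda>v. \<pi> (rep_deriv b c id p v)))
      (at (chart_map b p) within rep_dom b c id)"
    by (rule bounded_linear.has_derivative[OF s(7) hd(1)])
  have 2: "((\<lambda>y. y) has_derivative (\<lambda>v. v)) (at (chart_map b p) within rep_dom b c id)"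
    by (rule has_derivative_ident)
  have "\<pi> (rep_deriv b c id p (u b)) = u b"
  proof (rule has_derivative_within_unique[OF R R s(5) hd(2) hd(2) tangent_coord(1)[OF u b] 1 2])
    fix y assume "y \<in> rep_dom b c id \<inter> rep_dom b c id"
    then obtain q where q: "q \<in> chart_dom b" "y = chart_map b q" by (auto simp: rep_dom_def)
    show "\<pi> (rep b c id y) = y"
      unfolding q(2) rep_chart_map[OF bc q(1)] using s(8)[OF q(1)] by simp
  qed
  then show ?thesis using e by simp
qed

lemma embedded_slice_manifold:
  assumes M: "smooth_manifold M" and S: "S \<subseteq> points M"
    and cover: "\<And>p. p \<in> S \<Longrightarrow> \<exists>b c \<pi> s. slice M S b c \<pi> s \<and> p \<in> chart_dom b"
  shows "embedded_submanifold M S (slice_manifold M S)"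
  unfolding embedded_submanifold_def
proof (intro conjI ballI)
  let ?B = "slice_manifold M S"
  note B = smooth_manifold_slice_manifold[OF M S cover]
  show "S \<subseteq> points M" "smooth_manifold ?B" "smooth_map ?B M id" "mtop ?B = subtopology (mtop M) S"
    using S B by (simp_all add: slice_manifold_simps)
  fix p assume "p \<in> S"
  then obtain b c \<pi> s where sl: "slice M S b c \<pi> s" "p \<in> chart_dom b" using cover by blast
  have b: "b \<in> charts_at ?B p" using sl by (auto simp: charts_at_def slice_manifold_simps)
  show "inj_on (differential ?B M id p) (tangent_space ?B p)"
  proof (rule inj_onI)
    fix u v assume uv: "u \<in> tangent_space ?B p" "v \<in> tangent_space ?B p"
      and e: "differential ?B M id p u = differential ?B M id p v"
    show "u = v"
      by (rule tangent_eqI[OF uv b])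
        (simp only: slice_tangent[OF M B sl uv(1)] slice_tangent[OF M B sl uv(2)] e)
  qed
qed

section \<open>Vertical spaces\<close>

lemma vertical_iff:
  assumes M: "smooth_manifold M" and N: "smooth_manifold N" and F: "smooth_map M N F"
    and c: "c \<in> charts_at M p" and d: "d \<in> charts_at N (F p)" and v: "v \<in> tangent_space M p"
  shows "v \<in> vertical_space M N F p \<longleftrightarrow> rep_deriv c d F p (v c) = 0"
proof -
  note dv = differential_tangent[OF M N F v charts_at_points[OF M c]]
  have "differential M N F p v = 0 \<longleftrightarrow> differential M N F p v d = 0"
    using tangent_eqI[OF dv(1) subspace_0[OF subspace_tangent_space[OF N]] d] by auto
  then show ?thesis using v dv(2)[OF c d] by (simp add: vertical_space_def)
qed

lemma subspace_vertical:
  assumes M: "smooth_manifold M" and N: "smooth_manifold N" and F: "smooth_map M N F"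
    and p: "p \<in> points M"
  shows "subspace (vertical_space M N F p)"
  using subspace_tangent_space[OF M, of p] differential_linear_on[OF M N F p]
    linear_on_sum[OF subspace_tangent_space[OF M] differential_linear_on[OF M N F p]
      subspace_0[OF subspace_tangent_space[OF M]], of _ "{}"]
  by (simp add: vertical_space_def subspace_def linear_on_def)

lemma vertical_subset: "vertical_space M N F p \<subseteq> tangent_space M p"
  by (auto simp: vertical_space_def)

lemma vertical_coords:
  assumes M: "smooth_manifold M" and N: "smooth_manifold N" and F: "smooth_map M N F"
    and c: "c \<in> charts_at M p" and d: "d \<in> charts_at N (F p)"
  shows "(\<lambda>v. v c) ` vertical_space M N F p = {w \<in> chart_model c. rep_deriv c d F p w = 0}"
proof
  show "(\<lambda>v. v c) ` vertical_space M N F p \<subseteq> {w \<in> chart_model c. rep_deriv c d F p w = 0}"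
  proof (rule image_subsetI)
    fix v assume v: "v \<in> vertical_space M N F p"
    then have vT: "v \<in> tangent_space M p" by (rule subsetD[OF vertical_subset])
    show "v c \<in> {w \<in> chart_model c. rep_deriv c d F p w = 0}"
      using v vertical_iff[OF M N F c d vT] tangent_coord(1)[OF vT c] by simp
  qed
  show "{w \<in> chart_model c. rep_deriv c d F p w = 0} \<subseteq> (\<lambda>v. v c) ` vertical_space M N F p"
  proof
    fix w assume w: "w \<in> {w \<in> chart_model c. rep_deriv c d F p w = 0}"
    then have wm: "w \<in> chart_model c" by simp
    have "tvec M p c w \<in> vertical_space M N F p"
      using vertical_iff[OF M N F c d tvec_in_tangent_space[OF M c wm]] w tvec_self[OF M c wm] by simp
    then show "w \<in> (\<lambda>v. v c) ` vertical_space M N F p"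
      by (rule image_eqI[rotated]) (simp add: tvec_self[OF M c wm])
  qed
qed

lemma linear_coord: "linear (\<lambda>v. v c)"
  by (rule linearI) (simp_all add: scaleR_fun_apply)

lemma inj_on_coord: "c \<in> charts_at M p \<Longrightarrow> inj_on (\<lambda>v. v c) (tangent_space M p)"
  by (rule inj_onI) (rule tangent_eqI)

text \<open>The type of tangent vectors is an infinite-dimensional function space in general. Finite
  bases and dimensions of its subspaces are taken from Euclidean space through an injective linear
  map, here a coordinate in one chart.\<close>

lemma subspace_basis_inj:
  fixes f :: "'v::real_vector \<Rightarrow> 'w::euclidean_space"
  assumes f: "linear f" "inj_on f A" and A: "subspace A"
  obtains xs where "distinct xs" "set xs \<subseteq> A" "span (set xs) = A" "dim A = dim (f ` A)"
proof -
  obtain X where X: "X \<subseteq> A" "independent X" "A \<subseteq> span X" "card X = dim A" using basis_exists by blast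
  have sp: "span X = A" using X(1,3) A by (simp add: span_minimal subset_antisym)
  have ind: "independent (f ` X)"
    by (rule linear_independent_injective_image[OF f(1) X(2)]) (simp add: sp f(2))
  have fin: "finite X"
    using independent_imp_finite[OF ind] inj_on_subset[OF f(2) X(1)] finite_imageD by blast
  have "span (f ` X) = f ` A" using linear_span_image[OF f(1)] sp by metis
  then have "dim (f ` A) = card (f ` X)"
    using dim_unique[OF image_mono[OF X(1)] _ ind refl] by simp
  also have "\<dots> = card X" using inj_on_subset[OF f(2) X(1)] by (rule card_image)
  finally have "dim A = dim (f ` A)" using X(4) by simp
  moreover obtain xs where "set xs = X" "distinct xs" using finite_distinct_list[OF fin] by blast
  ultimately show thesis using that[of xs] X(1) sp by simp
qed

lemma tangent_subspace_basis:
  assumes c: "c \<in> charts_at M p" and A: "subspace A" "A \<subseteq> tangent_space M p"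
  obtains xs where "distinct xs" "set xs \<subseteq> A" "span (set xs) = A" "dim A = dim ((\<lambda>v. v c) ` A)"
  by (rule subspace_basis_inj[OF linear_coord inj_on_subset[OF inj_on_coord[OF c] A(2)] A(1)])
    (rule that)

lemma independent_linear_preimage:
  assumes f: "linear f" "inj_on f X" and ind: "independent (f ` X)"
  shows "independent X"
  unfolding dependent_def
proof
  assume "\<exists>x\<in>X. x \<in> span (X - {x})"
  then obtain x where x: "x \<in> X" "x \<in> span (X - {x})" by blast
  have "f x \<in> span (f ` (X - {x}))" using linear_span_image[OF f(1), of "X - {x}"] x(2) by blast
  moreover have "f ` (X - {x}) = f ` X - {f x}" using f(2) x(1) by (auto dest: inj_onD)
  ultimately show False using ind x(1) unfolding dependent_def by auto
qed

section \<open>Pointwise linear algebra of semi-slant maps\<close>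

lemma component_eqI:
  "a \<in> A \<Longrightarrow> v - a \<in> B \<Longrightarrow> (\<And>a'. a' \<in> A \<Longrightarrow> v - a' \<in> B \<Longrightarrow> a' = a) \<Longrightarrow> component A B v = a"
  unfolding component_def by (rule the_equality) blast+

text \<open>The linear algebra in a single tangent space \<open>T\<close>, with \<open>V\<close> the
  kernel, \<open>P\<close> the projection of \<open>V\<close> onto \<open>D1\<close> and
  \<open>k\<close> the orthogonal projection onto \<open>V\<close>. The projections are given by
  their characterizing properties, so that Gram-Schmidt formulas for any frames can be
  substituted.\<close>

locale semi_slant_point = inner_on T g
  for T :: "'v::real_vector set" and g +
  fixes J :: "'v \<Rightarrow> 'v" and V D1 D2 :: "'v set" and P k :: "'v \<Rightarrow> 'v" and \<theta> :: real
  assumes J_in: "v \<in> T \<Longrightarrow> J v \<in> T" and J_lin: "linear_on T J"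
    and J_sq: "v \<in> T \<Longrightarrow> J (J v) = - v"
    and J_iso: "u \<in> T \<Longrightarrow> v \<in> T \<Longrightarrow> g (J u) (J v) = g u v"
    and V: "subspace V" "V \<subseteq> T"
    and D1: "subspace D1" "D1 \<subseteq> V" and D2_def: "D2 = orth_compl g V D1"
    and J_D1: "J ` D1 = D1"
    and P: "v \<in> V \<Longrightarrow> P v \<in> D1" "v \<in> V \<Longrightarrow> v - P v \<in> D2"
    and k: "v \<in> T \<Longrightarrow> k v \<in> V" "v \<in> T \<Longrightarrow> w \<in> V \<Longrightarrow> g (v - k v) w = 0"
    and angle: "v \<in> D2 \<Longrightarrow> v \<noteq> 0 \<Longrightarrow>
      (let w = component D2 (orth_compl g T D2) (J v)
       in arccos (sqrt (g w w) / sqrt (g (J v) (J v)))) = \<theta>"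
    and theta: "0 \<le> \<theta>" "\<theta> < pi / 2"
begin

definition phi where "phi v = k (J v)"
definition Jh where "Jh v = J (P v) + (1 / cos \<theta>) *\<^sub>R phi (v - P v)"

lemma VT: "v \<in> V \<Longrightarrow> v \<in> T" using V by blast
lemma D1V: "v \<in> D1 \<Longrightarrow> v \<in> V" using D1 by blast
lemma D2V: "v \<in> D2 \<Longrightarrow> v \<in> V" and D2D1: "v \<in> D2 \<Longrightarrow> d \<in> D1 \<Longrightarrow> g v d = 0"
  by (auto simp: D2_def orth_compl_def)

lemma J_add: "u \<in> T \<Longrightarrow> v \<in> T \<Longrightarrow> J (u + v) = J u + J v"
  and J_scale: "v \<in> T \<Longrightarrow> J (a *\<^sub>R v) = a *\<^sub>R J v"
  using J_lin by (auto simp: linear_on_def)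

lemma D2: "subspace D2"
proof (rule subspaceI)
  show "0 \<in> D2" using zero_l VT D1V subspace_0[OF V(1)] by (auto simp: D2_def orth_compl_def)
  show "u + v \<in> D2" if "u \<in> D2" "v \<in> D2" for u v
    using that subspace_add[OF V(1)] add_l VT D1V by (auto simp: D2_def orth_compl_def)
  show "a *\<^sub>R v \<in> D2" if "v \<in> D2" for v a
    using that subspace_scale[OF V(1)] scale_l VT D1V by (auto simp: D2_def orth_compl_def)
qed

text \<open>Apply the isometry property to \<open>J u\<close> and \<open>v\<close>, and use that
  \<open>J\<close> squares to minus the identity.\<close>

lemma J_skew: "u \<in> T \<Longrightarrow> v \<in> T \<Longrightarrow> g (J u) v = - g u (J v)"
  using J_iso[of "J u" v] J_in J_sq[of u] scale_l[of "J v" u "-1"] by simp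

lemma P_eqI: "v \<in> V \<Longrightarrow> d \<in> D1 \<Longrightarrow> v - d \<in> D2 \<Longrightarrow> P v = d"
  by (rule orth_unique[of D1 "P v" d v]) (use P D2D1 D1 V VT in auto)

lemma P_component: "v \<in> V \<Longrightarrow> component D1 D2 v = P v"
  by (rule component_eqI) (use P P_eqI in auto)

lemma Q_component:
  assumes v: "v \<in> V" shows "component D2 D1 v = v - P v"
proof (rule component_eqI)
  fix a assume "a \<in> D2" "v - a \<in> D1"
  then have "P v = v - a" using P_eqI[OF v] by simp
  then show "a = v - P v" by simp
qed (use P[OF v] in auto)

lemma k_eqI: "v \<in> T \<Longrightarrow> a \<in> V \<Longrightarrow> (\<And>w. w \<in> V \<Longrightarrow> g (v - a) w = 0) \<Longrightarrow> k v = a"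
  by (rule orth_unique[of V "k v" a v]) (use V k in auto)

lemma k_component: "v \<in> T \<Longrightarrow> component V (orth_compl g T V) v = k v"
proof (rule component_eqI)
  assume v: "v \<in> T"
  show "k v \<in> V" using k(1)[OF v] .
  show "v - k v \<in> orth_compl g T V"
    using k v VT subspace_diff[OF T] by (auto simp: orth_compl_def)
  show "a = k v" if "a \<in> V" "v - a \<in> orth_compl g T V" for a
    using k_eqI[OF v that(1)] that(2) by (auto simp: orth_compl_def)
qed

lemma P_add: assumes "u \<in> V" "v \<in> V" shows "P (u + v) = P u + P v"
proof (rule P_eqI)
  show "u + v \<in> V" "P u + P v \<in> D1"
    using assms P subspace_add[OF V(1)] subspace_add[OF D1(1)] by auto
  have "(u - P u) + (v - P v) \<in> D2" using assms P subspace_add[OF D2] by blast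
  then show "u + v - (P u + P v) \<in> D2" by (simp add: algebra_simps)
qed

lemma P_scale: assumes "v \<in> V" shows "P (a *\<^sub>R v) = a *\<^sub>R P v"
proof (rule P_eqI)
  show "a *\<^sub>R v \<in> V" "a *\<^sub>R P v \<in> D1"
    using assms P subspace_scale[OF V(1)] subspace_scale[OF D1(1)] by auto
  have "a *\<^sub>R (v - P v) \<in> D2" using assms P subspace_scale[OF D2] by blast
  then show "a *\<^sub>R v - a *\<^sub>R P v \<in> D2" by (simp add: algebra_simps)
qed

lemma phi_V: "v \<in> T \<Longrightarrow> phi v \<in> V"
  unfolding phi_def using k(1) J_in by blast

lemma phi_inner: "v \<in> T \<Longrightarrow> w \<in> V \<Longrightarrow> g (phi v) w = g (J v) w"
  using k(2)[of "J v" w] diff_l[of w "J v" "phi v"] phi_V VT J_in unfolding phi_def by simp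

lemma phi_add: assumes "u \<in> T" "v \<in> T" shows "phi (u + v) = phi u + phi v"
  unfolding phi_def
proof (rule k_eqI)
  show "J (u + v) \<in> T" "k (J u) + k (J v) \<in> V"
    using assms J_in k(1) subspace_add[OF T] subspace_add[OF V(1)] by auto
  have 1: "J u - k (J u) \<in> T" "J v - k (J v) \<in> T"
    using assms J_in k(1) VT subspace_diff[OF T] by auto
  have e: "J (u + v) - (k (J u) + k (J v)) = (J u - k (J u)) + (J v - k (J v))"
    using assms J_add by simp
  show "g (J (u + v) - (k (J u) + k (J v))) w = 0" if "w \<in> V" for w
    unfolding e using add_l[OF VT[OF that] 1] k(2)[OF J_in that] assms by simp
qed

lemma phi_scale: assumes "v \<in> T" shows "phi (a *\<^sub>R v) = a *\<^sub>R phi v"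
  unfolding phi_def
proof (rule k_eqI)
  show "J (a *\<^sub>R v) \<in> T" "a *\<^sub>R k (J v) \<in> V"
    using assms J_in k(1) subspace_scale[OF T] subspace_scale[OF V(1)] by auto
  have 1: "J v - k (J v) \<in> T"
    using assms J_in k(1) VT subspace_diff[OF T] by auto
  have e: "J (a *\<^sub>R v) - a *\<^sub>R k (J v) = a *\<^sub>R (J v - k (J v))"
    using assms J_scale by (simp add: algebra_simps)
  show "g (J (a *\<^sub>R v) - a *\<^sub>R k (J v)) w = 0" if "w \<in> V" for w
    unfolding e using scale_l[OF VT[OF that] 1] k(2)[OF J_in that] assms by simp
qed

text \<open>For d in \<open>D1\<close>, skew-symmetry moves \<open>J\<close> from \<open>v\<close>
  to d, and \<open>J d\<close> stays in \<open>D1\<close>, which is orthogonal to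
  \<open>v\<close>.\<close>

lemma phi_D2: assumes v: "v \<in> D2" shows "phi v \<in> D2"
proof -
  have vT: "v \<in> T" using v D2V VT by blast
  have "g (phi v) d = 0" if d: "d \<in> D1" for d
  proof -
    have "J d \<in> D1" using J_D1 d by blast
    then show ?thesis
      using phi_inner[OF vT D1V[OF d]] J_skew[OF vT VT[OF D1V[OF d]]] D2D1[OF v] by simp
  qed
  then show ?thesis using phi_V[OF vT] by (simp add: D2_def orth_compl_def)
qed

text \<open>The slant angle is measured against \<open>D2\<close>, whereas \<phi> projects onto all
  of \<open>V\<close>. The two projections of \<open>J v\<close> agree because the one onto
  \<open>V\<close> already lies in \<open>D2\<close>.\<close>

lemma phi_component: assumes v: "v \<in> D2" shows "component D2 (orth_compl g T D2) (J v) = phi v"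
proof (rule component_eqI)
  have vT: "v \<in> T" using v D2V VT by blast
  show "phi v \<in> D2" by (rule phi_D2[OF v])
  have orth: "g (J v - phi v) w = 0" if "w \<in> D2" for w
    using k(2)[OF J_in[OF vT] D2V[OF that]] by (simp add: phi_def)
  then show "J v - phi v \<in> orth_compl g T D2"
    using J_in[OF vT] VT[OF phi_V[OF vT]] subspace_diff[OF T] by (simp add: orth_compl_def)
  show "a = phi v" if "a \<in> D2" "J v - a \<in> orth_compl g T D2" for a
    by (rule orth_unique[of D2 _ _ "J v"])
      (use that orth D2 D2V VT J_in[OF vT] phi_D2[OF v] in \<open>auto simp: orth_compl_def\<close>)
qed

lemma cos_pos: "cos \<theta> > 0"
  using theta by (intro cos_gt_zero_pi) auto

text \<open>The angle condition says that the length of \<phi> v divided by that of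
  \<open>J v\<close> is cos \<theta>, and \<open>J v\<close> is as long as \<open>v\<close>.
  Pythagoras puts this quotient in [0,1], where the cosine inverts arccos.\<close>

lemma phi_norm: assumes v: "v \<in> D2" shows "g (phi v) (phi v) = (cos \<theta>)\<^sup>2 * g v v"
proof (cases "v = 0")
  case True
  have "phi 0 = 0" using phi_scale[OF subspace_0[OF T], of 0] by simp
  then show ?thesis using True zero_r[OF subspace_0[OF T]] by simp
next
  case False
  have vT: "v \<in> T" using v D2V VT by blast
  let ?w = "phi v"
  have wT: "?w \<in> T" "J v \<in> T" "J v - ?w \<in> T"
    using VT[OF phi_V[OF vT]] J_in[OF vT] subspace_diff[OF T] by auto
  have vv: "g v v > 0" using pos[OF vT False] .
  have ww: "g ?w ?w \<ge> 0" using nonneg[OF wT(1)] .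
  have "g (J v) ?w = g ?w ?w" using phi_inner[OF vT phi_V[OF vT]] by simp
  then have "g (J v - ?w) (J v - ?w) = g (J v) (J v) - g ?w ?w"
    using diff_l[OF wT(3) wT(2,1)] diff_r[OF wT(2) wT(2,1)] diff_r[OF wT(1) wT(2,1)]
      sym[OF wT(1,2)] by simp
  then have le: "g ?w ?w \<le> g v v" using nonneg[OF wT(3)] J_iso[OF vT vT] by simp
  let ?r = "sqrt (g ?w ?w) / sqrt (g v v)"
  have "0 \<le> ?r" "?r \<le> 1" using ww vv le by (auto simp: divide_le_eq_1)
  moreover have "arccos ?r = \<theta>"
    using angle[OF v False] unfolding phi_component[OF v] Let_def J_iso[OF vT vT] .
  ultimately have "?r = cos \<theta>" using cos_arccos[of ?r] by simp
  then have "?r\<^sup>2 = (cos \<theta>)\<^sup>2" by simp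
  then have "g ?w ?w / g v v = (cos \<theta>)\<^sup>2" using ww vv by (simp add: power_divide)
  then show ?thesis using vv by (simp add: field_simps)
qed

lemma phi_inner_D2:
  assumes "u \<in> D2" "v \<in> D2" shows "g (phi u) (phi v) = (cos \<theta>)\<^sup>2 * g u v"
proof -
  have t: "u \<in> T" "v \<in> T" "phi u \<in> T" "phi v \<in> T" using assms D2V VT phi_D2 by blast+
  have tt: "u + v \<in> T" "phi u + phi v \<in> T" using t subspace_add[OF T] by blast+
  have exp: "g (a + b) (a + b) = g a a + 2 * g a b + g b b" if "a \<in> T" "b \<in> T" for a b
    using add_l[OF _ that, of "a + b"] add_r[OF that(1) that] add_r[OF that(2) that] sym[OF that]
      subspace_add[OF T that] by simp
  have "g (phi (u + v)) (phi (u + v)) = (cos \<theta>)\<^sup>2 * g (u + v) (u + v)"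
    by (rule phi_norm[OF subspace_add[OF D2 assms]])
  then show ?thesis
    unfolding phi_add[OF t(1,2)] exp[OF t(1,2)] exp[OF t(3,4)]
    using phi_norm[OF assms(1)] phi_norm[OF assms(2)] by (simp add: algebra_simps)
qed

text \<open>The vector \<open>?x\<close> lies in \<open>D2\<close>, and skew-symmetry together with
  the polarized norm identity makes it orthogonal to \<open>D2\<close>, hence zero.\<close>

lemma phi_phi: assumes u: "u \<in> D2" shows "phi (phi u) = - ((cos \<theta>)\<^sup>2 *\<^sub>R u)"
proof -
  let ?c = "(cos \<theta>)\<^sup>2" and ?x = "phi (phi u) + (cos \<theta>)\<^sup>2 *\<^sub>R u"
  have uT: "u \<in> T" "phi u \<in> T" "phi (phi u) \<in> T" using u D2V VT phi_D2 by blast+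
  have cu: "?c *\<^sub>R u \<in> T" using subspace_scale[OF T uT(1)] .
  have xD: "?x \<in> D2" using phi_D2 u subspace_scale[OF D2] subspace_add[OF D2] by blast
  have "g ?x w = 0" if w: "w \<in> D2" for w
  proof -
    have wT: "w \<in> T" "phi w \<in> T" using w D2V VT phi_D2 by blast+
    have "g (phi (phi u)) w = g (J (phi u)) w" by (rule phi_inner[OF uT(2) D2V[OF w]])
    also have "\<dots> = - g (phi u) (J w)" by (rule J_skew[OF uT(2) wT(1)])
    also have "g (phi u) (J w) = g (phi w) (phi u)"
      using phi_inner[OF wT(1) D2V[OF phi_D2[OF u]]] sym[OF uT(2) J_in[OF wT(1)]] by simp
    also have "\<dots> = ?c * g w u" by (rule phi_inner_D2[OF w u])
    finally show ?thesis
      using add_l[OF wT(1) uT(3) cu] scale_l[OF wT(1) uT(1)] sym[OF wT(1) uT(1)] by simp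
  qed
  from this[OF xD] have "?x = 0" using eq_0 VT[OF D2V[OF xD]] by blast
  then show ?thesis by (simp add: eq_neg_iff_add_eq_0)
qed

lemma Jh_parts:
  assumes v: "v \<in> V"
  shows "J (P v) \<in> D1" "(1 / cos \<theta>) *\<^sub>R phi (v - P v) \<in> D2" "Jh v \<in> V"
proof -
  show 1: "J (P v) \<in> D1" using P(1)[OF v] J_D1 by blast
  show 2: "(1 / cos \<theta>) *\<^sub>R phi (v - P v) \<in> D2"
    using subspace_scale[OF D2 phi_D2[OF P(2)[OF v]]] .
  show "Jh v \<in> V" unfolding Jh_def using subspace_add[OF V(1) D1V[OF 1] D2V[OF 2]] .
qed

text \<open>\<open>Jh\<close> preserves both summands. On \<open>D1\<close> it is \<open>J\<close>;
  on \<open>D2\<close> it is \<phi> divided by cos \<theta>, and the two factors 1 / cos \<theta>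
  cancel the squared cosine in \<open>phi_phi\<close>.\<close>

lemma Jh_Jh: assumes v: "v \<in> V" shows "Jh (Jh v) = - v"
proof -
  let ?c = "cos \<theta>" and ?q = "v - P v"
  note p = Jh_parts[OF v]
  have qT: "phi ?q \<in> T" using VT[OF D2V[OF phi_D2[OF P(2)[OF v]]]] .
  have PJ: "P (Jh v) = J (P v)"
    by (rule P_eqI[OF p(3,1)]) (use p(2) in \<open>simp add: Jh_def\<close>)
  have "Jh (Jh v) = J (J (P v)) + (1 / ?c) *\<^sub>R phi (Jh v - J (P v))"
    unfolding Jh_def[of "Jh v"] PJ ..
  also have "Jh v - J (P v) = (1 / ?c) *\<^sub>R phi ?q" by (simp add: Jh_def)
  also have "phi \<dots> = (1 / ?c) *\<^sub>R - (?c\<^sup>2 *\<^sub>R ?q)"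
    unfolding phi_scale[OF qT] phi_phi[OF P(2)[OF v]] ..
  also have "J (J (P v)) = - P v" using J_sq[OF VT[OF D1V[OF P(1)[OF v]]]] .
  finally show ?thesis using cos_pos by (simp add: power2_eq_square)
qed

lemma Jh_linear: "linear_on V Jh"
  unfolding linear_on_def
proof (intro conjI ballI allI)
  fix u v assume uv: "u \<in> V" "v \<in> V"
  have t: "P u \<in> T" "P v \<in> T" "u - P u \<in> T" "v - P v \<in> T"
    using P uv D1V D2V VT by blast+
  have e: "u + v - (P u + P v) = (u - P u) + (v - P v)" by simp
  show "Jh (u + v) = Jh u + Jh v"
    unfolding Jh_def P_add[OF uv] J_add[OF t(1,2)] e phi_add[OF t(3,4)]
    by (simp add: scaleR_add_right)
next
  fix a v assume v: "v \<in> V"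
  have t: "P v \<in> T" "v - P v \<in> T" using P v D1V D2V VT by blast+
  have e: "a *\<^sub>R v - a *\<^sub>R P v = a *\<^sub>R (v - P v)" by (simp add: algebra_simps)
  show "Jh (a *\<^sub>R v) = a *\<^sub>R Jh v"
    unfolding Jh_def P_scale[OF v] J_scale[OF t(1)] e phi_scale[OF t(2)]
    by (simp add: scaleR_add_right)
qed

end

section \<open>Slice charts of the fibers of a Riemannian map\<close>

text \<open>Subtracting from \<open>v\<close> its orthogonal projection onto the kernel leaves a
  horizontal vector with the same image, whose length the Riemannian map preserves.\<close>

lemma horizontal_lift:
  assumes RM: "riemannian_manifold M gM" and RN: "riemannian_manifold N gN"
    and F: "riemannian_map M gM N gN F" and c: "c \<in> charts_at M p" and v: "v \<in> tangent_space M p"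
  obtains h where "h \<in> tangent_space M p" "differential M N F p h = differential M N F p v"
    "gN (F p) (differential M N F p h) (differential M N F p h) = gM p h h"
proof -
  have M: "smooth_manifold M" and N: "smooth_manifold N" and sF: "smooth_map M N F"
    using RM RN F by (auto simp: riemannian_manifold_def riemannian_map_def)
  have p: "p \<in> points M" using charts_at_points[OF M c] .
  interpret inner_on "tangent_space M p" "gM p" by (rule riemannian_inner_on[OF RM p])
  obtain xs where xs: "set xs \<subseteq> vertical_space M N F p" "span (set xs) = vertical_space M N F p"
    using tangent_subspace_basis[OF c subspace_vertical[OF M N sF p] vertical_subset] by metis
  have xsT: "set xs \<subseteq> tangent_space M p" using xs(1) by (rule order.trans[OF _ vertical_subset])
  let ?k = "gs_proj (gM p) xs v"
  let ?h = "v - ?k"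
  have kV: "?k \<in> vertical_space M N F p" using gs_proj(1)[OF xsT v] xs(2) by simp
  have kT: "?k \<in> tangent_space M p" using kV by (rule subsetD[OF vertical_subset])
  have hT: "?h \<in> tangent_space M p" using subspace_diff[OF T v kT] .
  have hor: "?h \<in> horizontal_space M gM N F p"
    using gs_proj(2)[OF xsT v] xs(2) hT by (auto simp: horizontal_space_def orth_compl_def)
  have "differential M N F p (?h + ?k) = differential M N F p ?h + differential M N F p ?k"
    using differential_linear_on[OF M N sF p] hT kT unfolding linear_on_def by blast
  then have "differential M N F p ?h = differential M N F p v" using kV by (simp add: vertical_space_def)
  moreover have "gN (F p) (differential M N F p ?h) (differential M N F p ?h) = gM p ?h ?h"
    using F p hor unfolding riemannian_map_def by blast
  ultimately show thesis using that hT by blast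
qed

text \<open>Applies the constant rank argument to the coordinate expression of \<open>F\<close>. At
  \<open>p0\<close> the model space of the resulting chart is the vertical space in coordinates,
  which later identifies the tangent space of the fiber. The neighbourhood \<open>W\<close> is for
  the dimension count.\<close>

lemma fiber_slice:
  assumes RM: "riemannian_manifold M gM" and RN: "riemannian_manifold N gN"
    and F: "riemannian_map M gM N gN F" and p0: "p0 \<in> points M"
  obtains b c \<pi> s W where "slice M (fiber M F (F p0)) b c \<pi> s" "p0 \<in> chart_dom b"
    "chart_model b = (\<lambda>v. v c) ` vertical_space M N F p0" "\<And>v. v \<in> chart_model b \<Longrightarrow> \<pi> v = v"
    "openin (mtop M) W" "p0 \<in> W"
    "\<And>q. q \<in> W \<Longrightarrow> dim (vertical_space M N F q) = dim (vertical_space M N F p0)"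
proof -
  let ?V = "vertical_space M N F"
  have M: "smooth_manifold M" and N: "smooth_manifold N" and sF: "smooth_map M N F"
    using RM RN F by (auto simp: riemannian_manifold_def riemannian_map_def)
  have cF: "continuous_map (mtop M) (mtop N) F" using sF by (simp add: smooth_map_def)
  have Fp0: "F p0 \<in> points N" using cF p0 by (auto simp: continuous_map_def)
  obtain c d where c: "c \<in> charts_at M p0" and d: "d \<in> charts_at N (F p0)"
    using charts_at_ex[OF M p0] charts_at_ex[OF N Fp0] by blast
  note C = charts_at_chart[OF M c] and Dc = charts_at_chart[OF N d]
  note cc = charts_atD[OF c] and dd = charts_atD[OF d]
  let ?E = "chart_model c" and ?R = "rep_dom c d F" and ?y0 = "chart_map c p0"
  obtain U1 m1 k1 where U1: "openin (mtop M) U1" "p0 \<in> U1" "U1 \<subseteq> chart_dom c" "0 < m1" "0 < k1"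
    "\<And>q u. q \<in> U1 \<Longrightarrow> u \<in> tangent_space M q \<Longrightarrow> m1 * (norm (u c))\<^sup>2 \<le> gM q u u"
    "\<And>q u. q \<in> U1 \<Longrightarrow> u \<in> tangent_space M q \<Longrightarrow> gM q u u \<le> k1 * (norm (u c))\<^sup>2"
    by (rule metric_comparable[OF RM c]) (rule that)
  obtain U2 m2 k2 where U2: "openin (mtop N) U2" "F p0 \<in> U2" "U2 \<subseteq> chart_dom d" "0 < m2" "0 < k2"
    "\<And>q u. q \<in> U2 \<Longrightarrow> u \<in> tangent_space N q \<Longrightarrow> m2 * (norm (u d))\<^sup>2 \<le> gN q u u"
    "\<And>q u. q \<in> U2 \<Longrightarrow> u \<in> tangent_space N q \<Longrightarrow> gN q u u \<le> k2 * (norm (u d))\<^sup>2"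
    by (rule metric_comparable[OF RN d]) (rule that)
  define V0 where "V0 = U1 \<inter> {q \<in> points M. F q \<in> U2}"
  have V0: "openin (mtop M) V0" unfolding V0_def
    by (intro openin_Int U1(1) openin_continuous_map_preimage[OF cF U2(1)])
  have p0V: "p0 \<in> V0" using U1(2) U2(2) p0 by (simp add: V0_def)
  have V0c: "q \<in> chart_dom c" and V0d: "F q \<in> chart_dom d" and V0U: "q \<in> U1" "F q \<in> U2"
    if "q \<in> V0" for q
    using that U1(3) U2(3) by (auto simp: V0_def)
  have cq: "c \<in> charts_at M q" "d \<in> charts_at N (F q)" if "q \<in> V0" for q
    using V0c[OF that] V0d[OF that] cc dd by (auto simp: charts_at_def)
  \<comment> \<open>From m1 |h|^2 \<le> gM(h,h) = gN(dF h, dF h) \<le> k2 |dF h|^2 for a horizontal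
    h, the norms on both ends being coordinate norms.\<close>
  define C0 where "C0 = sqrt (k2 / m1)"
  have lift: "\<exists>w\<in>?E. rep_deriv c d F q w = rep_deriv c d F q v \<and>
      norm w \<le> C0 * norm (rep_deriv c d F q v)" if q: "q \<in> V0" and v: "v \<in> ?E" for q v
  proof -
    note cq' = cq[OF q]
    have vT: "tvec M q c v \<in> tangent_space M q" "tvec M q c v c = v"
      using tvec_in_tangent_space[OF M cq'(1) v] tvec_self[OF M cq'(1) v] .
    have qp: "q \<in> points M" using charts_at_points[OF M cq'(1)] .
    obtain h where h: "h \<in> tangent_space M q"
      "differential M N F q h = differential M N F q (tvec M q c v)"
      "gN (F q) (differential M N F q h) (differential M N F q h) = gM q h h"
      by (rule horizontal_lift[OF RM RN F cq'(1) vT(1)]) (rule that)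
    let ?x = "differential M N F q h"
    have xT: "?x \<in> tangent_space N (F q)" by (rule differential_tangent(1)[OF M N sF h(1) qp])
    have x: "?x d = rep_deriv c d F q (h c)"
      by (rule differential_tangent(2)[OF M N sF h(1) qp cq'])
    have x': "?x d = rep_deriv c d F q v"
      unfolding h(2) using differential_tangent(2)[OF M N sF vT(1) qp cq'] vT(2) by simp
    have "m1 * (norm (h c))\<^sup>2 \<le> gM q h h" by (rule U1(6)[OF V0U(1)[OF q] h(1)])
    also have "\<dots> = gN (F q) ?x ?x" using h(3) by simp
    also have "\<dots> \<le> k2 * (norm (?x d))\<^sup>2" by (rule U2(7)[OF V0U(2)[OF q] xT])
    finally have "(norm (h c))\<^sup>2 \<le> k2 / m1 * (norm (?x d))\<^sup>2"
      using U1(4) by (simp add: field_simps)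
    then have "sqrt ((norm (h c))\<^sup>2) \<le> sqrt (k2 / m1 * (norm (?x d))\<^sup>2)" by (rule real_sqrt_le_mono)
    then have "norm (h c) \<le> C0 * norm (?x d)" unfolding C0_def real_sqrt_mult by simp
    then show ?thesis using x x' tangent_coord(1)[OF h(1) cq'(1)] by metis
  qed
  have C0: "C0 \<ge> 0" using U1(4) U2(5) by (simp add: C0_def)
  have R: "openin (top_of_set ?E) ?R" by (rule rep_dom_openin[OF M N cF]) (use cc dd in auto)
  have y0R: "?y0 \<in> ?R" using rep_has_derivative(2)[OF sF c d] .
  obtain G1 where G1: "open G1" "chart_map c ` (chart_dom c \<inter> V0) = ?E \<inter> G1"
    using chart_open_map[OF C V0] by (auto simp: openin_open)
  have smF: "smooth_on ?R (rep c d F)" using sF cc dd by (simp add: smooth_map_def)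
  \<comment> \<open>The extension \<open>f\<close> agrees with the coordinate expression only on its
    domain inside the model space; below it is evaluated only after applying
    \<open>\<pi>\<close>.\<close>
  obtain U f where U: "open U" "?y0 \<in> U" "\<And>n. tdo n U f"
    "\<And>y. y \<in> ?R \<Longrightarrow> y \<in> U \<Longrightarrow> f y = rep c d F y"
    by (rule smooth_onE[OF smF y0R]) (rule that)
  define G where "G = G1 \<inter> U"
  have G: "open G" unfolding G_def by (rule open_Int[OF G1(1) U(1)])
  have EG: "\<exists>q\<in>V0. y = chart_map c q" if "y \<in> ?E" "y \<in> G" for y
    using that G1(2) by (auto simp: G_def)
  have VE: "chart_map c q \<in> ?E" "chart_map c q \<in> G1" "chart_map c q \<in> ?R" if "q \<in> V0" for q
    using that G1(2) V0c[OF that] V0d[OF that] by (auto simp: rep_dom_def)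
  obtain \<pi> where \<pi>: "bounded_linear \<pi>" "\<And>v. \<pi> v \<in> ?E" "\<And>v. v \<in> ?E \<Longrightarrow> \<pi> v = v"
    and plin: "linear \<pi>"
    by (rule chart_projection[OF C]) (rule that)
  define Uh where "Uh = \<pi> -` G"
  have Uh: "open Uh" unfolding Uh_def using G linear_continuous_on[OF \<pi>(1), of UNIV] open_vimage by blast
  have y0E: "?y0 \<in> ?E" "?y0 \<in> Uh"
    using VE[OF p0V] \<pi>(3) U(2) by (auto simp: Uh_def G_def)
  txt \<open>The second component cuts the model space out of the ambient Euclidean space, so that the
    zero set of \<open>fh - fh y0\<close> is exactly the fiber in coordinates.\<close>
  define fh where "fh y = (f (\<pi> y), y - \<pi> y)" for y
  have blp: "bounded_linear (\<lambda>y. y - \<pi> y)"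
    by (intro bounded_linear_sub bounded_linear_ident \<pi>(1))
  have fh: "tdo n Uh fh" for n
  proof -
    have "tdo n Uh (\<lambda>y. f (\<pi> y))"
      by (rule tdo_compose[OF Uh U(1) _ tdo_linear[OF Uh \<pi>(1)] U(3)]) (auto simp: Uh_def G_def)
    from tdo_compose_linear[OF Uh bounded_linear_Pair[OF bounded_linear_ident bounded_linear_zero] this]
    have 1: "tdo n Uh (\<lambda>y. (f (\<pi> y), 0 :: 'b))" .
    have 2: "tdo n Uh (\<lambda>y. (0 :: 'd, y - \<pi> y))"
      by (rule tdo_linear[OF Uh bounded_linear_Pair[OF bounded_linear_zero blp]])
    from tdo_add[OF Uh 1 2] show ?thesis by (simp add: fh_def[abs_def])
  qed
  let ?D = "\<lambda>y. fderiv fh y"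
  have D: "?D y v = (rep_deriv c d F q (\<pi> v), v - \<pi> v)"
    if y: "y \<in> Uh" and q: "q \<in> V0" "\<pi> y = chart_map c q" for y q v
  proof -
    have pU: "\<pi> y \<in> U" using y by (simp add: Uh_def G_def)
    have "(f has_derivative fderiv f (\<pi> y)) (at (\<pi> y))"
      by (rule tdo_has_derivative[OF U(3) pU])
    from has_derivative_compose[OF bounded_linear_imp_has_derivative[OF \<pi>(1)] this]
    have "((\<lambda>y. f (\<pi> y)) has_derivative (\<lambda>v. fderiv f (\<pi> y) (\<pi> v))) (at y)" .
    from has_derivative_Pair[OF this bounded_linear_imp_has_derivative[OF blp]]
    have "(fh has_derivative (\<lambda>v. (fderiv f (\<pi> y) (\<pi> v), v - \<pi> v))) (at y)"
      by (simp add: fh_def[abs_def])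
    from frechet_derivative_at[OF this]
    have e: "?D y v = (fderiv f (\<pi> y) (\<pi> v), v - \<pi> v)" by metis
    have pR: "\<pi> y \<in> ?R" unfolding q(2) by (rule VE(3)[OF q(1)])
    have "fderiv f (\<pi> y) (\<pi> v) = rep_deriv c d F q (\<pi> v)"
    proof (rule has_derivative_within_unique[OF R R chart_subspace[OF C] pR pR \<pi>(2)])
      show "(rep c d F has_derivative fderiv f (\<pi> y)) (at (\<pi> y) within ?R)"
        by (rule smooth_on_has_derivative_ext[OF pR U(1) pU U(3,4)])
      show "(rep c d F has_derivative rep_deriv c d F q) (at (\<pi> y) within ?R)"
        unfolding q(2) by (rule rep_has_derivative(1)[OF sF cq[OF q(1)]])
    qed simp
    then show ?thesis using e by simp
  qed
  \<comment> \<open>The component of \<open>v\<close> transverse to the model space is kept, and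
    only the component inside it is replaced by a bounded lift. The former is visible in the second
    entry of the derivative, which costs the extra 1 in the constant.\<close>
  have Dlift: "\<exists>w. ?D y w = ?D y v \<and> norm w \<le> (C0 + 1) * norm (?D y v)" if y: "y \<in> Uh" for y v
  proof -
    obtain q where q: "q \<in> V0" "\<pi> y = chart_map c q" using EG[OF \<pi>(2), of y] y by (auto simp: Uh_def)
    obtain w where w: "w \<in> ?E" "rep_deriv c d F q w = rep_deriv c d F q (\<pi> v)"
      "norm w \<le> C0 * norm (rep_deriv c d F q (\<pi> v))" using lift[OF q(1) \<pi>(2)] by blast
    have pw: "\<pi> (w + (v - \<pi> v)) = w"
      using w(1) \<pi>(2,3) by (simp add: linear_add[OF plin] linear_diff[OF plin])
    have e: "?D y (w + (v - \<pi> v)) = ?D y v" unfolding D[OF y q] pw w(2) by simp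
    have "norm (w + (v - \<pi> v)) \<le> norm w + norm (v - \<pi> v)" by (rule norm_triangle_ineq)
    also have "norm w \<le> C0 * norm (?D y v)"
    proof -
      have "norm (fst (?D y v)) \<le> norm (?D y v)" by (rule norm_fst_le[of "fst (?D y v)" "snd (?D y v)", simplified])
      then have "norm (rep_deriv c d F q (\<pi> v)) \<le> norm (?D y v)" using D[OF y q, of v] by simp
      then show ?thesis using w(3) C0 by (meson mult_left_mono order.trans)
    qed
    also have "norm (v - \<pi> v) \<le> norm (?D y v)"
      using norm_snd_le[of "v - \<pi> v" "rep_deriv c d F q (\<pi> v)"] D[OF y q, of v] by simp
    finally have "norm (w + (v - \<pi> v)) \<le> (C0 + 1) * norm (?D y v)" by (simp add: algebra_simps)
    then show ?thesis using e by blast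
  qed
  have Dker: "{v. ?D (chart_map c q) v = 0} = (\<lambda>v. v c) ` ?V q"
    if q: "q \<in> V0" and y: "chart_map c q \<in> Uh" for q
  proof -
    have "\<pi> (chart_map c q) = chart_map c q" using \<pi>(3) VE(1)[OF q] by blast
    note Dq = D[OF y q this]
    show ?thesis unfolding vertical_coords[OF M N sF cq[OF q]] Dq zero_prod_def prod.inject
    proof (intro Collect_cong iffI conjI)
      fix v assume v: "rep_deriv c d F q (\<pi> v) = 0 \<and> v - \<pi> v = 0"
      then have "v = \<pi> v" by simp
      then show "v \<in> ?E" "rep_deriv c d F q v = 0" using v \<pi>(2)[of v] by auto
    next
      fix v assume v: "v \<in> ?E \<and> rep_deriv c d F q v = 0"
      then show "rep_deriv c d F q (\<pi> v) = 0" "v - \<pi> v = 0" using \<pi>(3) by auto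
    qed
  qed
  obtain G' T p s where crf: "open G'" "?y0 \<in> G'" "G' \<subseteq> Uh"
    "openin (top_of_set {v. ?D ?y0 v = 0}) T" "bounded_linear p" "range p \<subseteq> {v. ?D ?y0 v = 0}"
    "\<And>v. ?D ?y0 v = 0 \<Longrightarrow> p v = v" "smooth_on T s"
    "\<And>y. y \<in> G' \<Longrightarrow> fh y = fh ?y0 \<Longrightarrow> p y \<in> T \<and> s (p y) = y"
    "\<And>z. z \<in> T \<Longrightarrow> s z \<in> G' \<and> fh (s z) = fh ?y0 \<and> p (s z) = z"
    "\<And>y. y \<in> G' \<Longrightarrow> dim {v. ?D y v = 0} = dim {v. ?D ?y0 v = 0}"
    by (rule constant_rank_fiber[OF Uh y0E(2) fh Dlift]) (assumption, rule that)
  note K = Dker[OF p0V y0E(2)]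
  let ?S = "fiber M F (F p0)"
  define W where "W = V0 \<inter> {q \<in> chart_dom c. chart_map c q \<in> G'}"
  have W: "openin (mtop M) W" unfolding W_def by (intro openin_Int V0 chart_preimage[OF C crf(1)])
  have p0W: "p0 \<in> W" using p0V cc crf(2) by (simp add: W_def)
  define Dm where "Dm = W \<inter> ?S"
  \<comment> \<open>The projection onto the kernel, applied to ambient coordinates, is the chart.
    The section \<open>s\<close> of the constant rank lemma is the smooth inverse demanded of a
    slice.\<close>
  define b where "b = Chart Dm {v. ?D ?y0 v = 0} (p \<circ> chart_map c)"
  have b: "chart_dom b = Dm" "chart_model b = {v. ?D ?y0 v = 0}" "\<And>q. chart_map b q = p (chart_map c q)"
    by (simp_all add: b_def)
  have fhV: "fh (chart_map c q) = (chart_map d (F q), 0)" if q: "q \<in> W" for q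
  proof -
    have qV: "q \<in> V0" and qG: "chart_map c q \<in> G'" using q by (auto simp: W_def)
    have e: "\<pi> (chart_map c q) = chart_map c q" using \<pi>(3) VE(1)[OF qV] by blast
    have "chart_map c q \<in> Uh" using qG crf(3) by blast
    then have "chart_map c q \<in> U" using e by (simp add: Uh_def G_def)
    then have "f (chart_map c q) = rep c d F (chart_map c q)" using U(4) VE(3)[OF qV] by blast
    then show ?thesis using e rep_chart_map[OF C V0c[OF qV]] by (simp add: fh_def)
  qed
  have Dm: "p (chart_map c q) \<in> T \<and> s (p (chart_map c q)) = chart_map c q" if q: "q \<in> Dm" for q
  proof (rule crf(9))
    show "chart_map c q \<in> G'" using q by (simp add: Dm_def W_def)
    show "fh (chart_map c q) = fh ?y0"
      using q fhV[of q] fhV[OF p0W] by (simp add: Dm_def fiber_def)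
  qed
  have im: "chart_map b ` Dm = T"
  proof
    show "chart_map b ` Dm \<subseteq> T" using Dm b(3) by auto
    \<comment> \<open>A point \<open>s z\<close> of the level set has zero transverse entry, hence
      lies in the model space and comes from a point \<open>q\<close> of \<open>V0\<close>.
      Injectivity of the chart \<open>d\<close> then turns equal coordinates of \<open>F q\<close>
      and \<open>F p0\<close> into equality.\<close>
    show "T \<subseteq> chart_map b ` Dm"
    proof
      fix z assume z: "z \<in> T"
      note sz = crf(10)[OF z]
      have fs: "fh (s z) = (chart_map d (F p0), 0)" using sz fhV[OF p0W] by simp
      then have "s z = \<pi> (s z)" by (simp add: fh_def)
      then have sE: "s z \<in> ?E" using \<pi>(2) by metis
      have "s z \<in> Uh" using sz crf(3) by blast
      then have "s z \<in> G" using \<open>s z = \<pi> (s z)\<close> by (simp add: Uh_def)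
      then obtain q where q: "q \<in> V0" "s z = chart_map c q" using EG[OF sE] by blast
      have qW: "q \<in> W" using q V0c[OF q(1)] sz by (simp add: W_def)
      have "chart_map d (F q) = chart_map d (F p0)" using fhV[OF qW] fs q(2) by simp
      then have "F q = F p0" using inj_onD[OF chart_inj[OF Dc]] V0d[OF q(1)] dd by blast
      moreover have "q \<in> points M" using charts_at_points[OF M cq(1)[OF q(1)]] .
      ultimately have "q \<in> Dm" using qW by (simp add: Dm_def fiber_def)
      moreover have "chart_map b q = z" using sz q(2) b(3) by simp
      ultimately show "z \<in> chart_map b ` Dm" by blast
    qed
  qed
  show thesis
  proof (rule that)
    show "slice M ?S b c p s"
      unfolding slice_def b(1,2) im
    proof (intro conjI ballI)
      show "c \<in> atlas M" using cc by blast
      show "Dm \<subseteq> chart_dom c" "Dm \<subseteq> ?S" by (auto simp: Dm_def W_def)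
      show "openin (subtopology (mtop M) ?S) Dm"
        unfolding Dm_def using W openin_subtopology by blast
      show "subspace {v. ?D ?y0 v = 0}"
        by (rule linear_subspace_kernel[OF has_derivative_linear[OF tdo_has_derivative[OF fh y0E(2)]]])
      show "chart_map b q = p (chart_map c q)" for q by (rule b(3))
      show "s (chart_map b q) = chart_map c q" if "q \<in> Dm" for q using Dm[OF that] b(3) by simp
    qed (use crf in auto)
    show "p0 \<in> chart_dom b" using p0W p0 by (simp add: b(1) Dm_def fiber_def)
    show "chart_model b = (\<lambda>v. v c) ` ?V p0" unfolding b(2) K ..
    show "p v = v" if "v \<in> chart_model b" for v using that crf(7) by (simp add: b(2))
    show "openin (mtop M) W" "p0 \<in> W" by (rule W, rule p0W)
    have dim: "dim (?V q) = dim ((\<lambda>v. v c) ` ?V q)" if "q \<in> V0" for q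
      using tangent_subspace_basis[OF cq(1)[OF that]
          subspace_vertical[OF M N sF charts_at_points[OF M cq(1)[OF that]]] vertical_subset] by metis
    show "dim (?V q) = dim (?V p0)" if "q \<in> W" for q
    proof -
      have q: "q \<in> V0" "chart_map c q \<in> G'" using that by (auto simp: W_def)
      have "chart_map c q \<in> Uh" using q(2) crf(3) by blast
      then show ?thesis
        using crf(11)[OF q(2)] unfolding K Dker[OF q(1) \<open>chart_map c q \<in> Uh\<close>] dim[OF q(1)] dim[OF p0V] by blast
    qed
  qed
qed

section \<open>The almost complex structure on the fibers\<close>

locale semi_slant =
  fixes M :: "('a, 'e::euclidean_space) manifold"
    and gM :: "('a, 'e) metric"
    and J :: "('a, 'e) tangent_endo"
    and N :: "('b, 'f::euclidean_space) manifold"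
    and gN :: "('b, 'f) metric"
    and F :: "'a \<Rightarrow> 'b"
    and D1 :: "'a \<Rightarrow> ('a, 'e) tangent_vector set"
    and \<theta> :: real
  assumes hermitian: "almost_hermitian_manifold M gM J"
    and RN: "riemannian_manifold N gN"
    and slant: "semi_slant_riemannian_map M gM J N gN F D1 \<theta>"
    and theta: "0 \<le> \<theta>" "\<theta> < pi / 2"
begin

abbreviation "V \<equiv> vertical_space M N F"
abbreviation "D2 \<equiv> D2_of M gM N F D1"
abbreviation "Jhat \<equiv> J_hat M gM J N F D1 \<theta>"

lemma RM: "riemannian_manifold M gM" and acM: "almost_complex_manifold M J"
  using hermitian by (simp_all add: almost_hermitian_manifold_def)

lemma M: "smooth_manifold M" and N: "smooth_manifold N"
  using RM RN by (simp_all add: riemannian_manifold_def)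

lemma RF: "riemannian_map M gM N gN F" and distD1: "distribution M D1"
  using slant by (simp_all add: semi_slant_riemannian_map_def)

lemma sF: "smooth_map M N F" using RF by (simp add: riemannian_map_def)

lemma cF: "continuous_map (mtop M) (mtop N) F" using sF by (simp add: smooth_map_def)

lemma V_subspace: "p \<in> points M \<Longrightarrow> subspace (V p)"
  by (rule subspace_vertical[OF M N sF])

lemma slant_at:
  assumes "p \<in> points M"
  shows "D1 p \<subseteq> V p" "direct_sum (V p) (D1 p) (D2 p)" "J p ` D1 p = D1 p"
    "v \<in> D2 p \<Longrightarrow> v \<noteq> 0 \<Longrightarrow> angle_to_subspace M gM p (J p v) (D2 p) = \<theta>"
  using slant assms unfolding semi_slant_riemannian_map_def by blast+

text \<open>Any lists spanning \<open>D1 p\<close> and \<open>V p\<close> are allowed. This lets the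
  pointwise algebra be used with arbitrary bases and with the values of smooth frames alike.\<close>

lemma semi_slant_point:
  assumes p: "p \<in> points M" and xs: "span (set xs) = D1 p" and ys: "span (set ys) = V p"
  shows "semi_slant_point (tangent_space M p) (gM p) (J p) (V p) (D1 p) (D2 p)
    (gs_proj (gM p) xs) (gs_proj (gM p) ys) \<theta>"
proof -
  interpret inner_on "tangent_space M p" "gM p" by (rule riemannian_inner_on[OF RM p])
  note sl = slant_at[OF p]
  have VT: "V p \<subseteq> tangent_space M p" by (rule vertical_subset)
  have xsV: "set xs \<subseteq> V p" and ysV: "set ys \<subseteq> V p"
    using span_superset[of "set xs"] span_superset[of "set ys"] xs ys sl(1) by auto
  have xsT: "set xs \<subseteq> tangent_space M p" and ysT: "set ys \<subseteq> tangent_space M p"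
    using xsV ysV VT by auto
  have D1s: "subspace (D1 p)" using sl(2) by (simp add: direct_sum_def)
  have Jp: "J p ` tangent_space M p \<subseteq> tangent_space M p" "linear_on (tangent_space M p) (J p)"
    using acM p by (auto simp: almost_complex_manifold_def smooth_endomorphism_def)
  show ?thesis
  proof unfold_locales
    show "J p v \<in> tangent_space M p" if "v \<in> tangent_space M p" for v using Jp(1) that by blast
    show "linear_on (tangent_space M p) (J p)" by (rule Jp(2))
    show "J p (J p v) = - v" if "v \<in> tangent_space M p" for v
      using acM p that by (simp add: almost_complex_manifold_def)
    show "gM p (J p u) (J p v) = gM p u v" if "u \<in> tangent_space M p" "v \<in> tangent_space M p" for u v
      using hermitian p that by (simp add: almost_hermitian_manifold_def)
    show "subspace (V p)" "V p \<subseteq> tangent_space M p" "subspace (D1 p)" "D1 p \<subseteq> V p"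
      "D2 p = orth_compl (gM p) (V p) (D1 p)" "J p ` D1 p = D1 p" "0 \<le> \<theta>" "\<theta> < pi / 2"
      using V_subspace[OF p] VT D1s sl theta by (auto simp: D2_of_def)
    show P1: "gs_proj (gM p) xs v \<in> D1 p" if "v \<in> V p" for v
      using gs_proj(1)[OF xsT] that VT xs by blast
    show "v - gs_proj (gM p) xs v \<in> D2 p" if v: "v \<in> V p" for v
    proof -
      have "v - gs_proj (gM p) xs v \<in> V p"
        using subspace_diff[OF V_subspace[OF p] v] P1[OF v] sl(1) by blast
      moreover have "gM p (v - gs_proj (gM p) xs v) w = 0" if "w \<in> D1 p" for w
        using gs_proj(2)[OF xsT subsetD[OF VT v]] that xs by blast
      ultimately show ?thesis by (simp add: D2_of_def orth_compl_def)
    qed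
    show "gs_proj (gM p) ys v \<in> V p" if "v \<in> tangent_space M p" for v
      using gs_proj(1)[OF ysT that] ys by simp
    show "gM p (v - gs_proj (gM p) ys v) w = 0" if "v \<in> tangent_space M p" "w \<in> V p" for v w
      using gs_proj(2)[OF ysT that(1)] that(2) ys by simp
    show "(let w = component (D2 p) (orth_compl (gM p) (tangent_space M p) (D2 p)) (J p v)
       in arccos (sqrt (gM p w w) / sqrt (gM p (J p v) (J p v)))) = \<theta>" if "v \<in> D2 p" "v \<noteq> 0" for v
      using sl(4)[OF that] by (simp add: angle_to_subspace_def)
  qed
qed

lemma spanning_lists:
  assumes p: "p \<in> points M"
  obtains xs ys where "span (set xs) = D1 p" "span (set ys) = V p"
proof -
  obtain c where c: "c \<in> charts_at M p" using charts_at_ex[OF M p] by blast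
  have "subspace (D1 p)" "D1 p \<subseteq> tangent_space M p"
    using slant_at[OF p] vertical_subset[of M N F p] by (auto simp: direct_sum_def)
  from tangent_subspace_basis[OF c this] obtain xs where "span (set xs) = D1 p" by metis
  moreover from tangent_subspace_basis[OF c V_subspace[OF p] vertical_subset]
  obtain ys where "span (set ys) = V p" by metis
  ultimately show thesis using that by blast
qed

text \<open>\<open>J_hat\<close> is defined through components chosen by definite description. The
  first form exposes it as a Gram-Schmidt expression whose smoothness can be followed; the second
  connects it with the pointwise algebra.\<close>

lemma Jhat_eq:
  assumes p: "p \<in> points M" and xs: "span (set xs) = D1 p" and ys: "span (set ys) = V p"
    and v: "v \<in> V p"
  shows "Jhat p v = J p (gs_proj (gM p) xs v) +
      (1 / cos \<theta>) *\<^sub>R gs_proj (gM p) ys (J p (v - gs_proj (gM p) xs v))"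
    and "Jhat p v = semi_slant_point.Jh (J p) (gs_proj (gM p) xs) (gs_proj (gM p) ys) \<theta> v"
proof -
  interpret semi_slant_point "tangent_space M p" "gM p" "J p" "V p" "D1 p" "D2 p"
    "gs_proj (gM p) xs" "gs_proj (gM p) ys" \<theta>
    by (rule semi_slant_point[OF p xs ys])
  have "J p (v - gs_proj (gM p) xs v) \<in> tangent_space M p"
    using J_in VT D2V P(2)[OF v] by blast
  then show e: "Jhat p v = J p (gs_proj (gM p) xs v) +
      (1 / cos \<theta>) *\<^sub>R gs_proj (gM p) ys (J p (v - gs_proj (gM p) xs v))"
    unfolding J_hat_def P_part_def Q_part_def phi_part_def horizontal_space_def
      P_component[OF v] Q_component[OF v]
    by (simp only: k_component)
  then show "Jhat p v = Jh v" unfolding Jh_def phi_def .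
qed

lemma Jhat_props:
  assumes p: "p \<in> points M"
  shows "v \<in> V p \<Longrightarrow> Jhat p v \<in> V p" "v \<in> V p \<Longrightarrow> Jhat p (Jhat p v) = - v"
    "linear_on (V p) (Jhat p)"
proof -
  obtain xs ys where xy: "span (set xs) = D1 p" "span (set ys) = V p" using spanning_lists[OF p] .
  interpret semi_slant_point "tangent_space M p" "gM p" "J p" "V p" "D1 p" "D2 p"
    "gs_proj (gM p) xs" "gs_proj (gM p) ys" \<theta>
    by (rule semi_slant_point[OF p xy])
  note e = Jhat_eq(2)[OF p xy]
  show V1: "Jhat p v \<in> V p" if "v \<in> V p" for v using Jh_parts(3)[OF that] e[OF that] by simp
  show "Jhat p (Jhat p v) = - v" if "v \<in> V p" for v
    using Jh_Jh[OF that] e[OF V1[OF that]] e[OF that] by simp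
  show "linear_on (V p) (Jhat p)"
    using Jh_linear e subspace_add[OF V(1)] subspace_scale[OF V(1)] by (simp add: linear_on_def)
qed

section \<open>The fiber as an embedded submanifold, its tangent spaces, and the transported
  endomorphism\<close>

definition "fib x = fiber M F x"
definition "B x = slice_manifold M (fib x)"
abbreviation "TB x \<equiv> tangent_space (B x)"
abbreviation "inc x \<equiv> differential (B x) M id"

text \<open>A tangent vector of the fiber is indexed by charts of the fiber, so \<open>Jhat\<close>
  cannot act on it directly. It is transported through the differential of the inclusion, which is a
  bijection onto the vertical space.\<close>

definition "JB x p v = inv_into (TB x p) (inc x p)
    (Jhat p (inc x p v))"

lemma fib: "p \<in> fib x \<longleftrightarrow> p \<in> points M \<and> F p = x"
  by (simp add: fib_def fiber_def)

lemma fib_slice: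
  assumes "p \<in> fib x"
  obtains b c \<pi> s where "slice M (fib x) b c \<pi> s" "p \<in> chart_dom b"
    "chart_model b = (\<lambda>v. v c) ` V p" "\<And>v. v \<in> chart_model b \<Longrightarrow> \<pi> v = v"
proof -
  have p: "p \<in> points M" and x: "x = F p" using assms fib by auto
  show thesis unfolding x fib_def
    by (rule fiber_slice[OF RM RN RF p]) (rule that[unfolded x fib_def])
qed

lemma fib_cover: "p \<in> fib x \<Longrightarrow> \<exists>b c \<pi> s. slice M (fib x) b c \<pi> s \<and> p \<in> chart_dom b"
  by (erule fib_slice) blast

lemma fib_points: "fib x \<subseteq> points M" using fib by blast

lemma embedded: "embedded_submanifold M (fib x) (B x)"
  unfolding B_def by (rule embedded_slice_manifold[OF M fib_points fib_cover])

lemma B: "smooth_manifold (B x)" and inc_smooth: "smooth_map (B x) M id"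
  and inj_inc: "p \<in> fib x \<Longrightarrow> inj_on (inc x p) (TB x p)"
  using embedded by (auto simp: embedded_submanifold_def)

lemma mtop_B: "mtop (B x) = subtopology (mtop M) (fib x)"
  by (simp add: B_def slice_manifold_simps)

lemma points_B: "points (B x) = fib x"
  using fib_points[of x] by (auto simp: mtop_B)

lemma slice_atlas: "slice M (fib x) b c \<pi> s \<Longrightarrow> b \<in> atlas (B x)"
  by (auto simp: B_def slice_manifold_simps)

lemma charts_at_slice: "slice M (fib x) b c \<pi> s \<Longrightarrow> p \<in> chart_dom b \<Longrightarrow>
    b \<in> charts_at (B x) p \<and> c \<in> charts_at M p \<and> p \<in> fib x"
  using slice_atlas sliceD(1-3)[of M "fib x" b c \<pi> s] by (auto simp: charts_at_def)

lemma slice_tangent_B: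
  "slice M (fib x) b c \<pi> s \<Longrightarrow> p \<in> chart_dom b \<Longrightarrow> u \<in> TB x p \<Longrightarrow>
    u b = \<pi> (inc x p u c)"
  unfolding B_def by (rule slice_tangent[OF M B[unfolded B_def] inc_smooth[unfolded B_def]])

text \<open>\<open>F\<close> is constant on the fiber, so its expression in a chart of the fiber has
  zero derivative; the chain rule through the inclusion gives the claim.\<close>

lemma differential_inc_vertical:
  assumes p: "p \<in> fib x" and u: "u \<in> TB x p"
  shows "inc x p u \<in> V p"
proof -
  have pM: "p \<in> points M" and pB: "p \<in> points (B x)" and Fp: "F p = x"
    using p points_B fib by auto
  have "F p \<in> points N" using cF pM by (auto simp: continuous_map_def)
  then obtain c d where c: "c \<in> charts_at M p" and d: "d \<in> charts_at N (F p)"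
    using charts_at_ex[OF M pM] charts_at_ex[OF N] by blast
  obtain b where b: "b \<in> charts_at (B x) p" using charts_at_ex[OF B pB] by blast
  note bc = charts_at_chart[OF B b]
  have ub: "u b \<in> chart_model b" by (rule tangent_coord(1)[OF u b])
  have cBF: "continuous_map (mtop (B x)) (mtop N) F"
    unfolding mtop_B by (rule continuous_map_from_subtopology[OF cF])
  have R: "openin (top_of_set (chart_model b)) (rep_dom b d F)"
    by (rule rep_dom_openin[OF B N cBF]) (use charts_atD[OF b] charts_atD[OF d] in auto)
  have xR: "chart_map b p \<in> rep_dom b d F"
    using charts_atD[OF b] charts_atD[OF d] by (auto simp: rep_dom_def)
  have const: "chart_map d x = rep b d F y" if y: "y \<in> rep_dom b d F" for y
  proof -
    obtain q where q: "q \<in> chart_dom b" "y = chart_map b q" using y by (auto simp: rep_dom_def)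
    have "q \<in> fib x" using openin_subset[OF chart_openin[OF bc]] q(1) points_B by blast
    then show ?thesis using q by (simp add: rep_chart_map[OF bc] fib)
  qed
  have "(rep b d F has_derivative (\<lambda>_. 0)) (at (chart_map b p) within rep_dom b d F)"
    by (rule has_derivative_transform[OF xR const[symmetric] has_derivative_const])
  from frechet_derivative_within_eqI[OF R R chart_subspace[OF bc] xR subset_refl this ub]
  have 0: "rep_deriv b d F p (u b) = 0" unfolding rep_deriv_def .
  have "rep_deriv b d (F \<circ> id) p (u b) = rep_deriv c d F (id p) (rep_deriv b c id p (u b))"
    by (rule rep_deriv_chain[OF B M N inc_smooth sF b _ _ ub]) (use c d in auto)
  moreover have "inc x p u c = rep_deriv b c id p (u b)"
    by (rule differential_tangent(2)[OF B M inc_smooth u pB b]) (use c in simp)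
  ultimately have "rep_deriv c d F p (inc x p u c) = 0" using 0 by simp
  moreover have "inc x p u \<in> tangent_space M p"
    using differential_tangent(1)[OF B M inc_smooth u pB] by simp
  ultimately show ?thesis using vertical_iff[OF M N sF c d] by blast
qed

text \<open>For the reverse inclusion the chart built at \<open>p\<close> itself is used: its model
  space is the coordinate image of \<open>V p\<close>, and \<open>\<pi>\<close> is the identity
  there. The fiber vector with coordinate \<open>w c\<close> is sent to a vertical vector with the
  same ambient coordinate as \<open>w\<close>.\<close>

lemma differential_inc_image:
  assumes p: "p \<in> fib x"
  shows "inc x p ` TB x p = V p"
proof
  show "inc x p ` TB x p \<subseteq> V p"
    using differential_inc_vertical[OF p] by blast
  show "V p \<subseteq> inc x p ` TB x p"
  proof
    fix w assume w: "w \<in> V p"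
    obtain b c \<pi> s where sl: "slice M (fib x) b c \<pi> s" "p \<in> chart_dom b"
      and mod: "chart_model b = (\<lambda>v. v c) ` V p" "\<And>v. v \<in> chart_model b \<Longrightarrow> \<pi> v = v"
      by (rule fib_slice[OF p]) (rule that)
    have b: "b \<in> charts_at (B x) p" and c: "c \<in> charts_at M p" using charts_at_slice[OF sl] by auto
    have wc: "w c \<in> chart_model b" using w mod(1) by blast
    let ?u = "tvec (B x) p b (w c)"
    have u: "?u \<in> TB x p" by (rule tvec_in_tangent_space[OF B b wc])
    let ?w = "inc x p ?u"
    have wV: "?w \<in> V p" by (rule differential_inc_vertical[OF p u])
    then have "?w c \<in> chart_model b" using mod(1) by blast
    then have "?w c = \<pi> (?w c)" using mod(2) by simp
    also have "\<dots> = w c" using slice_tangent_B[OF sl u] tvec_self[OF B b wc] by simp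
    finally have e: "?w = w"
      by (rule tangent_eqI[OF subsetD[OF vertical_subset wV] subsetD[OF vertical_subset w] c])
    then show "w \<in> inc x p ` TB x p"
      using imageI[OF u, of "inc x p"] by (simp only: e)
  qed
qed

lemma JB_props:
  assumes p: "p \<in> fib x" and v: "v \<in> TB x p"
  shows "JB x p v \<in> TB x p"
    and "inc x p (JB x p v) = Jhat p (inc x p v)"
proof -
  have "Jhat p (inc x p v) \<in> V p"
    using Jhat_props(1) differential_inc_vertical[OF p v] p fib by blast
  then have "Jhat p (inc x p v) \<in> inc x p ` TB x p"
    unfolding differential_inc_image[OF p] .
  then show "JB x p v \<in> TB x p"
    and "inc x p (JB x p v) = Jhat p (inc x p v)"
    unfolding JB_def by (rule inv_into_into, rule f_inv_into_f)
qed

lemma inc_linear: "p \<in> fib x \<Longrightarrow> linear_on (TB x p) (inc x p)"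
  by (rule differential_linear_on[OF B M inc_smooth]) (simp add: points_B)

lemma JB_linear:
  assumes p: "p \<in> fib x" shows "linear_on (TB x p) (JB x p)"
proof -
  let ?T = "TB x p" and ?i = "inc x p"
  note T = subspace_tangent_space[OF B, of x p]
  have pM: "p \<in> points M" using p fib by blast
  have i: "?i (u + v) = ?i u + ?i v" "?i (a *\<^sub>R u) = a *\<^sub>R ?i u" if "u \<in> ?T" "v \<in> ?T" for u v a
    using inc_linear[OF p] that by (simp_all add: linear_on_def)
  have h: "Jhat p (u + v) = Jhat p u + Jhat p v" "Jhat p (a *\<^sub>R u) = a *\<^sub>R Jhat p u"
    if "u \<in> V p" "v \<in> V p" for u v a
    using Jhat_props(3)[OF pM] that by (simp_all add: linear_on_def)
  note iV = differential_inc_vertical[OF p] and JT = JB_props(1)[OF p] and Ji = JB_props(2)[OF p]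
  show ?thesis
    unfolding linear_on_def
  proof (intro conjI ballI allI)
    fix u v assume uv: "u \<in> ?T" "v \<in> ?T"
    have s: "u + v \<in> ?T" "JB x p u + JB x p v \<in> ?T" using uv JT subspace_add[OF T] by blast+
    have "?i (JB x p (u + v)) = ?i (JB x p u + JB x p v)"
      using Ji[OF s(1)] Ji[OF uv(1)] Ji[OF uv(2)] i(1)[OF uv] i(1)[OF JT[OF uv(1)] JT[OF uv(2)]]
        h(1)[OF iV[OF uv(1)] iV[OF uv(2)]] by simp
    then show "JB x p (u + v) = JB x p u + JB x p v"
      by (rule inj_onD[OF inj_inc[OF p] _ JT[OF s(1)] s(2)])
  next
    fix a u assume u: "u \<in> ?T"
    have s: "a *\<^sub>R u \<in> ?T" "a *\<^sub>R JB x p u \<in> ?T" using u JT subspace_scale[OF T] by blast+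
    have "?i (JB x p (a *\<^sub>R u)) = ?i (a *\<^sub>R JB x p u)"
      using Ji[OF s(1)] Ji[OF u] i(2)[OF u u] i(2)[OF JT[OF u] JT[OF u]] h(2)[OF iV[OF u] iV[OF u]]
      by simp
    then show "JB x p (a *\<^sub>R u) = a *\<^sub>R JB x p u"
      by (rule inj_onD[OF inj_inc[OF p] _ JT[OF s(1)] s(2)])
  qed
qed

lemma JB_JB:
  assumes p: "p \<in> fib x" and v: "v \<in> TB x p"
  shows "JB x p (JB x p v) = - v"
proof -
  let ?i = "inc x p"
  note j = JB_props(1)[OF p v]
  have pM: "p \<in> points M" using p fib by blast
  have m: "- v \<in> TB x p" using subspace_neg[OF subspace_tangent_space[OF B] v] .
  have "?i ((-1) *\<^sub>R v) = (-1) *\<^sub>R ?i v" using inc_linear[OF p] v unfolding linear_on_def by blast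
  then have "?i (- v) = - ?i v" by simp
  then have "?i (JB x p (JB x p v)) = ?i (- v)"
    using JB_props(2)[OF p j] JB_props(2)[OF p v] Jhat_props(2)[OF pM differential_inc_vertical[OF p v]]
    by simp
  then show ?thesis by (rule inj_onD[OF inj_inc[OF p] _ JB_props(1)[OF p j] m])
qed

text \<open>At every point of the chart, not only where it was built, this linear map takes the
  image of a fiber vector back to the coordinate of that vector. It therefore inverts the inclusion
  in coordinates.\<close>

lemma slice_coordinates:
  assumes sl: "slice M (fib x) b c \<pi> s" and q: "q \<in> chart_dom b"
  shows "linear (\<lambda>w. \<pi> (w c))" "inj_on (\<lambda>w. \<pi> (w c)) (V q)"
    "(\<lambda>w. \<pi> (w c)) ` V q = chart_model b"
proof -
  let ?L = "\<lambda>w. \<pi> (w c)"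
  have bq: "b \<in> charts_at (B x) q" and qf: "q \<in> fib x" using charts_at_slice[OF sl q] by auto
  show "linear ?L"
    using linear_compose[OF linear_coord bounded_linear.linear[OF sliceD(7)[OF sl]]] by (simp add: o_def)
  have Li: "?L (inc x q u) = u b" if "u \<in> TB x q" for u
    using slice_tangent_B[OF sl q that] by simp
  show "inj_on ?L (V q)"
  proof (rule inj_onI)
    fix w w' assume w: "w \<in> V q" "w' \<in> V q" "?L w = ?L w'"
    obtain u u' where u: "u \<in> TB x q" "w = inc x q u" "u' \<in> TB x q" "w' = inc x q u'"
      using w differential_inc_image[OF qf] by blast
    have "u b = u' b" using w(3) Li[OF u(1)] Li[OF u(3)] u(2,4) by simp
    then have "u = u'" by (rule tangent_eqI[OF u(1,3) bq])
    then show "w = w'" using u by simp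
  qed
  show "?L ` V q = chart_model b"
  proof
    show "?L ` V q \<subseteq> chart_model b"
      unfolding differential_inc_image[OF qf, symmetric] using Li tangent_coord(1)[OF _ bq] by auto
    show "chart_model b \<subseteq> ?L ` V q"
    proof
      fix e assume e: "e \<in> chart_model b"
      have t: "tvec (B x) q b e \<in> TB x q" "tvec (B x) q b e b = e"
        using tvec_in_tangent_space[OF B bq e] tvec_self[OF B bq e] .
      have "e = ?L (inc x q (tvec (B x) q b e))" using Li[OF t(1)] t(2) by simp
      then show "e \<in> ?L ` V q" using differential_inc_vertical[OF qf t(1)] by blast
    qed
  qed
qed

text \<open>A fixed basis of the model space gives coordinate fields on the fiber, and their images
  form a frame of the kernel along the whole chart. Applying the map of
  \<open>slice_coordinates\<close> returns the fixed basis, which settles both span and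
  independence.\<close>

lemma vertical_frame:
  assumes sl: "slice M (fib x) b c \<pi> s"
  obtains es where "set es \<subseteq> chart_model b"
    "\<And>q. q \<in> chart_dom b \<Longrightarrow> span (set (map (\<lambda>e. inc x q (tvec (B x) q b e)) es)) = V q"
    "\<And>q. q \<in> chart_dom b \<Longrightarrow> indep_list (map (\<lambda>e. inc x q (tvec (B x) q b e)) es)"
proof -
  obtain X where X: "X \<subseteq> chart_model b" "independent X" "chart_model b \<subseteq> span X"
    by (rule basis_exists[of "chart_model b"]) (rule that)
  obtain es where es: "set es = X" "distinct es"
    using finite_distinct_list[OF independent_imp_finite[OF X(2)]] by blast
  have sp: "span X = chart_model b"
    using X sliceD(5)[OF sl] by (simp add: span_minimal subset_antisym)
  have *: "span (set (map (\<lambda>e. inc x q (tvec (B x) q b e)) es)) = V q \<and>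
      indep_list (map (\<lambda>e. inc x q (tvec (B x) q b e)) es)" if q: "q \<in> chart_dom b" for q
  proof -
    have b: "b \<in> charts_at (B x) q" and qf: "q \<in> fib x"
      using charts_at_slice[OF sl q] by auto
    have qM: "q \<in> points M" using qf fib by blast
    let ?f = "\<lambda>e. inc x q (tvec (B x) q b e)" and ?L = "\<lambda>w. \<pi> (w c)"
    note L = slice_coordinates[OF sl q]
    have fV: "?f e \<in> V q" and Lf: "?L (?f e) = e" if "e \<in> X" for e
    proof -
      have e: "e \<in> chart_model b" using that X(1) by blast
      show "?f e \<in> V q" by (rule differential_inc_vertical[OF qf tvec_in_tangent_space[OF B b e]])
      show "?L (?f e) = e"
        using slice_tangent_B[OF sl q tvec_in_tangent_space[OF B b e]] tvec_self[OF B b e] by simp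
    qed
    have fX: "?f ` X \<subseteq> V q" using fV by blast
    have sub: "span (?f ` X) \<subseteq> V q" by (rule span_minimal[OF fX V_subspace[OF qM]])
    have im: "?L ` ?f ` X = X" unfolding image_image using Lf by simp
    have "?L ` span (?f ` X) = ?L ` V q" unfolding linear_span_image[OF L(1), symmetric] im sp L(3) ..
    then have "span (?f ` X) = V q" using inj_on_image_eq_iff[OF L(2) sub subset_refl] by blast
    moreover have "independent (?f ` X)"
      by (rule independent_linear_preimage[OF L(1) inj_on_subset[OF L(2) fX], unfolded im, OF X(2)])
    moreover have "inj_on ?f X" by (rule inj_on_inverseI[of _ ?L]) (rule Lf)
    ultimately show ?thesis using es by (simp add: indep_list_iff distinct_map)
  qed
  show thesis by (rule that[OF _ conjunct1[OF *] conjunct2[OF *]]) (simp only: es(1) X(1))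
qed

text \<open>Instead of differentiating an inverse of the inclusion, the field is pushed into
  \<open>M\<close> along the parametrization \<open>?a\<close>, \<open>Jhat\<close> is applied there
  as a Gram-Schmidt expression, and the result is read in the chart \<open>b\<close> by the linear
  map \<open>\<pi>\<close>.\<close>

lemma JB_smooth:
  assumes U: "openin (mtop (B x)) U" and X: "smooth_vector_field (B x) U X"
  shows "smooth_vector_field (B x) U (\<lambda>p. JB x p (X p))"
  unfolding smooth_vector_field_def
proof (intro conjI ballI)
  have Uf: "U \<subseteq> fib x" using openin_subset[OF U] points_B by simp
  have XT: "X p \<in> TB x p" if "p \<in> U" for p
    using X that by (simp add: smooth_vector_field_def)
  show "JB x p (X p) \<in> TB x p" if "p \<in> U" for p
    using JB_props(1)[OF _ XT[OF that]] Uf that by blast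
  fix b assume b: "b \<in> atlas (B x)"
  then obtain c \<pi> s where sl: "slice M (fib x) b c \<pi> s" by (auto simp: B_def slice_manifold_simps)
  note sD = sliceD[OF sl] and bc = manifold_chart[OF B b]
  let ?a = "chart_inv b" and ?T = "chart_map b ` (chart_dom b \<inter> U)"
  let ?V = "\<lambda>z. inc x (?a z) (X (?a z))"
  have aT: "?a z \<in> chart_dom b" "?a z \<in> U" "chart_map b (?a z) = z" if "z \<in> ?T" for z
    using that chart_inv_map[OF bc] by auto
  have sa: "chart_map c (?a z) = s z" if "z \<in> ?T" for z
    using sD(10)[OF aT(1)[OF that]] aT(3)[OF that] by simp
  have sb: "smooth_on ?T (\<lambda>z. chart_map b (?a z))"
    by (rule smooth_on_cong[OF smooth_on_id]) (use aT(3) in simp)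
  have sc: "smooth_on ?T (\<lambda>z. chart_map c (?a z))"
    by (rule smooth_on_cong[OF smooth_on_subset[OF sD(9)]]) (use sa in auto)
  have Xa: "smooth_along (B x) b ?T ?a (\<lambda>z. X (?a z))"
    by (rule field_along[OF B b sb _ X]) (use aT in blast)
  have sub: "?a ` ?T \<subseteq> chart_dom b" "id ` ?a ` ?T \<subseteq> chart_dom c" using aT(1) sD(2) by auto
  have along: "smooth_along M c ?T ?a (\<lambda>z. inc x (?a z) (Y z))"
    if "smooth_along (B x) b ?T ?a Y" for Y
    using differential_along[OF B M inc_smooth b sD(1) sb sub that] by simp
  obtain es where es: "set es \<subseteq> chart_model b"
    "\<And>q. q \<in> chart_dom b \<Longrightarrow>
      span (set (map (\<lambda>e. inc x q (tvec (B x) q b e)) es)) = V q"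
    "\<And>q. q \<in> chart_dom b \<Longrightarrow>
      indep_list (map (\<lambda>e. inc x q (tvec (B x) q b e)) es)"
    by (rule vertical_frame[OF sl]) (rule that)
  let ?ys = "map (\<lambda>e z. inc x (?a z) (tvec (B x) (?a z) b e)) es"
  have ys: "smooth_along M c ?T ?a (\<lambda>z. inc x (?a z) (tvec (B x) (?a z) b e))"
    if "e \<in> set es" for e
  proof (rule along[OF field_along[OF B b sb]])
    show "smooth_vector_field (B x) (chart_dom b) (\<lambda>q. tvec (B x) q b e)"
      by (rule smooth_vector_field_tvec[OF B b]) (use that es(1) in blast)
    show "?a ` ?T \<subseteq> chart_dom b \<inter> chart_dom b" using sub(1) by simp
  qed
  show "smooth_on ?T (\<lambda>z. JB x (?a z) (X (?a z)) b)"
  proof (rule smooth_on_local)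
    fix z0 assume z0: "z0 \<in> ?T"
    have "?a z0 \<in> points M" using aT(2)[OF z0] Uf fib by blast
    then obtain U1 n Y where U1: "openin (mtop M) U1" "?a z0 \<in> U1"
      and Y: "\<And>i. i < n \<Longrightarrow> smooth_vector_field M U1 (Y i)"
      "\<And>q. q \<in> U1 \<Longrightarrow> inj_on (\<lambda>i. Y i q) {..<n} \<and> independent ((\<lambda>i. Y i q) ` {..<n}) \<and>
        D1 q = span ((\<lambda>i. Y i q) ` {..<n::nat})"
      using distD1 unfolding distribution_def by metis
    \<comment> \<open>Frames of D1 exist only locally in \<open>M\<close>. The domain is shrunk to
      points of the fiber that lie in the domain of one frame, and the smaller set is described by
      an open set \<open>W\<close> of coordinates.\<close>
    have "openin (mtop (B x)) (U \<inter> U1)"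
    proof -
      have "openin (mtop (B x)) (U1 \<inter> fib x)" unfolding mtop_B using U1(1) openin_subtopology by blast
      moreover have "U \<inter> U1 = U \<inter> (U1 \<inter> fib x)" using Uf by blast
      ultimately show ?thesis using U by (simp add: openin_Int)
    qed
    from chart_open_map[OF bc this]
    obtain W where W: "open W" "chart_map b ` (chart_dom b \<inter> (U \<inter> U1)) = chart_model b \<inter> W"
      by (auto simp: openin_open)
    have z0W: "z0 \<in> W"
    proof -
      have "chart_map b (?a z0) \<in> chart_map b ` (chart_dom b \<inter> (U \<inter> U1))" using aT[OF z0] U1(2) by blast
      then show ?thesis using W(2) aT(3)[OF z0] by auto
    qed
    let ?T' = "?T \<inter> W"
    have aU1: "?a z \<in> U1" if "z \<in> ?T'" for z
    proof -
      have "z \<in> chart_model b" using that openin_imp_subset[OF sD(6)] by blast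
      then have "z \<in> chart_map b ` (chart_dom b \<inter> (U \<inter> U1))" using that W(2) by blast
      then show ?thesis using chart_inv_map[OF bc] by auto
    qed
    let ?xs = "map (\<lambda>i z. Y i (?a z)) [0..<n]"
    have subT: "?T' \<subseteq> ?T" by blast
    have sc': "smooth_on ?T' (\<lambda>z. chart_map c (?a z))" by (rule smooth_on_subset[OF sc subT])
    have sub': "?a ` ?T' \<subseteq> chart_dom c" using sub(2) by auto
    have xs: "smooth_along M c ?T' ?a (\<lambda>z. Y i (?a z))" if "i < n" for i
      by (rule field_along[OF M sD(1) sc' _ Y(1)[OF that]]) (use sub' aU1 in blast)
    have xsl: "list_all (smooth_along M c ?T' ?a) ?xs" using xs by (simp add: list_all_iff)
    have ysl: "list_all (smooth_along M c ?T' ?a) ?ys"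
      using smooth_along_subset[OF ys subT] by (auto simp: list_all_iff)
    have xs_eq: "map (\<lambda>f. f z) ?xs = map (\<lambda>i. Y i (?a z)) [0..<n]" for z by simp
    have ys_eq: "map (\<lambda>f. f z) ?ys = map (\<lambda>e. inc x (?a z) (tvec (B x) (?a z) b e)) es" for z
      by simp
    have xsi: "indep_list (map (\<lambda>f. f z) ?xs)" and xsD: "span (set (map (\<lambda>f. f z) ?xs)) = D1 (?a z)"
      if "z \<in> ?T'" for z
    proof -
      have "set (map (\<lambda>i. Y i (?a z)) [0..<n]) = (\<lambda>i. Y i (?a z)) ` {..<n}" by auto
      then show "indep_list (map (\<lambda>f. f z) ?xs)" "span (set (map (\<lambda>f. f z) ?xs)) = D1 (?a z)"
        unfolding xs_eq using Y(2)[OF aU1[OF that]]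
        by (simp_all add: indep_list_iff distinct_map atLeast0LessThan)
    qed
    have ysi: "indep_list (map (\<lambda>f. f z) ?ys)" and ysV: "span (set (map (\<lambda>f. f z) ?ys)) = V (?a z)"
      if "z \<in> ?T'" for z
      unfolding ys_eq using es(2,3)[OF aT(1)] that by blast+
    have Va: "smooth_along M c ?T' ?a ?V" by (rule smooth_along_subset[OF along[OF Xa] subT])
    let ?p = "\<lambda>z. gs_proj (gM (?a z)) (map (\<lambda>f. f z) ?xs)"
    let ?k = "\<lambda>z. gs_proj (gM (?a z)) (map (\<lambda>f. f z) ?ys)"
    have Je: "smooth_endomorphism M J" using acM by (simp add: almost_complex_manifold_def)
    note Ja = endo_along[OF M sD(1) sc' sub' Je]
    have pa: "smooth_along M c ?T' ?a (\<lambda>z. ?p z (?V z))"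
      by (rule gs_proj_along[OF RM sD(1) sc' sub' xsl xsi Va])
    have "smooth_along M c ?T' ?a (\<lambda>z. ?V z + (-1) *\<^sub>R ?p z (?V z))"
      by (rule smooth_along_add[OF M Va smooth_along_scale[OF M smooth_on_const pa]])
    then have "smooth_along M c ?T' ?a (\<lambda>z. ?V z - ?p z (?V z))" by simp
    from gs_proj_along[OF RM sD(1) sc' sub' ysl ysi Ja[OF this]]
    have ka: "smooth_along M c ?T' ?a (\<lambda>z. ?k z (J (?a z) (?V z - ?p z (?V z))))" .
    have "smooth_along M c ?T' ?a (\<lambda>z. J (?a z) (?p z (?V z)) +
        (1 / cos \<theta>) *\<^sub>R ?k z (J (?a z) (?V z - ?p z (?V z))))"
      by (rule smooth_along_add[OF M Ja[OF pa] smooth_along_scale[OF M smooth_on_const ka]])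
    then have "smooth_along M c ?T' ?a (\<lambda>z. Jhat (?a z) (?V z))"
    proof (rule smooth_along_cong)
      fix z assume z: "z \<in> ?T'"
      have af: "?a z \<in> fib x" "?a z \<in> U" using z aT(2) Uf by blast+
      have aM: "?a z \<in> points M" using af fib by blast
      have "?V z \<in> V (?a z)" by (rule differential_inc_vertical[OF af(1) XT[OF af(2)]])
      from Jhat_eq(1)[OF aM xsD[OF z] ysV[OF z] this]
      show "J (?a z) (?p z (?V z)) + (1 / cos \<theta>) *\<^sub>R ?k z (J (?a z) (?V z - ?p z (?V z))) =
        Jhat (?a z) (?V z)" by simp
    qed
    \<comment> \<open>By \<open>slice_tangent_B\<close>, applying \<open>\<pi>\<close> to the
      ambient coordinate gives the coordinate of the transported vector in \<open>b\<close>.\<close>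
    then have "smooth_on ?T' (\<lambda>z. \<pi> (Jhat (?a z) (?V z) c))"
      unfolding smooth_along_def by (intro smooth_on_compose_linear[OF sD(7)]) blast
    then have "smooth_on ?T' (\<lambda>z. JB x (?a z) (X (?a z)) b)"
    proof (rule smooth_on_cong)
      fix z assume z: "z \<in> ?T'"
      have af: "?a z \<in> fib x" "?a z \<in> U" "?a z \<in> chart_dom b" using z aT(1,2) Uf by blast+
      note j = JB_props[OF af(1) XT[OF af(2)]]
      show "\<pi> (Jhat (?a z) (?V z) c) = JB x (?a z) (X (?a z)) b"
        using slice_tangent_B[OF sl af(3) j(1)] j(2) by simp
    qed
    then show "\<exists>W. open W \<and> z0 \<in> W \<and> smooth_on (?T \<inter> W) (\<lambda>z. JB x (?a z) (X (?a z)) b)"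
      using W(1) z0W by blast
  qed
qed

lemma almost_complex_B: "almost_complex_manifold (B x) (JB x)"
  unfolding almost_complex_manifold_def smooth_endomorphism_def points_B
  using B JB_props(1) JB_linear JB_smooth JB_JB by (intro conjI ballI allI impI image_subsetI) blast+

text \<open>The dimension of the kernel is locally constant, by the neighbourhoods from
  \<open>fiber_slice\<close>, so its level sets are open and closed.\<close>

lemma dim_vertical_constant:
  assumes con: "connected_space (mtop M)" and p: "p \<in> points M" "q \<in> points M"
  shows "dim (V p) = dim (V q)"
proof -
  have loc: "\<exists>W. openin (mtop M) W \<and> r \<in> W \<and> (\<forall>q\<in>W. dim (V q) = dim (V r))" if "r \<in> points M" for r
    by (rule fiber_slice[OF RM RN RF that]) blast
  let ?A = "{r \<in> points M. dim (V r) = dim (V p)}"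
  \<comment> \<open>An arbitrary predicate \<open>Q\<close> covers a level set and its complement in
    one argument.\<close>
  have op: "openin (mtop M) {r \<in> points M. Q (dim (V r))}" for Q
  proof (subst openin_subopen, intro ballI)
    fix r assume r: "r \<in> {r \<in> points M. Q (dim (V r))}"
    then have "r \<in> points M" by simp
    from loc[OF this] obtain W where
      W: "openin (mtop M) W" "r \<in> W" "\<forall>q\<in>W. dim (V q) = dim (V r)" by blast
    have "W \<subseteq> {r \<in> points M. Q (dim (V r))}"
    proof
      fix q assume q: "q \<in> W"
      have "q \<in> points M" using openin_subset[OF W(1)] q by blast
      moreover have "dim (V q) = dim (V r)" using W(3) q by blast
      ultimately show "q \<in> {r \<in> points M. Q (dim (V r))}" using r by simp
    qed
    then show "\<exists>T. openin (mtop M) T \<and> r \<in> T \<and> T \<subseteq> {r \<in> points M. Q (dim (V r))}"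
      using W(1,2) by blast
  qed
  have "points M - ?A = {r \<in> points M. dim (V r) \<noteq> dim (V p)}" by blast
  then have "closedin (mtop M) ?A" unfolding closedin_def using op[of "\<lambda>k. k \<noteq> dim (V p)"] by auto
  then have A: "?A = {} \<or> ?A = points M" using con op[of "\<lambda>k. k = dim (V p)"]
    unfolding connected_space_clopen_in by blast
  have "p \<in> ?A" using p by simp
  then have "q \<in> ?A" using A p(2) by blast
  then show ?thesis by simp
qed

lemma dim_chart_model_B:
  assumes b: "b \<in> atlas (B x)" and q: "q \<in> chart_dom b"
  shows "dim (chart_model b) = dim (V q)" "q \<in> points M"
proof -
  obtain c \<pi> s where sl: "slice M (fib x) b c \<pi> s" using b by (auto simp: B_def slice_manifold_simps)
  show qM: "q \<in> points M" using charts_at_slice[OF sl q] fib by blast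
  show "dim (chart_model b) = dim (V q)"
    using subspace_basis_inj[OF slice_coordinates(1,2)[OF sl q] V_subspace[OF qM]]
      slice_coordinates(3)[OF sl q] by metis
qed

lemma has_dimension_B:
  assumes con: "connected_space (mtop M)"
  shows "\<exists>k. has_dimension (B x) k"
proof (cases "points M = {}")
  \<comment> \<open>Without points there are no charts of nonempty domain, so every number is a
    dimension.\<close>
  case True
  then show ?thesis using dim_chart_model_B(2) unfolding has_dimension_def by blast
next
  case False
  then obtain p where p: "p \<in> points M" by blast
  have "has_dimension (B x) (dim (V p))"
    unfolding has_dimension_def
  proof (intro ballI impI)
    fix b assume b: "b \<in> atlas (B x)" "chart_dom b \<noteq> {}"
    then obtain q where q: "q \<in> chart_dom b" by blast
    note d = dim_chart_model_B[OF b(1) q]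
    show "dim (chart_model b) = dim (V p)" using d(1) dim_vertical_constant[OF con d(2) p] by simp
  qed
  then show ?thesis ..
qed

end

theorem theorem3p8:
  fixes M :: "('a, 'e::euclidean_space) manifold"
    and gM :: "('a, 'e) metric"
    and J :: "('a, 'e) tangent_endo"
    and N :: "('b, 'f::euclidean_space) manifold"
    and gN :: "('b, 'f) metric"
    and F :: "'a \<Rightarrow> 'b"
    and D1 :: "'a \<Rightarrow> ('a, 'e) tangent_vector set"
    and \<theta> :: real
  assumes "almost_hermitian_manifold M gM J"
    and "riemannian_manifold N gN"
    and "semi_slant_riemannian_map M gM J N gN F D1 \<theta>"
    and "0 \<le> \<theta>" and "\<theta> < pi / 2"
  shows "\<forall>x \<in> F ` points M. \<exists>(B :: ('a, 'e) manifold) (JB :: ('a, 'e) tangent_endo).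
    embedded_submanifold M (fiber M F x) B \<and>
    (connected_space (mtop M) \<longrightarrow> (\<exists>k. has_dimension B k)) \<and>
    (\<forall>p \<in> fiber M F x.
      differential B M id p ` tangent_space B p = vertical_space M N F p \<and>
      (\<forall>v \<in> tangent_space B p.
        differential B M id p (JB p v) = J_hat M gM J N F D1 \<theta> p (differential B M id p v))) \<and>
    almost_complex_manifold B JB"
proof -
  interpret semi_slant M gM J N gN F D1 \<theta> by standard (fact assms)+
  show ?thesis
    unfolding fib_def[symmetric]
    by (intro ballI, rule exI, rule exI, intro conjI impI ballI, rule embedded, erule has_dimension_B,
        erule differential_inc_image, erule (1) JB_props(2), rule almost_complex_B)
qed

end
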